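(* The universal realization $2$-functor $\mathrm{Fr}:\mathrm{LS}\to\mathrm{RLS}$, from the $2$-category of limit sketches to the $2$-category of realized limit sketches, is left $2$-adjoint to the forgetful (inclusion) $2$-functor $U:\mathrm{RLS}\to\mathrm{LS}$.
   Context: **Limit sketches.** A cone $C=(x,I,\phi,\delta)$ in a category $E$ consists of an object $x$ of $E$ (the vertex), a small category $I$, a functor $\phi:I\to E$, and a natural transformation $\delta:*_x\Rightarrow\phi$, where $*_x:I\to E$ is the constant functor at $x$. A functor $F:E\to E'$ sends it to the cone $F(C)=(F(x),I,F\circ\phi,F\delta)$. A limit sketch $(E,A,\{C_\alpha\}_{\alpha\in A})$ is a small category $E$ with a set of cones $C_\alpha=(x_\alpha,I_\alpha,\phi_\alpha,\delta_\alpha)$ in $E$ indexed by a set $A$. A morphism $(E,A,\{C_\alpha\})\to(E',B,\{C'_\beta\})$ is a pair $(F,f)$ of a functor $F:E\to E'$ and a function $f:A\to B$ such that $F(C_\alpha)=C'_{f(\alpha)}$ for all $\alpha\in A$. A 2-morphism $(F,f)\Rightarrow(G,g)$ is a natural transformation $F\Rightarrow G$. This gives the $2$-category $\mathrm{LS}$. $\mathrm{RLS}\subseteq\mathrm{LS}$ is the full sub-$2$-category on the realized limit sketches, i.e. those in which every specified cone is a limit cone. **Orthogonality.** For morphisms $f:x\to y$, $g:a\to b$ of a category, $f\downarrow g$ means that every commutative square with left side $f$ and right side $g$ has a unique diagonal filler $y\to a$. For a class $H$ of morphisms, $H^{\downarrow}=\{f\mid h\downarrow f\ \forall h\in H\}$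 and $H^{\uparrow}=\{f\mid f\downarrow h\ \forall h\in H\}$. **The object $\mathrm{Fib}_E(!)$.** $\mathbf{Cat}$ is the category of small categories, and $E/\mathbf{Cat}$ is the coslice category. Fix a limit sketch $(E,A,\{C_\alpha\}_{\alpha\in A})$ with cones $C_\alpha=(x_\alpha,I_\alpha,\phi_\alpha,\delta_\alpha)$. For $y$ an object of $E$ and $\alpha\in A$, let $i_{y,\alpha}:E\to E[y;\alpha]$ with $\gamma:i_{y,\alpha}\circ *_y\Rightarrow i_{y,\alpha}\circ\phi_\alpha$ (where $*_y:I_\alpha\to E$) be the initial triple $(D,F,\psi)$ consisting of a small category $D$, a functor $F:E\to D$ and a natural transformation $\psi:F\circ *_y\Rightarrow F\circ\phi_\alpha$ (morphisms $(D,F,\psi)\to(D',F',\psi')$ being functors $H:D\to D'$ with $HF=F'$, $H\psi=\psi'$). Let $r_{y,\alpha}:E[y;\alpha]\to E[y;\alpha]'$ be obtained by freely adjoining a morphism $f_{y,\alpha}:y\to x_\alpha$ subject to $(\delta_\alpha)_i\circ f_{y,\alpha}=\gamma_i$ for every object $i$ of $I_\alpha$. Let $\Xi_E$ be the set of all $r_{y,\alpha}$, regarded as morphisms $(E[y;\alpha],i_{y,\alpha})\to(E[y;\alpha]',r_{y,\alpha}\circ i_{y,\alpha})$ of $E/\mathbf{Cat}$, and put $\mathcal R_E=\Xi_E^{\downarrow}$, $\mathcal L_E=\Xi_E^{\downarrow\uparrow}$; this is an orthogonal factorization system on $E/\mathbf{Cat}$, with a chosen functorial factorization. Applied to the unique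 morphism $!$ in $E/\mathbf{Cat}$ from the initial object $(E,\mathrm{id}_E)$ to the terminal object (the terminal category $*$), it gives $E\xrightarrow{L_E(!)}\mathrm{Fib}_E(!)\to *$ with first map in $\mathcal L_E$ and second in $\mathcal R_E$. **The $2$-functor $\mathrm{Fr}$.** On objects, $\mathrm{Fr}(E,A,\{C_\alpha\})=(\mathrm{Fib}_E(!),A,\{L_E(!)(C_\alpha)\})$, a realized limit sketch. On 1-cells, $(F,f):(E,A,\{C_\alpha\})\to(E',B,\{C'_\beta\})$ goes to $(\hat F,f)$ with $\hat F$ the unique functor satisfying $\hat F\circ L_E(!)=L_{E'}(!)\circ F$. On 2-cells, $\theta:F\Rightarrow G$ goes to the unique $\hat\theta:\hat F\Rightarrow\hat G$ with $\hat\theta L_E(!)=L_{E'}(!)\theta$. *)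

theory Defs
  imports Main "HOL-Library.FuncSet" "HOL-Library.Equipollence"
begin

section \<open>Size\<close>

text \<open>
  HOL has no type of all sets, so smallness is a parameter. Small categories and index sets of
  sketches are carried by subsets of one type \<open>'u\<close> satisfying \<open>small\<close>; the shapes of cones are
  carried by subsets of \<open>'u\<close> satisfying \<open>ismall\<close>. The closure condition says that every small
  set lies in a small infinite set closed, up to injections, under the formation of families
  indexed by any of a small family of shapes.

  If the small sets form a Grothendieck universe, then \<open>smallness small small\<close>
  (\<open>smallness_Grothendieck\<close> below), which is the usual meaning of ``small'', the same for
  categories and for shapes. Since HOL does not prove that such a universe exists, the two
  predicates are kept apart: then every infinite type carries an instance in which all sets are
  small (\<open>smallness_UNIV\<close>), and so do the powers of an infinite type \<open>'i\<close>, with the sets of size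
  at most \<open>'i\<close> as shapes (\<open>smallness_UNIV_set\<close>).
\<close>

definition smallness :: "('u set \<Rightarrow> bool) \<Rightarrow> ('u set \<Rightarrow> bool) \<Rightarrow> bool" where
  "smallness small ismall \<longleftrightarrow>
     small {} \<and>
     (\<forall>X Y. small Y \<longrightarrow> X \<lesssim> Y \<longrightarrow> small X) \<and>
     (\<forall>X A (J :: 'u \<Rightarrow> 'u set). small X \<longrightarrow> small A \<longrightarrow> (\<forall>\<alpha>\<in>A. ismall (J \<alpha>)) \<longrightarrow>
        (\<exists>Y. small Y \<and> infinite Y \<and> X \<subseteq> Y \<and> (\<forall>\<alpha>\<in>A. (J \<alpha> \<rightarrow>\<^sub>E Y) \<lesssim> Y)))"

lemma PiE_Pow_lepoll:
  assumes "infinite Z" "J \<lesssim> Z"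
  shows "(J \<rightarrow>\<^sub>E Pow Z) \<lesssim> Pow Z"
proof -
  obtain g where g: "inj_on g J" "g ` J \<subseteq> Z"
    using assms(2) by (auto simp: lepoll_def)
  obtain p where p: "bij_betw p (Z \<times> Z) Z"
    using card_of_Times_same_infinite[OF assms(1)] card_of_ordIso by blast
  let ?G = "\<lambda>f. {(g j, z) | j z. j \<in> J \<and> z \<in> f j}"
  have sub: "?G f \<in> Pow (Z \<times> Z)" if "f \<in> J \<rightarrow>\<^sub>E Pow Z" for f
    using that g(2) by (auto simp: PiE_iff)
  have "inj_on ?G (J \<rightarrow>\<^sub>E Pow Z)"
  proof (rule inj_onI)
    fix f h assume *: "f \<in> J \<rightarrow>\<^sub>E Pow Z" "h \<in> J \<rightarrow>\<^sub>E Pow Z" "?G f = ?G h"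
    have "f j = h j" if "j \<in> J" for j
    proof -
      have "z \<in> f j \<longleftrightarrow> (g j, z) \<in> ?G f" "z \<in> h j \<longleftrightarrow> (g j, z) \<in> ?G h" for z
        using that g(1) by (auto dest: inj_onD)
      then show ?thesis using *(3) by blast
    qed
    then show "f = h" by (rule PiE_ext[OF *(1,2)])
  qed
  then have "(J \<rightarrow>\<^sub>E Pow Z) \<lesssim> Pow (Z \<times> Z)"
    unfolding lepoll_def using sub by blast
  moreover have "Pow (Z \<times> Z) \<lesssim> Pow Z"
    using bij_betw_Pow[OF p] by (intro eqpoll_imp_lepoll) (auto simp: eqpoll_def)
  ultimately show ?thesis by (rule lepoll_trans)
qed

lemma smallness_UNIV:
  assumes "infinite (UNIV :: 'u set)"
  shows "smallness (\<lambda>_. True) (\<lambda>J :: 'u set. (J \<rightarrow>\<^sub>E (UNIV :: 'u set)) \<lesssim> (UNIV :: 'u set))"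
  using assms unfolding smallness_def by (auto intro!: exI[of _ UNIV])

lemma smallness_UNIV_set:
  assumes "infinite (UNIV :: 'i set)"
  shows "smallness (\<lambda>_. True) (\<lambda>J :: 'i set set. J \<lesssim> (UNIV :: 'i set))"
  using assms PiE_Pow_lepoll[OF assms] unfolding smallness_def
  by (auto intro!: exI[of _ UNIV] simp: Finite_Set.finite_set)

lemma smallness_Grothendieck:
  fixes small :: "'u set \<Rightarrow> bool"
  assumes le: "\<And>X Y. small Y \<Longrightarrow> X \<lesssim> Y \<Longrightarrow> small X"
    and inf: "\<exists>N. small N \<and> infinite N"
    and Un: "\<And>A J. small A \<Longrightarrow> (\<And>\<alpha>. \<alpha> \<in> A \<Longrightarrow> small (J \<alpha>)) \<Longrightarrow> small (\<Union>\<alpha>\<in>A. J \<alpha>)"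
    and Pow: "\<And>X. small X \<Longrightarrow> \<exists>Y. small Y \<and> Pow X \<lesssim> Y"
  shows "smallness small small"
proof -
  obtain N where N: "small N" "infinite N" using inf by blast
  have fin: "small X" if "finite X" for X
    by (rule le[OF N(1)]) (use that N(2) finite_lepoll_infinite in blast)
  have un: "small (X \<union> Y)" if "small X" "small Y" for X Y
  proof -
    obtain a b :: 'u where "a \<noteq> b"
      using N(2) by (metis finite.emptyI finite_insert finite_subset insertI1 subsetI)
    then show ?thesis
      using Un[of "{a, b}" "\<lambda>c. if c = a then X else Y"] that fin[of "{a, b}"]
      by (simp add: Un_commute)
  qed
  have "\<exists>Y. small Y \<and> infinite Y \<and> X \<subseteq> Y \<and> (\<forall>\<alpha>\<in>A. (J \<alpha> \<rightarrow>\<^sub>E Y) \<lesssim> Y)"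
    if "small X" "small A" "\<forall>\<alpha>\<in>A. small (J \<alpha>)" for X A and J :: "'u \<Rightarrow> 'u set"
  proof -
    define Z where "Z = N \<union> X \<union> (\<Union>\<alpha>\<in>A. J \<alpha>)"
    have Z: "small Z" "infinite Z" "X \<subseteq> Z" "\<And>\<alpha>. \<alpha> \<in> A \<Longrightarrow> J \<alpha> \<lesssim> Z"
      unfolding Z_def using that N by (auto intro!: un Un subset_imp_lepoll)
    obtain W where W: "small W" "Pow Z \<lesssim> W" using Pow[OF Z(1)] by blast
    then obtain g where g: "inj_on g (Pow Z)" "g ` Pow Z \<subseteq> W" by (auto simp: lepoll_def)
    define V where "V = g ` Pow Z"
    have V: "Pow Z \<approx> V" unfolding V_def eqpoll_def using g(1) by (auto simp: bij_betw_def)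
    have "Z \<lesssim> Pow Z" unfolding lepoll_def by (rule exI[of _ "\<lambda>z. {z}"]) auto
    then have ZV: "Z \<lesssim> V" using V by (metis eqpoll_imp_lepoll lepoll_trans)
    then have infV: "infinite V" using Z(2) by (meson finite_lepoll_infinite lepoll_def finite_imageD finite_subset)
    define Y where "Y = V \<union> X"
    have XV: "X \<lesssim> V" using ZV Z(3) by (meson lepoll_trans subset_imp_lepoll)
    have "V \<union> X \<lesssim> V"
      using ordLeq_ordIso_trans[OF card_of_Un_Plus_ordLeq
          card_of_Plus_infinite1[OF infV card_of_ordLeq[THEN iffD1, OF XV[unfolded lepoll_def]]]]
      unfolding lepoll_def card_of_ordLeq .
    then have YV: "Y \<approx> V"
      unfolding Y_def by (simp add: lepoll_antisym subset_imp_lepoll)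
    have PY: "Pow Z \<approx> Y" using V YV by (metis eqpoll_sym eqpoll_trans)
    have "small V" using le[OF W(1)] g(2) unfolding V_def by (simp add: subset_imp_lepoll)
    then have "small Y" unfolding Y_def using that(1) by (rule un)
    moreover have "infinite Y" unfolding Y_def using infV by simp
    moreover have "(J \<alpha> \<rightarrow>\<^sub>E Y) \<lesssim> Y" if "\<alpha> \<in> A" for \<alpha>
    proof -
      have "(J \<alpha> \<rightarrow>\<^sub>E Y) \<lesssim> (J \<alpha> \<rightarrow>\<^sub>E Pow Z)"
        by (intro lepoll_PiE) (use PY in \<open>auto intro: eqpoll_imp_lepoll eqpoll_sym\<close>)
      also have "\<dots> \<lesssim> Pow Z" by (rule PiE_Pow_lepoll[OF Z(2) Z(4)[OF that]])
      also have "\<dots> \<lesssim> Y" using PY by (rule eqpoll_imp_lepoll)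
      finally show ?thesis .
    qed
    ultimately show ?thesis unfolding Y_def by blast
  qed
  then show ?thesis unfolding smallness_def using le fin by blast
qed

section \<open>Categories, functors, natural transformations\<close>

record ('o, 'a) cat =
  Obj :: "'o set"
  Arr :: "'a set"
  Dom :: "'a \<Rightarrow> 'o"
  Cod :: "'a \<Rightarrow> 'o"
  Idt :: "'o \<Rightarrow> 'a"
  Comp :: "'a \<Rightarrow> 'a \<Rightarrow> 'a"  \<comment> \<open>\<open>Comp C g f\<close> is \<open>g\<close> after \<open>f\<close>\<close>

definition Hom :: "('o, 'a) cat \<Rightarrow> 'o \<Rightarrow> 'o \<Rightarrow> 'a set" where
  "Hom C x y = {f \<in> Arr C. Dom C f = x \<and> Cod C f = y}"

definition category :: "('o, 'a) cat \<Rightarrow> bool" where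
  "category C \<longleftrightarrow>
     (\<forall>f\<in>Arr C. Dom C f \<in> Obj C \<and> Cod C f \<in> Obj C) \<and>
     (\<forall>x\<in>Obj C. Idt C x \<in> Hom C x x) \<and>
     (\<forall>f\<in>Arr C. \<forall>g\<in>Arr C. Dom C g = Cod C f \<longrightarrow> Comp C g f \<in> Hom C (Dom C f) (Cod C g)) \<and>
     (\<forall>f\<in>Arr C. Comp C f (Idt C (Dom C f)) = f \<and> Comp C (Idt C (Cod C f)) f = f) \<and>
     (\<forall>f\<in>Arr C. \<forall>g\<in>Arr C. \<forall>h\<in>Arr C. Dom C g = Cod C f \<longrightarrow> Dom C h = Cod C g \<longrightarrow>
        Comp C h (Comp C g f) = Comp C (Comp C h g) f)"

text \<open>
  Structure maps are \<open>undefined\<close> off their domains, so that equality of records is equality of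
  categories. The same convention is used for functors, natural transformations and cones.
\<close>

definition tight :: "('o, 'a) cat \<Rightarrow> bool" where
  "tight C \<longleftrightarrow>
     Dom C \<in> extensional (Arr C) \<and> Cod C \<in> extensional (Arr C) \<and> Idt C \<in> extensional (Obj C) \<and>
     (\<forall>g f. \<not> (f \<in> Arr C \<and> g \<in> Arr C \<and> Dom C g = Cod C f) \<longrightarrow> Comp C g f = undefined)"

type_synonym 'u scat = "('u, 'u) cat"

definition small_cat :: "('u set \<Rightarrow> bool) \<Rightarrow> 'u scat \<Rightarrow> bool" where
  "small_cat small C \<longleftrightarrow> category C \<and> tight C \<and> small (Obj C) \<and> small (Arr C)"

record ('o, 'a, 'p, 'b) fctr =
  OMap :: "'o \<Rightarrow> 'p"
  AMap :: "'a \<Rightarrow> 'b"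

type_synonym 'u sfctr = "('u, 'u, 'u, 'u) fctr"

definition functorial :: "('o, 'a) cat \<Rightarrow> ('p, 'b) cat \<Rightarrow> ('o, 'a, 'p, 'b) fctr \<Rightarrow> bool" where
  "functorial C D F \<longleftrightarrow>
     OMap F \<in> Obj C \<rightarrow> Obj D \<and> AMap F \<in> Arr C \<rightarrow> Arr D \<and>
     (\<forall>f\<in>Arr C. Dom D (AMap F f) = OMap F (Dom C f) \<and> Cod D (AMap F f) = OMap F (Cod C f)) \<and>
     (\<forall>x\<in>Obj C. AMap F (Idt C x) = Idt D (OMap F x)) \<and>
     (\<forall>f\<in>Arr C. \<forall>g\<in>Arr C. Dom C g = Cod C f \<longrightarrow>
        AMap F (Comp C g f) = Comp D (AMap F g) (AMap F f))"

definition is_functor :: "('o, 'a) cat \<Rightarrow> ('p, 'b) cat \<Rightarrow> ('o, 'a, 'p, 'b) fctr \<Rightarrow> bool" where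
  "is_functor C D F \<longleftrightarrow>
     functorial C D F \<and> OMap F \<in> extensional (Obj C) \<and> AMap F \<in> extensional (Arr C)"

definition id_fctr :: "('o, 'a) cat \<Rightarrow> ('o, 'a, 'o, 'a) fctr" where
  "id_fctr C = \<lparr>OMap = (\<lambda>x\<in>Obj C. x), AMap = (\<lambda>f\<in>Arr C. f)\<rparr>"

definition fcomp :: "('o, 'a) cat \<Rightarrow> ('p, 'b, 'q, 'c) fctr \<Rightarrow> ('o, 'a, 'p, 'b) fctr
    \<Rightarrow> ('o, 'a, 'q, 'c) fctr" where
  "fcomp C G F = \<lparr>OMap = compose (Obj C) (OMap G) (OMap F),
                  AMap = compose (Arr C) (AMap G) (AMap F)\<rparr>"

definition const_fctr :: "('o, 'a) cat \<Rightarrow> ('p, 'b) cat \<Rightarrow> 'p \<Rightarrow> ('o, 'a, 'p, 'b) fctr" where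
  "const_fctr I E x = \<lparr>OMap = (\<lambda>i\<in>Obj I. x), AMap = (\<lambda>u\<in>Arr I. Idt E x)\<rparr>"

definition is_nat :: "('o, 'a) cat \<Rightarrow> ('p, 'b) cat \<Rightarrow> ('o, 'a, 'p, 'b) fctr
    \<Rightarrow> ('o, 'a, 'p, 'b) fctr \<Rightarrow> ('o \<Rightarrow> 'b) \<Rightarrow> bool" where
  "is_nat C D F G \<tau> \<longleftrightarrow>
     \<tau> \<in> extensional (Obj C) \<and>
     (\<forall>x\<in>Obj C. \<tau> x \<in> Hom D (OMap F x) (OMap G x)) \<and>
     (\<forall>f\<in>Arr C. Comp D (\<tau> (Cod C f)) (AMap F f) = Comp D (AMap G f) (\<tau> (Dom C f)))"

definition id_nat :: "('o, 'a) cat \<Rightarrow> ('p, 'b) cat \<Rightarrow> ('o, 'a, 'p, 'b) fctr \<Rightarrow> 'o \<Rightarrow> 'b" where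
  "id_nat C D F = (\<lambda>x\<in>Obj C. Idt D (OMap F x))"

definition vcomp_nat :: "('o, 'a) cat \<Rightarrow> ('p, 'b) cat \<Rightarrow> ('o \<Rightarrow> 'b) \<Rightarrow> ('o \<Rightarrow> 'b) \<Rightarrow> 'o \<Rightarrow> 'b"
  where "vcomp_nat C D \<tau> \<sigma> = (\<lambda>x\<in>Obj C. Comp D (\<tau> x) (\<sigma> x))"

text \<open>\<open>whisker_l C H \<tau>\<close> is \<open>H \<tau>\<close>, and \<open>whisker_r C L \<tau>\<close> is \<open>\<tau> L\<close>; \<open>C\<close> is the source.\<close>

definition whisker_l :: "('o, 'a) cat \<Rightarrow> ('p, 'b, 'q, 'c) fctr \<Rightarrow> ('o \<Rightarrow> 'b) \<Rightarrow> 'o \<Rightarrow> 'c" where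
  "whisker_l C H \<tau> = (\<lambda>x\<in>Obj C. AMap H (\<tau> x))"

definition whisker_r :: "('o, 'a) cat \<Rightarrow> ('o, 'a, 'p, 'b) fctr \<Rightarrow> ('p \<Rightarrow> 'c) \<Rightarrow> 'o \<Rightarrow> 'c" where
  "whisker_r C L \<tau> = (\<lambda>x\<in>Obj C. \<tau> (OMap L x))"

section \<open>Orthogonality and factorizations\<close>

definition orthogonal :: "('o, 'a) cat \<Rightarrow> 'a \<Rightarrow> 'a \<Rightarrow> bool" where
  "orthogonal C f g \<longleftrightarrow>
     (\<forall>u \<in> Hom C (Dom C f) (Dom C g). \<forall>v \<in> Hom C (Cod C f) (Cod C g).
        Comp C g u = Comp C v f \<longrightarrow>
        (\<exists>!d. d \<in> Hom C (Cod C f) (Dom C g) \<and> Comp C d f = u \<and> Comp C g d = v))"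

definition right_orth :: "('o, 'a) cat \<Rightarrow> 'a set \<Rightarrow> 'a set" where
  "right_orth C H = {f \<in> Arr C. \<forall>h\<in>H. orthogonal C h f}"

definition left_orth :: "('o, 'a) cat \<Rightarrow> 'a set \<Rightarrow> 'a set" where
  "left_orth C H = {f \<in> Arr C. \<forall>h\<in>H. orthogonal C f h}"

definition factorization :: "('o, 'a) cat \<Rightarrow> 'a set \<Rightarrow> 'a set \<Rightarrow> 'a \<Rightarrow> 'a \<times> 'a \<Rightarrow> bool" where
  "factorization C L R f = (\<lambda>(l, r). l \<in> L \<and> r \<in> R \<and> Cod C l = Dom C r \<and> Comp C r l = f)"

section \<open>The coslice category of small categories under a small category\<close>

type_synonym 'u cobj = "'u scat \<times> 'u sfctr"
type_synonym 'u carr = "'u cobj \<times> 'u cobj \<times> 'u sfctr"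

definition coslice :: "('u set \<Rightarrow> bool) \<Rightarrow> 'u scat \<Rightarrow> ('u cobj, 'u carr) cat" where
  "coslice small E =
     (let Ob = {(D, P). small_cat small D \<and> is_functor E D P} in
     \<lparr>Obj = Ob,
      Arr = {((D, P), (D', P'), H). (D, P) \<in> Ob \<and> (D', P') \<in> Ob \<and>
               is_functor D D' H \<and> fcomp E H P = P'},
      Dom = (\<lambda>(X, Y, H). X),
      Cod = (\<lambda>(X, Y, H). Y),
      Idt = (\<lambda>X. (X, X, id_fctr (fst X))),
      Comp = (\<lambda>(Y', Z, K) (X, Y, H). (X, Z, fcomp (fst X) K H))\<rparr>)"

definition terminal_cat :: "'u scat" where
  "terminal_cat =
     (let p = undefined in
     \<lparr>Obj = {p}, Arr = {p}, Dom = (\<lambda>f\<in>{p}. p), Cod = (\<lambda>f\<in>{p}. p), Idt = (\<lambda>x\<in>{p}. p),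
      Comp = (\<lambda>g f. p)\<rparr>)"

definition bang :: "'u scat \<Rightarrow> 'u carr" where
  "bang E =
     (let t = const_fctr E terminal_cat (undefined :: 'u)
      in ((E, id_fctr E), (terminal_cat, t), t))"

section \<open>Limit sketches\<close>

record 'u cone =
  Vertex :: 'u
  Shape :: "'u scat"
  Diagram :: "'u sfctr"
  Leg :: "'u \<Rightarrow> 'u"

definition cone_in :: "('u set \<Rightarrow> bool) \<Rightarrow> 'u scat \<Rightarrow> 'u cone \<Rightarrow> bool" where
  "cone_in ismall E c \<longleftrightarrow>
     Vertex c \<in> Obj E \<and> small_cat ismall (Shape c) \<and> is_functor (Shape c) E (Diagram c) \<and>
     is_nat (Shape c) E (const_fctr (Shape c) E (Vertex c)) (Diagram c) (Leg c)"

definition map_cone :: "'u sfctr \<Rightarrow> 'u cone \<Rightarrow> 'u cone" where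
  "map_cone F c =
     \<lparr>Vertex = OMap F (Vertex c), Shape = Shape c, Diagram = fcomp (Shape c) F (Diagram c),
      Leg = whisker_l (Shape c) F (Leg c)\<rparr>"

definition limit_cone :: "'u scat \<Rightarrow> 'u cone \<Rightarrow> bool" where
  "limit_cone E c \<longleftrightarrow>
     (\<forall>y \<in> Obj E. \<forall>\<tau>. is_nat (Shape c) E (const_fctr (Shape c) E y) (Diagram c) \<tau> \<longrightarrow>
        (\<exists>!h. h \<in> Hom E y (Vertex c) \<and> (\<forall>i \<in> Obj (Shape c). Comp E (Leg c i) h = \<tau> i)))"

record 'u sketch =
  Base :: "'u scat"
  Ix :: "'u set"
  Cone :: "'u \<Rightarrow> 'u cone"

definition limit_sketch :: "('u set \<Rightarrow> bool) \<Rightarrow> ('u set \<Rightarrow> bool) \<Rightarrow> 'u sketch \<Rightarrow> bool" where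
  "limit_sketch small ismall S \<longleftrightarrow>
     small_cat small (Base S) \<and> small (Ix S) \<and> Cone S \<in> extensional (Ix S) \<and>
     (\<forall>\<alpha>\<in>Ix S. cone_in ismall (Base S) (Cone S \<alpha>))"

definition realized :: "'u sketch \<Rightarrow> bool" where
  "realized S \<longleftrightarrow> (\<forall>\<alpha>\<in>Ix S. limit_cone (Base S) (Cone S \<alpha>))"

record 'u smor =
  MSrc :: "'u sketch"
  MTrg :: "'u sketch"
  MFun :: "'u sfctr"
  MIx :: "'u \<Rightarrow> 'u"

definition sketch_mor :: "'u smor \<Rightarrow> bool" where
  "sketch_mor m \<longleftrightarrow>
     is_functor (Base (MSrc m)) (Base (MTrg m)) (MFun m) \<and>
     MIx m \<in> Ix (MSrc m) \<rightarrow>\<^sub>E Ix (MTrg m) \<and>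
     (\<forall>\<alpha>\<in>Ix (MSrc m). map_cone (MFun m) (Cone (MSrc m) \<alpha>) = Cone (MTrg m) (MIx m \<alpha>))"

record 'u s2mor =
  TSrc :: "'u smor"
  TTrg :: "'u smor"
  TNat :: "'u \<Rightarrow> 'u"

definition sketch_2mor :: "'u s2mor \<Rightarrow> bool" where
  "sketch_2mor t \<longleftrightarrow>
     MSrc (TSrc t) = MSrc (TTrg t) \<and> MTrg (TSrc t) = MTrg (TTrg t) \<and>
     is_nat (Base (MSrc (TSrc t))) (Base (MTrg (TSrc t))) (MFun (TSrc t)) (MFun (TTrg t)) (TNat t)"

section \<open>Strict 2-categories, 2-functors and 2-adjunctions\<close>

record ('o, 'f, 'c) two_cat =
  Cell0 :: "'o set"
  Cell1 :: "'f set"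
  Cell2 :: "'c set"
  Src1 :: "'f \<Rightarrow> 'o"
  Trg1 :: "'f \<Rightarrow> 'o"
  Src2 :: "'c \<Rightarrow> 'f"
  Trg2 :: "'c \<Rightarrow> 'f"
  Id1 :: "'o \<Rightarrow> 'f"
  Id2 :: "'f \<Rightarrow> 'c"
  Comp1 :: "'f \<Rightarrow> 'f \<Rightarrow> 'f"
  VComp :: "'c \<Rightarrow> 'c \<Rightarrow> 'c"
  HComp :: "'c \<Rightarrow> 'c \<Rightarrow> 'c"

text \<open>
  The three categories underlying a 2-category: 0-cells and 1-cells; 1-cells and 2-cells under
  vertical composition; 0-cells and 2-cells under horizontal composition.
\<close>

definition cat1 :: "('o, 'f, 'c) two_cat \<Rightarrow> ('o, 'f) cat" where
  "cat1 K = \<lparr>Obj = Cell0 K, Arr = Cell1 K, Dom = Src1 K, Cod = Trg1 K, Idt = Id1 K,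
             Comp = Comp1 K\<rparr>"

definition catV :: "('o, 'f, 'c) two_cat \<Rightarrow> ('f, 'c) cat" where
  "catV K = \<lparr>Obj = Cell1 K, Arr = Cell2 K, Dom = Src2 K, Cod = Trg2 K, Idt = Id2 K,
             Comp = VComp K\<rparr>"

definition catH :: "('o, 'f, 'c) two_cat \<Rightarrow> ('o, 'c) cat" where
  "catH K = \<lparr>Obj = Cell0 K, Arr = Cell2 K, Dom = (\<lambda>a. Src1 K (Src2 K a)),
             Cod = (\<lambda>a. Trg1 K (Src2 K a)), Idt = (\<lambda>x. Id2 K (Id1 K x)), Comp = HComp K\<rparr>"

definition two_category :: "('o, 'f, 'c) two_cat \<Rightarrow> bool" where
  "two_category K \<longleftrightarrow>
     category (cat1 K) \<and> category (catV K) \<and> category (catH K) \<and>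
     (\<forall>a\<in>Cell2 K. Src1 K (Src2 K a) = Src1 K (Trg2 K a) \<and>
                  Trg1 K (Src2 K a) = Trg1 K (Trg2 K a)) \<and>
     (\<forall>a\<in>Cell2 K. \<forall>b\<in>Cell2 K. Src1 K (Src2 K b) = Trg1 K (Src2 K a) \<longrightarrow>
        Src2 K (HComp K b a) = Comp1 K (Src2 K b) (Src2 K a) \<and>
        Trg2 K (HComp K b a) = Comp1 K (Trg2 K b) (Trg2 K a)) \<and>
     (\<forall>f\<in>Cell1 K. \<forall>g\<in>Cell1 K. Src1 K g = Trg1 K f \<longrightarrow>
        HComp K (Id2 K g) (Id2 K f) = Id2 K (Comp1 K g f)) \<and>
     (\<forall>a\<in>Cell2 K. \<forall>a'\<in>Cell2 K. \<forall>b\<in>Cell2 K. \<forall>b'\<in>Cell2 K.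
        Src2 K a' = Trg2 K a \<longrightarrow> Src2 K b' = Trg2 K b \<longrightarrow>
        Src1 K (Src2 K b) = Trg1 K (Src2 K a) \<longrightarrow>
        HComp K (VComp K b' b) (VComp K a' a) = VComp K (HComp K b' a') (HComp K b a))"

definition full_sub :: "('o, 'f, 'c) two_cat \<Rightarrow> ('o \<Rightarrow> bool) \<Rightarrow> ('o, 'f, 'c) two_cat" where
  "full_sub K P =
     K\<lparr>Cell0 := {x \<in> Cell0 K. P x},
       Cell1 := {f \<in> Cell1 K. P (Src1 K f) \<and> P (Trg1 K f)},
       Cell2 := {a \<in> Cell2 K. P (Src1 K (Src2 K a)) \<and> P (Trg1 K (Src2 K a))}\<rparr>"

record ('o, 'f, 'c, 'p, 'g, 'd) two_fun =
  F0 :: "'o \<Rightarrow> 'p"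
  F1 :: "'f \<Rightarrow> 'g"
  F2 :: "'c \<Rightarrow> 'd"

definition two_functor :: "('o, 'f, 'c) two_cat \<Rightarrow> ('p, 'g, 'd) two_cat
    \<Rightarrow> ('o, 'f, 'c, 'p, 'g, 'd) two_fun \<Rightarrow> bool" where
  "two_functor K M F \<longleftrightarrow>
     functorial (cat1 K) (cat1 M) \<lparr>OMap = F0 F, AMap = F1 F\<rparr> \<and>
     functorial (catV K) (catV M) \<lparr>OMap = F1 F, AMap = F2 F\<rparr> \<and>
     functorial (catH K) (catH M) \<lparr>OMap = F0 F, AMap = F2 F\<rparr>"

definition two_id :: "('o, 'f, 'c, 'o, 'f, 'c) two_fun" where
  "two_id = \<lparr>F0 = id, F1 = id, F2 = id\<rparr>"

definition two_comp :: "('p, 'g, 'd, 'q, 'h, 'e) two_fun \<Rightarrow> ('o, 'f, 'c, 'p, 'g, 'd) two_fun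
    \<Rightarrow> ('o, 'f, 'c, 'q, 'h, 'e) two_fun" where
  "two_comp G F = \<lparr>F0 = F0 G \<circ> F0 F, F1 = F1 G \<circ> F1 F, F2 = F2 G \<circ> F2 F\<rparr>"

definition two_natural :: "('o, 'f, 'c) two_cat \<Rightarrow> ('p, 'g, 'd) two_cat
    \<Rightarrow> ('o, 'f, 'c, 'p, 'g, 'd) two_fun \<Rightarrow> ('o, 'f, 'c, 'p, 'g, 'd) two_fun
    \<Rightarrow> ('o \<Rightarrow> 'g) \<Rightarrow> bool" where
  "two_natural K M F G \<eta> \<longleftrightarrow>
     (\<forall>x\<in>Cell0 K. \<eta> x \<in> Hom (cat1 M) (F0 F x) (F0 G x)) \<and>
     (\<forall>f\<in>Cell1 K. Comp1 M (\<eta> (Trg1 K f)) (F1 F f) = Comp1 M (F1 G f) (\<eta> (Src1 K f))) \<and>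
     (\<forall>a\<in>Cell2 K. HComp M (Id2 M (\<eta> (Trg1 K (Src2 K a)))) (F2 F a) =
                  HComp M (F2 G a) (Id2 M (\<eta> (Src1 K (Src2 K a)))))"

text \<open>\<open>F\<close> is left 2-adjoint to \<open>G\<close>, by 2-natural unit and counit.\<close>

definition left_two_adjoint :: "('o, 'f, 'c) two_cat \<Rightarrow> ('p, 'g, 'd) two_cat
    \<Rightarrow> ('o, 'f, 'c, 'p, 'g, 'd) two_fun \<Rightarrow> ('p, 'g, 'd, 'o, 'f, 'c) two_fun \<Rightarrow> bool" where
  "left_two_adjoint K M F G \<longleftrightarrow>
     two_category K \<and> two_category M \<and> two_functor K M F \<and> two_functor M K G \<and>
     (\<exists>\<eta> \<epsilon>. two_natural K K two_id (two_comp G F) \<eta> \<and>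
            two_natural M M (two_comp F G) two_id \<epsilon> \<and>
            (\<forall>x\<in>Cell0 K. Comp1 M (\<epsilon> (F0 F x)) (F1 F (\<eta> x)) = Id1 M (F0 F x)) \<and>
            (\<forall>y\<in>Cell0 M. Comp1 K (F1 G (\<epsilon> y)) (\<eta> (F0 G y)) = Id1 K (F0 G y)))"

section \<open>The 2-categories of limit sketches and of realized limit sketches\<close>

definition smor_comp :: "'u smor \<Rightarrow> 'u smor \<Rightarrow> 'u smor" where
  "smor_comp n m =
     \<lparr>MSrc = MSrc m, MTrg = MTrg n, MFun = fcomp (Base (MSrc m)) (MFun n) (MFun m),
      MIx = compose (Ix (MSrc m)) (MIx n) (MIx m)\<rparr>"

definition LS :: "('u set \<Rightarrow> bool) \<Rightarrow> ('u set \<Rightarrow> bool)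
    \<Rightarrow> ('u sketch, 'u smor, 'u s2mor) two_cat" where
  "LS small ismall =
     (let one = {m. limit_sketch small ismall (MSrc m) \<and> limit_sketch small ismall (MTrg m) \<and>
                    sketch_mor m} in
     \<lparr>Cell0 = {S. limit_sketch small ismall S},
      Cell1 = one,
      Cell2 = {t. TSrc t \<in> one \<and> TTrg t \<in> one \<and> sketch_2mor t},
      Src1 = MSrc, Trg1 = MTrg, Src2 = TSrc, Trg2 = TTrg,
      Id1 = (\<lambda>S. \<lparr>MSrc = S, MTrg = S, MFun = id_fctr (Base S), MIx = (\<lambda>\<alpha>\<in>Ix S. \<alpha>)\<rparr>),
      Id2 = (\<lambda>m. \<lparr>TSrc = m, TTrg = m,
                  TNat = id_nat (Base (MSrc m)) (Base (MTrg m)) (MFun m)\<rparr>),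
      Comp1 = smor_comp,
      VComp = (\<lambda>t s. \<lparr>TSrc = TSrc s, TTrg = TTrg t,
                      TNat = vcomp_nat (Base (MSrc (TSrc s))) (Base (MTrg (TSrc s)))
                               (TNat t) (TNat s)\<rparr>),
      HComp = (\<lambda>t s.
        let m = TSrc s; m' = TTrg s; n = TSrc t; n' = TTrg t; E = Base (MSrc m)
        in \<lparr>TSrc = smor_comp n m, TTrg = smor_comp n' m',
            TNat = vcomp_nat E (Base (MTrg n)) (whisker_r E (MFun m') (TNat t))
                                               (whisker_l E (MFun n) (TNat s))\<rparr>)\<rparr>)"

definition RLS :: "('u set \<Rightarrow> bool) \<Rightarrow> ('u set \<Rightarrow> bool)
    \<Rightarrow> ('u sketch, 'u smor, 'u s2mor) two_cat" where
  "RLS small ismall = full_sub (LS small ismall) realized"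

definition forget :: "('u sketch, 'u smor, 'u s2mor, 'u sketch, 'u smor, 'u s2mor) two_fun" where
  "forget = \<lparr>F0 = (\<lambda>S. S), F1 = (\<lambda>m. m), F2 = (\<lambda>t. t)\<rparr>"

section \<open>The generating morphisms\<close>

text \<open>
  \<open>adjoin_cone small E y c D i \<gamma>\<close>: the triple \<open>(D, i, \<gamma>)\<close> is initial among small categories \<open>D\<close>
  with a functor \<open>i : E \<rightarrow> D\<close> and a natural transformation \<open>\<gamma> : i \<circ> *\<^sub>y \<Rightarrow> i \<circ> \<phi>\<close>, where \<open>\<phi>\<close> is
  the diagram of \<open>c\<close>.
\<close>

definition cone_triple :: "('u set \<Rightarrow> bool) \<Rightarrow> 'u scat \<Rightarrow> 'u \<Rightarrow> 'u cone
    \<Rightarrow> 'u scat \<Rightarrow> 'u sfctr \<Rightarrow> ('u \<Rightarrow> 'u) \<Rightarrow> bool" where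
  "cone_triple small E y c D F \<psi> \<longleftrightarrow>
     small_cat small D \<and> is_functor E D F \<and>
     is_nat (Shape c) D (fcomp (Shape c) F (const_fctr (Shape c) E y))
                        (fcomp (Shape c) F (Diagram c)) \<psi>"

definition adjoin_cone :: "('u set \<Rightarrow> bool) \<Rightarrow> 'u scat \<Rightarrow> 'u \<Rightarrow> 'u cone
    \<Rightarrow> 'u scat \<Rightarrow> 'u sfctr \<Rightarrow> ('u \<Rightarrow> 'u) \<Rightarrow> bool" where
  "adjoin_cone small E y c D i \<gamma> \<longleftrightarrow>
     cone_triple small E y c D i \<gamma> \<and>
     (\<forall>D' F' \<psi>'. cone_triple small E y c D' F' \<psi>' \<longrightarrow>
        (\<exists>!H. is_functor D D' H \<and> fcomp E H i = F' \<and> whisker_l (Shape c) H \<gamma> = \<psi>'))"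

text \<open>
  \<open>adjoin_lift small D c i y \<gamma> D' r f\<close>: the functor \<open>r : D \<rightarrow> D'\<close> freely adjoins to \<open>D\<close> an arrow
  \<open>f : i y \<rightarrow> i x\<close>, where \<open>x\<close> is the vertex of \<open>c\<close>, such that composition with the images of the
  legs of \<open>c\<close> gives \<open>\<gamma>\<close>.
\<close>

definition lift_triple :: "('u set \<Rightarrow> bool) \<Rightarrow> 'u scat \<Rightarrow> 'u cone \<Rightarrow> 'u sfctr \<Rightarrow> 'u
    \<Rightarrow> ('u \<Rightarrow> 'u) \<Rightarrow> 'u scat \<Rightarrow> 'u sfctr \<Rightarrow> 'u \<Rightarrow> bool" where
  "lift_triple small D c i y \<gamma> D' r f \<longleftrightarrow>
     small_cat small D' \<and> is_functor D D' r \<and>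
     f \<in> Hom D' (OMap r (OMap i y)) (OMap r (OMap i (Vertex c))) \<and>
     (\<forall>j\<in>Obj (Shape c). Comp D' (AMap r (AMap i (Leg c j))) f = AMap r (\<gamma> j))"

definition adjoin_lift :: "('u set \<Rightarrow> bool) \<Rightarrow> 'u scat \<Rightarrow> 'u cone \<Rightarrow> 'u sfctr \<Rightarrow> 'u
    \<Rightarrow> ('u \<Rightarrow> 'u) \<Rightarrow> 'u scat \<Rightarrow> 'u sfctr \<Rightarrow> 'u \<Rightarrow> bool" where
  "adjoin_lift small D c i y \<gamma> D' r f \<longleftrightarrow>
     lift_triple small D c i y \<gamma> D' r f \<and>
     (\<forall>D'' r'' f''. lift_triple small D c i y \<gamma> D'' r'' f'' \<longrightarrow>
        (\<exists>!H. is_functor D' D'' H \<and> fcomp D H r = r'' \<and> AMap H f = f''))"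

text \<open>
  The universal properties determine the generators up to isomorphism only; \<open>Xi\<close> contains all of
  them, which does not affect the classes orthogonal to it.
\<close>

definition Xi :: "('u set \<Rightarrow> bool) \<Rightarrow> 'u sketch \<Rightarrow> 'u carr set" where
  "Xi small S =
     {((D, i), (D', fcomp (Base S) r i), r) | D i D' r.
        \<exists>y\<in>Obj (Base S). \<exists>\<alpha>\<in>Ix S. \<exists>\<gamma> f.
          adjoin_cone small (Base S) y (Cone S \<alpha>) D i \<gamma> \<and>
          adjoin_lift small D (Cone S \<alpha>) i y \<gamma> D' r f}"

definition Rclass :: "('u set \<Rightarrow> bool) \<Rightarrow> 'u sketch \<Rightarrow> 'u carr set" where
  "Rclass small S = right_orth (coslice small (Base S)) (Xi small S)"

definition Lclass :: "('u set \<Rightarrow> bool) \<Rightarrow> 'u sketch \<Rightarrow> 'u carr set" where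
  "Lclass small S = left_orth (coslice small (Base S)) (Rclass small S)"

section \<open>Universal realization\<close>

text \<open>
  Of the chosen factorizations of morphisms of the coslice category, only that of the morphism
  from the initial to the terminal object is used. Its existence is not assumed: it has to be
  proved for the choice to mean anything.
\<close>

definition bang_factorization :: "('u set \<Rightarrow> bool) \<Rightarrow> 'u sketch \<Rightarrow> 'u carr \<times> 'u carr" where
  "bang_factorization small S =
     (SOME lr. factorization (coslice small (Base S)) (Lclass small S) (Rclass small S)
                 (bang (Base S)) lr)"

definition Fib :: "('u set \<Rightarrow> bool) \<Rightarrow> 'u sketch \<Rightarrow> 'u scat" where
  "Fib small S = (case fst (bang_factorization small S) of (_, (D, _), _) \<Rightarrow> D)"

definition Lbang :: "('u set \<Rightarrow> bool) \<Rightarrow> 'u sketch \<Rightarrow> 'u sfctr" where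
  "Lbang small S = (case fst (bang_factorization small S) of (_, _, H) \<Rightarrow> H)"

definition Fr0 :: "('u set \<Rightarrow> bool) \<Rightarrow> 'u sketch \<Rightarrow> 'u sketch" where
  "Fr0 small S =
     \<lparr>Base = Fib small S, Ix = Ix S, Cone = (\<lambda>\<alpha>\<in>Ix S. map_cone (Lbang small S) (Cone S \<alpha>))\<rparr>"

definition Fr1 :: "('u set \<Rightarrow> bool) \<Rightarrow> 'u smor \<Rightarrow> 'u smor" where
  "Fr1 small m =
     (let S = MSrc m; T = MTrg m in
     \<lparr>MSrc = Fr0 small S, MTrg = Fr0 small T,
      MFun = (THE Fh. is_functor (Fib small S) (Fib small T) Fh \<and>
                fcomp (Base S) Fh (Lbang small S) = fcomp (Base S) (Lbang small T) (MFun m)),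
      MIx = MIx m\<rparr>)"

definition Fr2 :: "('u set \<Rightarrow> bool) \<Rightarrow> 'u s2mor \<Rightarrow> 'u s2mor" where
  "Fr2 small t =
     (let m = TSrc t; n = TTrg t; S = MSrc m; T = MTrg m in
     \<lparr>TSrc = Fr1 small m, TTrg = Fr1 small n,
      TNat = (THE \<theta>. is_nat (Fib small S) (Fib small T)
                         (MFun (Fr1 small m)) (MFun (Fr1 small n)) \<theta> \<and>
                whisker_r (Base S) (Lbang small S) \<theta> =
                whisker_l (Base S) (Lbang small T) (TNat t))\<rparr>)"

definition Fr :: "('u set \<Rightarrow> bool)
    \<Rightarrow> ('u sketch, 'u smor, 'u s2mor, 'u sketch, 'u smor, 'u s2mor) two_fun" where
  "Fr small = \<lparr>F0 = Fr0 small, F1 = Fr1 small, F2 = Fr2 small\<rparr>"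

end

theory Submission
  imports Defs
begin

text \<open>
  Call a functor \<open>P : E \<rightarrow> X\<close> a model of the sketch if every cone from \<open>P y\<close>, with \<open>y\<close> an object of
  \<open>E\<close>, over the image of the diagram of a specified cone factors uniquely through the image of its
  vertex. The map from \<open>X\<close> to the terminal category is in the right class iff \<open>P\<close> is a model. In the
  product of all models, consider the subcategory on the objects of \<open>E\<close> generated by the arrows of
  \<open>E\<close> under composition and under the arrows induced by cones. It is small by the closure condition
  on sizes, although the product is not, and it is an initial model. Its structure functor is in the
  left class: the pullback of \<open>p : X \<rightarrow> Y\<close> in the right class along a functor from the initial model
  to \<open>Y\<close> is again a model, and a section of it gives the diagonal filler.

  Thus \<open>Fib\<close> is an initial model and \<open>E \<rightarrow> Fib\<close> is bijective on objects, so that the cones in \<open>Fib\<close>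
  are limit cones. A natural transformation extends along \<open>E \<rightarrow> Fib\<close> because the arrows at which the
  extended family is natural contain the image of \<open>E\<close> and are closed under the generating operations.
  The 2-adjunction is a formal consequence of these universal properties of \<open>E \<rightarrow> Fib\<close>.
\<close>

section \<open>Categories and functors\<close>

text \<open>The models on subsets of \<open>'u\<close> form a set in HOL, so no solution-set
  argument is called for, but they are indexed by a type larger than \<open>'u\<close>. Hence the
  product of all models cannot be a category on \<open>'u\<close>, and only suitable subcategories
  are brought back, by an injection of their arrows. Their size is bounded in one step: an arrow is
  the value of a well-founded term whose immediate subterms are represented by elements of a set
  \<open>Y\<close>, and the closure condition says that families of elements of \<open>Y\<close>
  over the shapes can again be coded in \<open>Y\<close>. Quotients never occur: two parallel arrows
  are equal as soon as they are equal in each factor. The free categories behind the generators are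
  obtained in the same way, from the product of all categories in which the required relations hold.
  Since \<open>Fib\<close> comes from a choice, only its membership in the two classes is known at
  first; bijectivity on objects and generation are carried over to it from the constructed initial
  model.\<close>

lemma HomD:
  assumes "f \<in> Hom C x y"
  shows "f \<in> Arr C" "Dom C f = x" "Cod C f = y"
  using assms by (auto simp: Hom_def)

lemma arr_Hom: "f \<in> Arr C \<Longrightarrow> f \<in> Hom C (Dom C f) (Cod C f)"
  by (simp add: Hom_def)

lemma Hom_Obj:
  assumes "category C" "f \<in> Hom C x y"
  shows "x \<in> Obj C" "y \<in> Obj C"
  using assms by (auto simp: category_def Hom_def)

lemma arr_Obj:
  assumes "category C" "f \<in> Arr C"
  shows "Dom C f \<in> Obj C" "Cod C f \<in> Obj C"
  using assms by (auto simp: category_def)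

lemma Idt_Hom: "category C \<Longrightarrow> x \<in> Obj C \<Longrightarrow> Idt C x \<in> Hom C x x"
  by (simp add: category_def)

lemma Comp_Hom: "category C \<Longrightarrow> f \<in> Hom C x y \<Longrightarrow> g \<in> Hom C y z \<Longrightarrow> Comp C g f \<in> Hom C x z"
  by (auto simp: category_def Hom_def)

lemma Comp_Idt: "category C \<Longrightarrow> f \<in> Hom C x y \<Longrightarrow> Comp C f (Idt C x) = f"
  by (auto simp: category_def Hom_def)

lemma Idt_Comp: "category C \<Longrightarrow> f \<in> Hom C x y \<Longrightarrow> Comp C (Idt C y) f = f"
  by (auto simp: category_def Hom_def)

lemma Comp_assoc:
  "category C \<Longrightarrow> f \<in> Hom C x y \<Longrightarrow> g \<in> Hom C y z \<Longrightarrow> h \<in> Hom C z w \<Longrightarrow>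
    Comp C h (Comp C g f) = Comp C (Comp C h g) f"
  by (auto simp: category_def Hom_def)

lemma categoryI:
  assumes "\<And>f. f \<in> Arr C \<Longrightarrow> Dom C f \<in> Obj C \<and> Cod C f \<in> Obj C"
    and "\<And>x. x \<in> Obj C \<Longrightarrow> Idt C x \<in> Hom C x x"
    and "\<And>x y z f g. f \<in> Hom C x y \<Longrightarrow> g \<in> Hom C y z \<Longrightarrow> Comp C g f \<in> Hom C x z"
    and "\<And>x y f. f \<in> Hom C x y \<Longrightarrow> Comp C f (Idt C x) = f"
    and "\<And>x y f. f \<in> Hom C x y \<Longrightarrow> Comp C (Idt C y) f = f"
    and "\<And>x y z w f g h. f \<in> Hom C x y \<Longrightarrow> g \<in> Hom C y z \<Longrightarrow> h \<in> Hom C z w \<Longrightarrow>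
           Comp C h (Comp C g f) = Comp C (Comp C h g) f"
  shows "category C"
  unfolding category_def
  by (intro conjI ballI impI) (use assms in \<open>auto simp: Hom_def\<close>)

lemma functorial_Obj: "functorial C D F \<Longrightarrow> x \<in> Obj C \<Longrightarrow> OMap F x \<in> Obj D"
  by (auto simp: functorial_def)

lemma functorial_Hom:
  "functorial C D F \<Longrightarrow> f \<in> Hom C x y \<Longrightarrow> AMap F f \<in> Hom D (OMap F x) (OMap F y)"
  by (auto simp: functorial_def Hom_def)

lemma functorial_Comp:
  "functorial C D F \<Longrightarrow> f \<in> Hom C x y \<Longrightarrow> g \<in> Hom C y z \<Longrightarrow>
    AMap F (Comp C g f) = Comp D (AMap F g) (AMap F f)"
  by (auto simp: functorial_def Hom_def)

lemma functorialI:
  assumes "\<And>x. x \<in> Obj C \<Longrightarrow> OMap F x \<in> Obj D"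
    and "\<And>f x y. f \<in> Hom C x y \<Longrightarrow> AMap F f \<in> Hom D (OMap F x) (OMap F y)"
    and "\<And>x. x \<in> Obj C \<Longrightarrow> AMap F (Idt C x) = Idt D (OMap F x)"
    and "\<And>x y z f g. f \<in> Hom C x y \<Longrightarrow> g \<in> Hom C y z \<Longrightarrow>
           AMap F (Comp C g f) = Comp D (AMap F g) (AMap F f)"
  shows "functorial C D F"
  unfolding functorial_def using assms by (auto simp: Hom_def)

lemma is_functorI:
  assumes "\<And>x. x \<in> Obj C \<Longrightarrow> OMap F x \<in> Obj D"
    and "\<And>f x y. f \<in> Hom C x y \<Longrightarrow> AMap F f \<in> Hom D (OMap F x) (OMap F y)"
    and "\<And>x. x \<in> Obj C \<Longrightarrow> AMap F (Idt C x) = Idt D (OMap F x)"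
    and "\<And>x y z f g. f \<in> Hom C x y \<Longrightarrow> g \<in> Hom C y z \<Longrightarrow>
           AMap F (Comp C g f) = Comp D (AMap F g) (AMap F f)"
    and "OMap F \<in> extensional (Obj C)" "AMap F \<in> extensional (Arr C)"
  shows "is_functor C D F"
  unfolding is_functor_def using assms by (auto intro: functorialI)

lemma is_functorD: "is_functor C D F \<Longrightarrow> functorial C D F"
  by (simp add: is_functor_def)

lemmas fun_Obj = functorial_Obj[OF is_functorD]
lemmas fun_Hom = functorial_Hom[OF is_functorD]
lemmas fun_Comp = functorial_Comp[OF is_functorD]

lemma fun_Idt: "is_functor C D F \<Longrightarrow> x \<in> Obj C \<Longrightarrow> AMap F (Idt C x) = Idt D (OMap F x)"
  by (simp add: is_functor_def functorial_def)

lemma fun_arr: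
  assumes "is_functor C D F" "f \<in> Arr C"
  shows "AMap F f \<in> Arr D" "Dom D (AMap F f) = OMap F (Dom C f)" "Cod D (AMap F f) = OMap F (Cod C f)"
  using assms by (auto simp: is_functor_def functorial_def)

lemma fctr_eqI:
  assumes "is_functor C D F" "is_functor C D' G"
    and "\<And>x. x \<in> Obj C \<Longrightarrow> OMap F x = OMap G x"
    and "\<And>f. f \<in> Arr C \<Longrightarrow> AMap F f = AMap G f"
  shows "F = G"
proof -
  have "OMap F = OMap G" "AMap F = AMap G"
    using assms unfolding is_functor_def by (auto intro: extensionalityI)
  then show ?thesis by (cases F; cases G) simp
qed

lemma fcomp_OMap [simp]: "x \<in> Obj C \<Longrightarrow> OMap (fcomp C G F) x = OMap G (OMap F x)"
  by (simp add: fcomp_def compose_def)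

lemma fcomp_AMap [simp]: "f \<in> Arr C \<Longrightarrow> AMap (fcomp C G F) f = AMap G (AMap F f)"
  by (simp add: fcomp_def compose_def)

lemma fcomp_functor:
  assumes "category C" "is_functor C D F" "is_functor D D' G"
  shows "is_functor C D' (fcomp C G F)"
proof (rule is_functorI)
  show "OMap (fcomp C G F) \<in> extensional (Obj C)" "AMap (fcomp C G F) \<in> extensional (Arr C)"
    by (simp_all add: fcomp_def)
next
  fix x assume x: "x \<in> Obj C"
  then show "OMap (fcomp C G F) x \<in> Obj D'" using assms by (auto intro: fun_Obj)
  show "AMap (fcomp C G F) (Idt C x) = Idt D' (OMap (fcomp C G F) x)"
    using x assms HomD(1)[OF Idt_Hom[OF assms(1) x]] by (simp add: fun_Idt fun_Obj)
next
  fix f x y assume f: "f \<in> Hom C x y"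
  then show "AMap (fcomp C G F) f \<in> Hom D' (OMap (fcomp C G F) x) (OMap (fcomp C G F) y)"
    using fun_Hom[OF assms(3) fun_Hom[OF assms(2) f]] Hom_Obj[OF assms(1) f] HomD(1)[OF f] by simp
  fix z g assume g: "g \<in> Hom C y z"
  show "AMap (fcomp C G F) (Comp C g f) = Comp D' (AMap (fcomp C G F) g) (AMap (fcomp C G F) f)"
    using HomD(1)[OF Comp_Hom[OF assms(1) f g]] HomD(1)[OF f] HomD(1)[OF g]
      fun_Comp[OF assms(2) f g] fun_Comp[OF assms(3) fun_Hom[OF assms(2) f] fun_Hom[OF assms(2) g]]
    by simp
qed

lemma id_fctr_OMap [simp]: "x \<in> Obj C \<Longrightarrow> OMap (id_fctr C) x = x"
  by (simp add: id_fctr_def)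

lemma id_fctr_AMap [simp]: "f \<in> Arr C \<Longrightarrow> AMap (id_fctr C) f = f"
  by (simp add: id_fctr_def)

lemma id_functor:
  assumes "category C" shows "is_functor C C (id_fctr C)"
proof (rule is_functorI)
  fix f x y assume f: "f \<in> Hom C x y"
  then show "AMap (id_fctr C) f \<in> Hom C (OMap (id_fctr C) x) (OMap (id_fctr C) y)"
    using Hom_Obj[OF assms f] HomD(1)[OF f] by simp
  fix z g assume g: "g \<in> Hom C y z"
  show "AMap (id_fctr C) (Comp C g f) = Comp C (AMap (id_fctr C) g) (AMap (id_fctr C) f)"
    using HomD(1)[OF Comp_Hom[OF assms f g]] HomD(1)[OF f] HomD(1)[OF g] by simp
qed (use HomD(1)[OF Idt_Hom[OF assms]] in \<open>auto simp: id_fctr_def\<close>)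

lemma fcomp_id_right: "is_functor C D F \<Longrightarrow> fcomp C F (id_fctr C) = F"
  by (cases F) (auto simp: fcomp_def id_fctr_def is_functor_def compose_def extensional_def fun_eq_iff)

lemma fcomp_id_left: "is_functor C D F \<Longrightarrow> fcomp C (id_fctr D) F = F"
  by (cases F) (auto simp: fcomp_def id_fctr_def is_functor_def functorial_def compose_def
      extensional_def fun_eq_iff Pi_iff)

lemma fcomp_assoc:
  "is_functor C D F \<Longrightarrow> fcomp C H (fcomp C G F) = fcomp C (fcomp D H G) F"
  by (auto simp: fcomp_def is_functor_def functorial_def compose_def fun_eq_iff Pi_iff)

lemma const_functor:
  assumes "category C" "category D" "x \<in> Obj D"
  shows "is_functor C D (const_fctr C D x)"
proof (rule is_functorI)
  fix f a b assume f: "f \<in> Hom C a b"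
  show "AMap (const_fctr C D x) f \<in> Hom D (OMap (const_fctr C D x) a) (OMap (const_fctr C D x) b)"
    using Hom_Obj[OF assms(1) f] HomD(1)[OF f] Idt_Hom[OF assms(2,3)] by (simp add: const_fctr_def)
  fix c g assume g: "g \<in> Hom C b c"
  show "AMap (const_fctr C D x) (Comp C g f) =
      Comp D (AMap (const_fctr C D x) g) (AMap (const_fctr C D x) f)"
    using HomD(1)[OF Comp_Hom[OF assms(1) f g]] HomD(1)[OF f] HomD(1)[OF g]
      Comp_Idt[OF assms(2) Idt_Hom[OF assms(2,3)]] by (simp add: const_fctr_def)
qed (use HomD(1)[OF Idt_Hom[OF assms(1)]] assms(3) in \<open>auto simp: const_fctr_def\<close>)

lemma fcomp_const:
  assumes "category C" "is_functor D D' F" "x \<in> Obj D"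
  shows "fcomp C F (const_fctr C D x) = const_fctr C D' (OMap F x)"
  using assms fun_Idt[OF assms(2,3)]
  by (auto simp: fcomp_def const_fctr_def compose_def fun_eq_iff)

lemma small_catD:
  assumes "small_cat small C"
  shows "category C" "tight C" "small (Obj C)" "small (Arr C)"
  using assms by (auto simp: small_cat_def)

section \<open>Cones over a diagram\<close>

text \<open>The identities of the constant functor are already cancelled, and \<open>P\<close> is
  kept apart from \<open>\<phi>\<close>. So a cone is a plain family of arrows that functors out of
  \<open>X\<close> transport.\<close>

definition cone_over :: "('u, 'u) cat \<Rightarrow> 'u sfctr \<Rightarrow> 'u scat \<Rightarrow> 'u sfctr \<Rightarrow> 'u \<Rightarrow> ('u \<Rightarrow> 'u) \<Rightarrow> bool" where
  "cone_over I \<phi> X P y \<tau> \<longleftrightarrow>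
     \<tau> \<in> extensional (Obj I) \<and> (\<forall>i\<in>Obj I. \<tau> i \<in> Hom X (OMap P y) (OMap P (OMap \<phi> i))) \<and>
     (\<forall>u\<in>Arr I. Comp X (AMap P (AMap \<phi> u)) (\<tau> (Dom I u)) = \<tau> (Cod I u))"

lemma is_nat_const:
  assumes "category I" "category X" "is_functor I X \<psi>" "z \<in> Obj X"
  shows "is_nat I X (const_fctr I X z) \<psi> \<tau> \<longleftrightarrow>
    \<tau> \<in> extensional (Obj I) \<and> (\<forall>i\<in>Obj I. \<tau> i \<in> Hom X z (OMap \<psi> i)) \<and>
     (\<forall>u\<in>Arr I. Comp X (AMap \<psi> u) (\<tau> (Dom I u)) = \<tau> (Cod I u))"
proof -
  have "Comp X (\<tau> (Cod I u)) (Idt X z) = \<tau> (Cod I u)"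
    if "\<forall>i\<in>Obj I. \<tau> i \<in> Hom X z (OMap \<psi> i)" "u \<in> Arr I" for u
    using that arr_Obj[OF assms(1) that(2)] Comp_Idt[OF assms(2)] by blast
  then show ?thesis unfolding is_nat_def by (auto simp: const_fctr_def)
qed

lemma is_nat_cone_over:
  assumes "category I" "category E" "category X" "is_functor I E \<phi>" "is_functor E X P" "y \<in> Obj E"
  shows "is_nat I X (const_fctr I X (OMap P y)) (fcomp I P \<phi>) \<tau> \<longleftrightarrow> cone_over I \<phi> X P y \<tau>"
  using is_nat_const[OF assms(1,3) fcomp_functor[OF assms(1,4,5)] fun_Obj[OF assms(5,6)]]
  by (auto simp: cone_over_def)

lemma cone_triple_iff:
  assumes "category E" "category (Shape c)" "is_functor (Shape c) E (Diagram c)" "y \<in> Obj E"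
  shows "cone_triple small E y c D F \<psi> \<longleftrightarrow>
    small_cat small D \<and> is_functor E D F \<and> cone_over (Shape c) (Diagram c) D F y \<psi>"
  unfolding cone_triple_def
  using assms is_nat_cone_over[OF assms(2,1) small_catD(1) assms(3) _ assms(4)]
  by (auto simp: fcomp_const)

lemma cone_over_map:
  assumes "category I" "is_functor I E \<phi>" "is_functor E X P" "is_functor X X' H" "y \<in> Obj E"
    and "cone_over I \<phi> X P y \<tau>"
  shows "cone_over I \<phi> X' (fcomp E H P) y (whisker_l I H \<tau>)"
proof -
  have "Comp X' (AMap H (AMap P (AMap \<phi> u))) (AMap H (\<tau> (Dom I u))) = AMap H (\<tau> (Cod I u))"
    if u: "u \<in> Arr I" for u
  proof -
    have 1: "\<tau> (Dom I u) \<in> Hom X (OMap P y) (OMap P (OMap \<phi> (Dom I u)))"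
      using assms(6) arr_Obj(1)[OF assms(1) u] by (auto simp: cone_over_def)
    have 2: "AMap P (AMap \<phi> u) \<in> Hom X (OMap P (OMap \<phi> (Dom I u))) (OMap P (OMap \<phi> (Cod I u)))"
      by (intro fun_Hom[OF assms(3)] fun_Hom[OF assms(2)] arr_Hom u)
    show ?thesis
      using fun_Comp[OF assms(4) 1 2] assms(6) u by (simp add: cone_over_def)
  qed
  then show ?thesis
    using assms unfolding cone_over_def whisker_l_def
    by (auto simp: arr_Obj fun_Obj fun_arr intro!: fun_Hom)
qed

section \<open>Cardinality of closures\<close>

lemma lepoll_card: "A \<lesssim> B \<longleftrightarrow> (card_of A, card_of B) \<in> ordLeq"
  unfolding lepoll_def by (rule card_of_ordLeq)

lemma Times_lepoll_self: "infinite Y \<Longrightarrow> Y \<times> Y \<lesssim> Y"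
  unfolding lepoll_card by (rule ordIso_imp_ordLeq[OF card_of_Times_same_infinite])

lemma Plus_lepoll_self: "infinite Y \<Longrightarrow> A \<lesssim> Y \<Longrightarrow> B \<lesssim> Y \<Longrightarrow> A <+> B \<lesssim> Y"
  using card_of_Plus_ordLeq_infinite_Field[of "card_of Y", OF _ _ _ card_of_Card_order]
  unfolding lepoll_card Field_card_of .

lemma Sigma_lepoll_self: "infinite Y \<Longrightarrow> A \<lesssim> Y \<Longrightarrow> (\<And>a. a \<in> A \<Longrightarrow> B a \<lesssim> Y) \<Longrightarrow> Sigma A B \<lesssim> Y"
  unfolding lepoll_card by (rule card_of_Sigma_ordLeq_infinite) auto

lemma Un_lepoll_self:
  assumes "infinite Y" "A \<lesssim> Y" "B \<lesssim> Y" shows "A \<union> B \<lesssim> Y"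
  using card_of_Un_ordLeq_infinite_Field[of "card_of Y", OF _ _ _ card_of_Card_order] assms
  unfolding lepoll_card Field_card_of by blast

text \<open>The operations are partial: \<open>Q\<close> and \<open>P\<close> say where
  \<open>m\<close> and \<open>op k\<close> apply. A family is extensional, so that its values on
  \<open>ar k\<close> determine it; the counting of terms below relies on this.\<close>

inductive_set closure_ops :: "'x set \<Rightarrow> ('x \<Rightarrow> 'x \<Rightarrow> bool) \<Rightarrow> ('x \<Rightarrow> 'x \<Rightarrow> 'x) \<Rightarrow> 'k set
    \<Rightarrow> ('k \<Rightarrow> 'j set) \<Rightarrow> ('k \<Rightarrow> ('j \<Rightarrow> 'x) \<Rightarrow> bool) \<Rightarrow> ('k \<Rightarrow> ('j \<Rightarrow> 'x) \<Rightarrow> 'x) \<Rightarrow> 'x set"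
  for B Q m K ar P op where
  base: "b \<in> B \<Longrightarrow> b \<in> closure_ops B Q m K ar P op"
| bin: "x \<in> closure_ops B Q m K ar P op \<Longrightarrow> y \<in> closure_ops B Q m K ar P op \<Longrightarrow> Q x y \<Longrightarrow>
    m x y \<in> closure_ops B Q m K ar P op"
| fam: "k \<in> K \<Longrightarrow> f \<in> extensional (ar k) \<Longrightarrow>
    (\<And>j. j \<in> ar k \<Longrightarrow> f j \<in> closure_ops B Q m K ar P op) \<Longrightarrow> P k f \<Longrightarrow>
    op k f \<in> closure_ops B Q m K ar P op"

text \<open>
  Terms are coded in \<open>Y\<close> by an injection \<open>c\<close>; a term evaluates to at most one element, although
  an element may be the value of many terms.
\<close>

inductive evaluates :: "(('x + 'y \<times> 'y) + ('k \<times> ('j \<Rightarrow> 'y)) \<Rightarrow> 'y) \<Rightarrow> 'y set \<Rightarrow> 'x set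
    \<Rightarrow> ('x \<Rightarrow> 'x \<Rightarrow> bool) \<Rightarrow> ('x \<Rightarrow> 'x \<Rightarrow> 'x) \<Rightarrow> 'k set
    \<Rightarrow> ('k \<Rightarrow> 'j set) \<Rightarrow> ('k \<Rightarrow> ('j \<Rightarrow> 'x) \<Rightarrow> bool) \<Rightarrow> ('k \<Rightarrow> ('j \<Rightarrow> 'x) \<Rightarrow> 'x) \<Rightarrow> 'y \<Rightarrow> 'x \<Rightarrow> bool"
  for c Y B Q m K ar P op where
  "b \<in> B \<Longrightarrow> evaluates c Y B Q m K ar P op (c (Inl (Inl b))) b"
| "s \<in> Y \<Longrightarrow> t \<in> Y \<Longrightarrow> evaluates c Y B Q m K ar P op s x \<Longrightarrow> evaluates c Y B Q m K ar P op t y \<Longrightarrow>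
    Q x y \<Longrightarrow> evaluates c Y B Q m K ar P op (c (Inl (Inr (s, t)))) (m x y)"
| "k \<in> K \<Longrightarrow> h \<in> ar k \<rightarrow>\<^sub>E Y \<Longrightarrow> f \<in> extensional (ar k) \<Longrightarrow>
    (\<And>j. j \<in> ar k \<Longrightarrow> evaluates c Y B Q m K ar P op (h j) (f j)) \<Longrightarrow> P k f \<Longrightarrow>
    evaluates c Y B Q m K ar P op (c (Inr (k, h))) (op k f)"

text \<open>Every element of the closure has a code, and a code evaluates to at most one element, so
  a choice of codes is injective. Subterms enter a code only through their own codes; it is
  therefore enough that one layer of terms over \<open>Y\<close> injects into \<open>Y\<close>,
  without transfinite stages or regular cardinals.\<close>

lemma closure_ops_lepoll:
  assumes Y: "infinite Y" and B: "B \<lesssim> Y" and K: "K \<lesssim> Y"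
    and ar: "\<And>k. k \<in> K \<Longrightarrow> (ar k \<rightarrow>\<^sub>E Y) \<lesssim> Y"
  shows "closure_ops B Q m K ar P op \<lesssim> Y"
proof -
  \<comment> \<open>One layer of terms over codes: generators, binary applications, applications to
    families.\<close>
  let ?C = "(B <+> (Y \<times> Y)) <+> (SIGMA k:K. ar k \<rightarrow>\<^sub>E Y)"
  have "?C \<lesssim> Y"
    by (intro Plus_lepoll_self Sigma_lepoll_self Times_lepoll_self assms)
  then obtain c where c: "inj_on c ?C" "c ` ?C \<subseteq> Y" by (auto simp: lepoll_def)
  let ?ev = "evaluates c Y B Q m K ar P op"
  have c_eq: "p = q" if "c p = c q" "p \<in> ?C" "q \<in> ?C" for p q
    using inj_onD[OF c(1)] that by blast
  \<comment> \<open>Induction on the first derivation: injectivity of \<open>c\<close> forces the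
    second one to end with the same rule applied to the same codes.\<close>
  have fn: "\<forall>x'. ?ev t x' \<longrightarrow> x' = x" if "?ev t x" for t x
    using that
  proof induction
    case (1 b)
    show ?case
    proof (intro allI impI)
      fix x' assume "?ev (c (Inl (Inl b))) x'"
      then show "x' = b"
      proof cases
        case 1
        then show ?thesis using c_eq[OF 1(1)] \<open>b \<in> B\<close> by auto
      next
        case (2 s t x y)
        then show ?thesis using c_eq[OF 2(1)] \<open>b \<in> B\<close> by auto
      next
        case (3 k h f)
        then show ?thesis using c_eq[OF 3(1)] \<open>b \<in> B\<close> by auto
      qed
    qed
  next
    case (2 s t x y)
    note st = \<open>s \<in> Y\<close> \<open>t \<in> Y\<close>
    show ?case
    proof (intro allI impI)
      fix x' assume "?ev (c (Inl (Inr (s, t)))) x'"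
      then show "x' = m x y"
      proof cases
        case 1
        then show ?thesis using c_eq[OF 1(1)] st by auto
      next
        case (2 s' t' x' y')
        then have "s' = s" "t' = t" using c_eq[OF 2(1)] st by auto
        then show ?thesis using 2 "2.IH" by blast
      next
        case (3 k h f)
        then show ?thesis using c_eq[OF 3(1)] st by auto
      qed
    qed
  next
    case (3 k h f)
    note kh = \<open>k \<in> K\<close> \<open>h \<in> ar k \<rightarrow>\<^sub>E Y\<close> and ext = \<open>f \<in> extensional (ar k)\<close>
    show ?case
    proof (intro allI impI)
      fix x' assume "?ev (c (Inr (k, h))) x'"
      then show "x' = op k f"
      proof cases
        case 1
        then show ?thesis using c_eq[OF 1(1)] kh by auto
      next
        case (2 s t x y)
        then show ?thesis using c_eq[OF 2(1)] kh by auto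
      next
        case (3 k' h' f')
        then have e: "k' = k" "h' = h" using c_eq[OF 3(1)] kh by auto
        have "f' j = f j" if "j \<in> ar k" for j using "3.IH"[OF that] 3(6)[of j] e that by blast
        \<comment> \<open>The induction hypothesis compares values on the arity only; extensionality
          does the rest.\<close>
        then have "f' = f" using 3(5) ext e by (auto intro: extensionalityI)
        then show ?thesis using 3 e by simp
      qed
    qed
  qed
  have ex: "\<exists>t\<in>Y. ?ev t x" if "x \<in> closure_ops B Q m K ar P op" for x
    using that
  proof induction
    case (base b)
    then show ?case using c(2) by (intro bexI[of _ "c (Inl (Inl b))"]) (auto intro: evaluates.intros)
  next
    case (bin x y)
    then obtain s t where "s \<in> Y" "t \<in> Y" "?ev s x" "?ev t y" by blast
    then show ?case using c(2) bin
      by (intro bexI[of _ "c (Inl (Inr (s, t)))"]) (auto intro: evaluates.intros)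
  next
    case (fam k f)
    then obtain h where h: "\<And>j. j \<in> ar k \<Longrightarrow> h j \<in> Y \<and> ?ev (h j) (f j)" by metis
    have "?ev (c (Inr (k, restrict h (ar k)))) (op k f)"
      using fam h by (intro evaluates.intros) auto
    moreover have "c (Inr (k, restrict h (ar k))) \<in> Y"
      using c(2) fam(1) h by (intro subsetD[OF c(2)] imageI) auto
    ultimately show ?case by blast
  qed
  from ex obtain e where e: "\<And>x. x \<in> closure_ops B Q m K ar P op \<Longrightarrow> e x \<in> Y \<and> ?ev (e x) x" by metis
  have "inj_on e (closure_ops B Q m K ar P op)"
    by (rule inj_onI) (metis e fn)
  then show ?thesis unfolding lepoll_def using e by (intro exI[of _ e]) auto
qed

section \<open>Smallness\<close>

text \<open>Names the two parameters only: that limit sketches form a 2-category holds for arbitrary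
  size predicates. The smallness condition is added in the extension
  \<open>size_pair\<close>.\<close>

locale sketch_size =
  fixes small ismall :: "'u set \<Rightarrow> bool"

locale size_pair = sketch_size small ismall
  for small ismall :: "'u set \<Rightarrow> bool" +
  assumes smallness: "smallness small ismall"
begin

lemma small_lepoll: "small Y \<Longrightarrow> X \<lesssim> Y \<Longrightarrow> small X"
  using smallness unfolding smallness_def by blast

lemma small_closed:
  assumes "small X" "small A" "\<And>\<alpha>. \<alpha> \<in> A \<Longrightarrow> ismall (J \<alpha>)"
  obtains Y where "small Y" "infinite Y" "X \<subseteq> Y" "\<And>\<alpha>. \<alpha> \<in> A \<Longrightarrow> (J \<alpha> \<rightarrow>\<^sub>E Y) \<lesssim> Y"
  using smallness assms unfolding smallness_def by metis

lemma small_infinite: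
  assumes "small X"
  obtains Y where "small Y" "infinite Y" "X \<subseteq> Y"
  using small_closed[of X "{}" "\<lambda>_. {}"] assms smallness unfolding smallness_def
  by (metis empty_iff)

text \<open>By comparability of cardinals, one of two infinite small supersets bounds both sets.
  Closure of small sets under unions is deduced from this.\<close>

lemma small_bound:
  assumes "small X" "small X'"
  obtains Y where "small Y" "infinite Y" "X \<lesssim> Y" "X' \<lesssim> Y"
proof -
  obtain Y where Y: "small Y" "infinite Y" "X \<subseteq> Y" using small_infinite[OF assms(1)] .
  obtain Y' where Y': "small Y'" "infinite Y'" "X' \<subseteq> Y'" using small_infinite[OF assms(2)] .
  consider "Y \<lesssim> Y'" | "Y' \<lesssim> Y" using ordLeq_total[OF card_of_Well_order card_of_Well_order]
    unfolding lepoll_card by blast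
  then show ?thesis
  proof cases
    case 1
    then show ?thesis using that[of Y'] Y Y' by (metis lepoll_trans subset_imp_lepoll)
  next
    case 2
    then show ?thesis using that[of Y] Y Y' by (metis lepoll_trans subset_imp_lepoll)
  qed
qed

lemma small_Un: "small X \<Longrightarrow> small X' \<Longrightarrow> small (X \<union> X')"
  by (metis small_bound Un_lepoll_self small_lepoll)

lemma small_finite:
  assumes "finite X" shows "small X"
proof -
  have "small {}" using smallness unfolding smallness_def by blast
  then obtain Y where "small Y" "infinite Y" using small_infinite by blast
  then show ?thesis using small_lepoll finite_lepoll_infinite assms by blast
qed

text \<open>The indicator functions of points, with two elements of \<open>Y\<close> as values,
  embed \<open>J\<close> into the function space, which the closure condition bounds by
  \<open>Y\<close>.\<close>

lemma ismall_small:
  assumes "ismall J" shows "small J"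
proof -
  obtain Y where Y: "small Y" "infinite Y" "(J \<rightarrow>\<^sub>E Y) \<lesssim> Y"
    by (rule small_closed[of "{}" "{undefined}" "\<lambda>_. J"]) (use assms in \<open>auto intro: small_finite\<close>)
  obtain a where a: "a \<in> Y" using Y(2) by fastforce
  obtain b where b: "b \<in> Y" "b \<noteq> a"
    using Y(2) by (metis finite.emptyI finite_insert finite_subset insertI1 subsetI)
  have "J \<lesssim> (J \<rightarrow>\<^sub>E Y)"
    unfolding lepoll_def
    by (rule exI[of _ "\<lambda>j. \<lambda>i\<in>J. if i = j then a else b"])
      (use a b in \<open>auto simp: inj_on_def fun_eq_iff restrict_def split: if_splits\<close>)
  then show ?thesis using Y small_lepoll lepoll_trans by blast
qed

end

section \<open>Subcategories of products\<close>

text \<open>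
  \<open>(x, a, y)\<close> stands for an arrow from \<open>F x\<close> to \<open>F y\<close> in the product of the categories \<open>X m\<close>,
  where \<open>F\<close> is the functor induced by the functors \<open>F m\<close> out of \<open>E\<close>. Since the index \<open>m\<close> may
  range over a type larger than \<open>'u\<close>, only small sets \<open>G\<close> of such arrows are carried over to \<open>'u\<close>.
\<close>

type_synonym ('u, 'm) tup = "'u \<times> ('m \<Rightarrow> 'u) \<times> 'u"

definition base_tup :: "'u scat \<Rightarrow> 'm set \<Rightarrow> ('m \<Rightarrow> 'u sfctr) \<Rightarrow> 'u \<Rightarrow> ('u, 'm) tup" where
  "base_tup E M F f = (Dom E f, \<lambda>m\<in>M. AMap (F m) f, Cod E f)"

definition comp_tup :: "'m set \<Rightarrow> ('m \<Rightarrow> 'u scat) \<Rightarrow> ('u, 'm) tup \<Rightarrow> ('u, 'm) tup \<Rightarrow> ('u, 'm) tup" where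
  "comp_tup M X g f =
     (fst f, \<lambda>m\<in>M. Comp (X m) (fst (snd g) m) (fst (snd f) m), snd (snd g))"

definition valid_tup :: "'u scat \<Rightarrow> 'm set \<Rightarrow> ('m \<Rightarrow> 'u scat) \<Rightarrow> ('m \<Rightarrow> 'u sfctr) \<Rightarrow> ('u, 'm) tup \<Rightarrow> bool" where
  "valid_tup E M X F = (\<lambda>(x, a, y). x \<in> Obj E \<and> y \<in> Obj E \<and> a \<in> extensional M \<and>
     (\<forall>m\<in>M. a m \<in> Hom (X m) (OMap (F m) x) (OMap (F m) y)))"

text \<open>The binary operation receives the first arrow first, hence the exchanged arguments of
  \<open>comp_tup\<close>. Identities are present as images of identities of \<open>E\<close>,
  because all objects are objects of \<open>E\<close>.\<close>

abbreviation generated_tups :: "'u scat \<Rightarrow> 'm set \<Rightarrow> ('m \<Rightarrow> 'u scat) \<Rightarrow> ('m \<Rightarrow> 'u sfctr)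
    \<Rightarrow> ('u, 'm) tup set \<Rightarrow> 'k set \<Rightarrow> ('k \<Rightarrow> 'j set) \<Rightarrow> ('k \<Rightarrow> ('j \<Rightarrow> ('u, 'm) tup) \<Rightarrow> bool)
    \<Rightarrow> ('k \<Rightarrow> ('j \<Rightarrow> ('u, 'm) tup) \<Rightarrow> ('u, 'm) tup) \<Rightarrow> ('u, 'm) tup set" where
  "generated_tups E M X F B K ar P op \<equiv> closure_ops (base_tup E M F ` Arr E \<union> B)
     (\<lambda>f g. snd (snd f) = fst g) (\<lambda>f g. comp_tup M X g f) K ar P op"

text \<open>Describes \<open>D\<close> by jointly faithful projections, so that the coding of tuples
  in \<open>'u\<close> stays hidden. \<open>G\<close> is arbitrary because it will be a generated
  set in one place and the set of all compatible pairs of a pullback in another. Tuples record their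
  endpoints because the functors \<open>F m\<close> may identify objects.\<close>

locale tuple_cat =
  fixes E :: "'u scat" and M :: "'m set" and X :: "'m \<Rightarrow> 'u scat" and F :: "'m \<Rightarrow> 'u sfctr"
    and G :: "('u, 'm) tup set" and D :: "'u scat" and L :: "'u sfctr" and \<pi> :: "'m \<Rightarrow> 'u sfctr"
  assumes cat_E: "category E" and cat_D: "category D"
    and cat_X: "\<And>m. m \<in> M \<Longrightarrow> category (X m)"
    and fun_F: "\<And>m. m \<in> M \<Longrightarrow> is_functor E (X m) (F m)"
    and Obj_D: "Obj D = Obj E"
    and fun_L: "is_functor E D L"
    and OMap_L: "\<And>x. x \<in> Obj E \<Longrightarrow> OMap L x = x"
    and proj: "\<And>m. m \<in> M \<Longrightarrow> is_functor D (X m) (\<pi> m)"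
    and proj_L: "\<And>m. m \<in> M \<Longrightarrow> fcomp E (\<pi> m) L = F m"
    and valid: "\<And>t. t \<in> G \<Longrightarrow> valid_tup E M X F t"
    and tup_arr: "\<And>x a y. (x, a, y) \<in> G \<Longrightarrow> \<exists>f\<in>Hom D x y. \<forall>m\<in>M. AMap (\<pi> m) f = a m"
    and arr_tup: "\<And>f. f \<in> Arr D \<Longrightarrow> (Dom D f, \<lambda>m\<in>M. AMap (\<pi> m) f, Cod D f) \<in> G"
    and faithful: "\<And>x y f g. f \<in> Hom D x y \<Longrightarrow> g \<in> Hom D x y \<Longrightarrow>
           (\<And>m. m \<in> M \<Longrightarrow> AMap (\<pi> m) f = AMap (\<pi> m) g) \<Longrightarrow> f = g"

text \<open>The arrows of \<open>D\<close> are the images of \<open>G\<close> under an injection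
  into \<open>Y\<close>; the objects are those of \<open>E\<close> and need no coding.\<close>

lemma tuple_cat_exists:
  fixes E :: "'u scat" and M :: "'m set" and Y :: "'u set"
  assumes E: "category E"
    and X: "\<And>m. m \<in> M \<Longrightarrow> category (X m)" "\<And>m. m \<in> M \<Longrightarrow> is_functor E (X m) (F m)"
    and val: "\<And>t. t \<in> G \<Longrightarrow> valid_tup E M X F t"
    and bas: "\<And>f. f \<in> Arr E \<Longrightarrow> base_tup E M F f \<in> G"
    and cmp: "\<And>f g. f \<in> G \<Longrightarrow> g \<in> G \<Longrightarrow> snd (snd f) = fst g \<Longrightarrow> comp_tup M X g f \<in> G"
    and size: "G \<lesssim> Y"
  shows "\<exists>D L \<pi>. tuple_cat E M X F G D L \<pi> \<and> tight D \<and> Arr D \<lesssim> Y"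
proof -
  obtain c where c: "inj_on c G" "c ` G \<subseteq> Y" using size by (auto simp: lepoll_def)
  let ?i = "the_inv_into G c"
  have i [simp]: "?i (c g) = g" if "g \<in> G" for g using the_inv_into_f_f[OF c(1) that] .
  define D :: "'u scat" where "D = \<lparr>Obj = Obj E, Arr = c ` G, Dom = (\<lambda>a\<in>c ` G. fst (?i a)),
    Cod = (\<lambda>a\<in>c ` G. snd (snd (?i a))), Idt = (\<lambda>x\<in>Obj E. c (base_tup E M F (Idt E x))),
    Comp = (\<lambda>g f. if f \<in> c ` G \<and> g \<in> c ` G \<and> fst (?i g) = snd (snd (?i f))
             then c (comp_tup M X (?i g) (?i f)) else undefined)\<rparr>"
  define L :: "'u sfctr" where "L = \<lparr>OMap = (\<lambda>x\<in>Obj E. x), AMap = (\<lambda>f\<in>Arr E. c (base_tup E M F f))\<rparr>"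
  define \<pi> :: "'m \<Rightarrow> 'u sfctr" where
    "\<pi> m = \<lparr>OMap = OMap (F m), AMap = (\<lambda>a\<in>c ` G. fst (snd (?i a)) m)\<rparr>" for m
  have Hom: "f \<in> Hom D x y \<longleftrightarrow> (\<exists>a. (x, a, y) \<in> G \<and> f = c (x, a, y))" for f x y
    unfolding Hom_def D_def by (force simp: image_iff)
  have Cmp: "Comp D (c (y, b, z)) (c (x, a, y)) = c (x, \<lambda>m\<in>M. Comp (X m) (b m) (a m), z)"
    if "(x, a, y) \<in> G" "(y, b, z) \<in> G" for x y z a b
    using that by (simp add: D_def comp_tup_def)
  have cG: "(x, \<lambda>m\<in>M. Comp (X m) (b m) (a m), z) \<in> G" if "(x, a, y) \<in> G" "(y, b, z) \<in> G" for x y z a b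
    using cmp[OF that] by (simp add: comp_tup_def)
  have Id: "Idt D x = c (x, \<lambda>m\<in>M. Idt (X m) (OMap (F m) x), x)"
    "(x, \<lambda>m\<in>M. Idt (X m) (OMap (F m) x), x) \<in> G" if "x \<in> Obj E" for x
  proof -
    have "base_tup E M F (Idt E x) = (x, \<lambda>m\<in>M. Idt (X m) (OMap (F m) x), x)"
      using HomD[OF Idt_Hom[OF E that]] X that by (auto simp: base_tup_def fun_eq_iff fun_Idt)
    then show "Idt D x = c (x, \<lambda>m\<in>M. Idt (X m) (OMap (F m) x), x)"
      "(x, \<lambda>m\<in>M. Idt (X m) (OMap (F m) x), x) \<in> G"
      using bas[OF HomD(1)[OF Idt_Hom[OF E that]]] that by (simp_all add: D_def)
  qed
  have vl: "x \<in> Obj E" "y \<in> Obj E" "a \<in> extensional M"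
    "m \<in> M \<Longrightarrow> a m \<in> Hom (X m) (OMap (F m) x) (OMap (F m) y)" if "(x, a, y) \<in> G" for x a y m
    using val[OF that] by (auto simp: valid_tup_def)
  have ObjD: "Obj D = Obj E" by (simp add: D_def)
  have catD: "category D"
  proof (rule categoryI)
    fix f assume "f \<in> Arr D"
    then obtain x a y where g: "(x, a, y) \<in> G" "f = c (x, a, y)" by (auto simp: D_def)
    then show "Dom D f \<in> Obj D \<and> Cod D f \<in> Obj D" using vl[OF g(1)] by (simp add: D_def)
  next
    fix x assume "x \<in> Obj D"
    then show "Idt D x \<in> Hom D x x" using Id unfolding ObjD Hom by blast
  next
    fix x y z f g assume "f \<in> Hom D x y" "g \<in> Hom D y z"
    then obtain a b where g: "(x, a, y) \<in> G" "f = c (x, a, y)" "(y, b, z) \<in> G" "g = c (y, b, z)"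
      unfolding Hom by blast
    then show "Comp D g f \<in> Hom D x z" using cG[OF g(1,3)] Cmp[OF g(1,3)] unfolding Hom by blast
  next
    fix x y f assume "f \<in> Hom D x y"
    then obtain a where g: "(x, a, y) \<in> G" "f = c (x, a, y)" unfolding Hom by blast
    have e: "(\<lambda>m\<in>M. Comp (X m) (a m) ((\<lambda>m\<in>M. Idt (X m) (OMap (F m) x)) m)) = a"
      "(\<lambda>m\<in>M. Comp (X m) ((\<lambda>m\<in>M. Idt (X m) (OMap (F m) y)) m) (a m)) = a"
      using vl[OF g(1)] by (auto intro!: extensionalityI[of _ M] simp: Comp_Idt[OF X(1) vl(4)[OF g(1)]] Idt_Comp[OF X(1) vl(4)[OF g(1)]])
    show "Comp D f (Idt D x) = f" "Comp D (Idt D y) f = f"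
      using Cmp[OF Id(2)[OF vl(1)[OF g(1)]] g(1)] Cmp[OF g(1) Id(2)[OF vl(2)[OF g(1)]]]
        Id(1)[OF vl(1)[OF g(1)]] Id(1)[OF vl(2)[OF g(1)]] g(2) e by simp_all
  next
    fix x y z w f g h assume "f \<in> Hom D x y" "g \<in> Hom D y z" "h \<in> Hom D z w"
    then obtain p q r where g: "(x, p, y) \<in> G" "f = c (x, p, y)" "(y, q, z) \<in> G" "g = c (y, q, z)"
      "(z, r, w) \<in> G" "h = c (z, r, w)"
      unfolding Hom by blast
    have "(\<lambda>m\<in>M. Comp (X m) (r m) (Comp (X m) (q m) (p m))) =
        (\<lambda>m\<in>M. Comp (X m) (Comp (X m) (r m) (q m)) (p m))"
      by (rule restrict_ext)
        (rule Comp_assoc[OF X(1) vl(4)[OF g(1)] vl(4)[OF g(3)] vl(4)[OF g(5)]])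
    then show "Comp D h (Comp D g f) = Comp D (Comp D h g) f"
      using g by (simp add: Cmp cG cong: restrict_cong)
  qed
  have funL: "is_functor E D L"
  proof (rule is_functorI)
    fix f x y assume f: "f \<in> Hom E x y"
    then have "base_tup E M F f = (x, \<lambda>m\<in>M. AMap (F m) f, y)"
      by (simp add: base_tup_def HomD)
    then show "AMap L f \<in> Hom D (OMap L x) (OMap L y)"
      using bas[OF HomD(1)[OF f]] HomD(1)[OF f] Hom_Obj[OF E f] unfolding Hom by (auto simp: L_def)
    fix z g assume g: "g \<in> Hom E y z"
    have "comp_tup M X (base_tup E M F g) (base_tup E M F f) = base_tup E M F (Comp E g f)"
      using HomD[OF f] HomD[OF g] HomD[OF Comp_Hom[OF E f g]] fun_Comp[OF X(2) f g]
      by (auto simp: comp_tup_def base_tup_def fun_eq_iff)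
    moreover have "AMap L g \<in> c ` G" "AMap L f \<in> c ` G"
      using bas HomD[OF f] HomD[OF g] by (simp_all add: L_def)
    moreover have "fst (base_tup E M F g) = snd (snd (base_tup E M F f))"
      using HomD[OF f] HomD[OF g] by (simp add: base_tup_def)
    ultimately show "AMap L (Comp E g f) = Comp D (AMap L g) (AMap L f)"
      using HomD[OF f] HomD[OF g] HomD(1)[OF Comp_Hom[OF E f g]] bas by (simp add: L_def D_def)
  qed (use HomD(1)[OF Idt_Hom[OF E]] in \<open>auto simp: L_def D_def\<close>)
  have OL: "OMap L x = x" if "x \<in> Obj E" for x using that by (simp add: L_def)
  have pr: "is_functor D (X m) (\<pi> m)" if m: "m \<in> M" for m
  proof (rule is_functorI)
    fix f x y assume "f \<in> Hom D x y"
    then obtain a where g: "(x, a, y) \<in> G" "f = c (x, a, y)" unfolding Hom by blast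
    then show "AMap (\<pi> m) f \<in> Hom (X m) (OMap (\<pi> m) x) (OMap (\<pi> m) y)"
      using vl(4)[OF g(1) m] by (simp add: \<pi>_def)
    fix z f' assume "f' \<in> Hom D y z"
    then obtain b where h: "(y, b, z) \<in> G" "f' = c (y, b, z)" unfolding Hom by blast
    show "AMap (\<pi> m) (Comp D f' f) = Comp (X m) (AMap (\<pi> m) f') (AMap (\<pi> m) f)"
      using g h m cG[OF g(1) h(1)] by (simp add: Cmp \<pi>_def)
  next
    fix x assume "x \<in> Obj D"
    then show "AMap (\<pi> m) (Idt D x) = Idt (X m) (OMap (\<pi> m) x)" "OMap (\<pi> m) x \<in> Obj (X m)"
      using m Id[of x] fun_Obj[OF X(2)[OF m]] by (simp_all add: \<pi>_def ObjD)
  qed (use X(2)[OF m] in \<open>simp_all add: \<pi>_def D_def is_functor_def\<close>)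
  have "tuple_cat E M X F G D L \<pi>"
  proof (unfold_locales, (fact E catD X ObjD funL OL pr)+)
    fix m assume m: "m \<in> M"
    show "fcomp E (\<pi> m) L = F m"
      by (rule fctr_eqI[OF fcomp_functor[OF E funL pr[OF m]] X(2)[OF m]])
        (use m bas in \<open>auto simp: \<pi>_def L_def base_tup_def\<close>)
  next
    fix t assume "t \<in> G" then show "valid_tup E M X F t" by (rule val)
  next
    fix x a y assume g: "(x, a, y) \<in> G"
    show "\<exists>f\<in>Hom D x y. \<forall>m\<in>M. AMap (\<pi> m) f = a m"
      by (rule bexI[of _ "c (x, a, y)"]) (use g in \<open>auto simp: Hom \<pi>_def\<close>)
  next
    fix f assume f: "f \<in> Arr D"
    then obtain x a y where g: "(x, a, y) \<in> G" "f = c (x, a, y)" by (auto simp: D_def)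
    have "(\<lambda>m\<in>M. AMap (\<pi> m) f) = a"
      by (rule extensionalityI[of _ M]) (use g vl(3)[OF g(1)] in \<open>auto simp: \<pi>_def\<close>)
    then show "(Dom D f, \<lambda>m\<in>M. AMap (\<pi> m) f, Cod D f) \<in> G" using g by (simp add: D_def)
  next
    fix x y f h assume "f \<in> Hom D x y" "h \<in> Hom D x y"
      and eq: "\<And>m. m \<in> M \<Longrightarrow> AMap (\<pi> m) f = AMap (\<pi> m) h"
    then obtain a b where g: "(x, a, y) \<in> G" "f = c (x, a, y)" "(x, b, y) \<in> G" "h = c (x, b, y)"
      unfolding Hom by blast
    have "a = b" by (rule extensionalityI[of _ M]) (use g eq vl(3) in \<open>auto simp: \<pi>_def\<close>)
    then show "f = h" using g by simp
  qed
  moreover have "tight D" unfolding tight_def by (auto simp: D_def)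
  moreover have "Arr D \<lesssim> Y" unfolding D_def using c(2) by (simp add: subset_imp_lepoll)
  ultimately show ?thesis by blast
qed

context tuple_cat
begin

text \<open>Inverse of the hidden coding: by \<open>tup_in\<close>, \<open>tup_eqD\<close> and
  \<open>tup_surj\<close> a bijection from \<open>Arr D\<close> onto \<open>G\<close>, along which
  operations on tuples become operations on arrows.\<close>

definition tup :: "'u \<Rightarrow> ('u, 'm) tup" where
  "tup f = (Dom D f, \<lambda>m\<in>M. AMap (\<pi> m) f, Cod D f)"

lemma tup_proj: "m \<in> M \<Longrightarrow> fst (snd (tup f)) m = AMap (\<pi> m) f"
  by (simp add: tup_def)

lemma tup_in: "f \<in> Arr D \<Longrightarrow> tup f \<in> G"
  unfolding tup_def by (rule arr_tup)

lemma tup_eqD: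
  assumes "f \<in> Arr D" "g \<in> Arr D" "tup f = tup g" shows "f = g"
proof (rule faithful)
  show "f \<in> Hom D (Dom D f) (Cod D f)" "g \<in> Hom D (Dom D f) (Cod D f)"
    using assms by (auto simp: Hom_def tup_def)
  show "AMap (\<pi> m) f = AMap (\<pi> m) g" if "m \<in> M" for m
    using tup_proj[OF that, of f] tup_proj[OF that, of g] assms(3) by simp
qed

lemma tup_surj:
  assumes "t \<in> G" obtains f where "f \<in> Arr D" "tup f = t"
proof -
  obtain x a y where t: "t = (x, a, y)" by (cases t)
  obtain f where f: "f \<in> Hom D x y" "\<forall>m\<in>M. AMap (\<pi> m) f = a m" using tup_arr assms t by blast
  have "(\<lambda>m\<in>M. AMap (\<pi> m) f) = a"
    by (rule extensionalityI[of _ M]) (use f valid[OF assms] t in \<open>auto simp: valid_tup_def\<close>)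
  then show ?thesis using that[of f] f t by (auto simp: tup_def Hom_def)
qed

lemma proj_arr_L: "m \<in> M \<Longrightarrow> f \<in> Arr E \<Longrightarrow> AMap (\<pi> m) (AMap L f) = AMap (F m) f"
  using proj_L[of m] by (metis fcomp_AMap)

lemma tup_L: "f \<in> Arr E \<Longrightarrow> tup (AMap L f) = base_tup E M F f"
  using fun_arr[OF fun_L, of f] arr_Obj[OF cat_E, of f]
  by (auto simp: tup_def base_tup_def OMap_L proj_arr_L fun_eq_iff)

lemma tup_Comp: "f \<in> Hom D x y \<Longrightarrow> g \<in> Hom D y z \<Longrightarrow> tup (Comp D g f) = comp_tup M X (tup g) (tup f)"
  using HomD[OF Comp_Hom[OF cat_D]] fun_Comp[OF proj]
  by (auto simp: tup_def comp_tup_def fun_eq_iff HomD)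

text \<open>Rule induction for \<open>closure_ops\<close>, moved along the bijection
  \<open>tup\<close>. It serves to identify functors out of \<open>D\<close> and to show that the
  initial model is generated.\<close>

lemma generated_induct:
  fixes W :: "'u \<Rightarrow> bool" and ar :: "'k \<Rightarrow> 'j set"
  assumes G: "G = generated_tups E M X F B K ar P op"
    and base: "\<And>f. f \<in> Arr E \<Longrightarrow> W (AMap L f)"
    and new: "\<And>f. f \<in> Arr D \<Longrightarrow> tup f \<in> B \<Longrightarrow> W f"
    and comp: "\<And>f g x y z. f \<in> Hom D x y \<Longrightarrow> g \<in> Hom D y z \<Longrightarrow> W f \<Longrightarrow> W g \<Longrightarrow> W (Comp D g f)"
    and fam: "\<And>k h f. k \<in> K \<Longrightarrow> f \<in> Arr D \<Longrightarrow> (\<And>j. j \<in> ar k \<Longrightarrow> h j \<in> Arr D \<and> W (h j)) \<Longrightarrow>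
       P k (\<lambda>j\<in>ar k. tup (h j)) \<Longrightarrow> tup f = op k (\<lambda>j\<in>ar k. tup (h j)) \<Longrightarrow> W f"
    and f: "f \<in> Arr D"
  shows "W f"
proof -
  \<comment> \<open>The induction runs over tuples, so the claim is made for whichever arrow has the
    given tuple.\<close>
  have "\<forall>f\<in>Arr D. tup f = t \<longrightarrow> W f" if "t \<in> G" for t
    using that unfolding G
  proof induction
    case (base b)
    show ?case
    proof (intro ballI impI)
      fix f assume f: "f \<in> Arr D" "tup f = b"
      from base show "W f"
      proof
        assume "b \<in> base_tup E M F ` Arr E"
        then obtain g where g: "g \<in> Arr E" "b = base_tup E M F g" by blast
        have "f = AMap L g"
          by (rule tup_eqD[OF f(1) fun_arr(1)[OF fun_L g(1)]]) (simp add: f(2) g tup_L)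
        then show ?thesis using assms(2)[OF g(1)] by simp
      next
        assume "b \<in> B"
        then show ?thesis using new[OF f(1)] f(2) by simp
      qed
    qed
  next
    case (bin t u)
    obtain p q where pq: "p \<in> Arr D" "tup p = t" "q \<in> Arr D" "tup q = u"
      using bin.hyps(1,2) tup_surj unfolding G[symmetric] by metis
    then have p: "p \<in> Hom D (Dom D p) (Cod D p)" and q: "q \<in> Hom D (Cod D p) (Cod D q)"
      using bin.hyps(3) by (auto simp: Hom_def tup_def)
    have "tup (Comp D q p) = comp_tup M X u t" using tup_Comp[OF p q] pq by simp
    moreover have "W (Comp D q p)" using comp[OF p q] bin.IH pq by blast
    ultimately show ?case using tup_eqD[OF HomD(1)[OF Comp_Hom[OF cat_D p q]]] by auto
  next
    case (fam k g)
    then have "\<forall>j\<in>ar k. \<exists>h. h \<in> Arr D \<and> tup h = g j"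
      using tup_surj unfolding G[symmetric] by metis
    then obtain h where h: "\<And>j. j \<in> ar k \<Longrightarrow> h j \<in> Arr D \<and> tup (h j) = g j" by metis
    have g: "g = (\<lambda>j\<in>ar k. tup (h j))"
      by (rule extensionalityI[of _ "ar k"]) (use fam h in auto)
    show ?case
    proof (intro ballI impI)
      fix f assume f: "f \<in> Arr D" "tup f = op k g"
      show "W f"
      proof (rule assms(5)[of k f h])
        show "h j \<in> Arr D \<and> W (h j)" if "j \<in> ar k" for j using h[OF that] fam.IH[OF that] by blast
      qed (use fam.hyps f in \<open>auto simp: g[symmetric]\<close>)
    qed
  qed
  then show ?thesis using tup_in[OF f] f by blast
qed

end

section \<open>Generated subcategories of products\<close>

lemma closure_valid:
  assumes E: "category E"
    and X: "\<And>m. m \<in> M \<Longrightarrow> category (X m)" "\<And>m. m \<in> M \<Longrightarrow> is_functor E (X m) (F m)"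
    and B: "\<And>b. b \<in> B \<Longrightarrow> valid_tup E M X F b"
    and op: "\<And>k f. k \<in> K \<Longrightarrow> (\<And>j. j \<in> ar k \<Longrightarrow> valid_tup E M X F (f j)) \<Longrightarrow> P k f \<Longrightarrow>
       valid_tup E M X F (op k f)"
    and t: "t \<in> generated_tups E M X F B K ar P op"
  shows "valid_tup E M X F t"
  using t
proof induction
  case (base b)
  then show ?case
  proof
    assume "b \<in> base_tup E M F ` Arr E"
    then obtain f where f: "f \<in> Arr E" "b = base_tup E M F f" by blast
    then show ?thesis
      using fun_Hom[OF X(2) arr_Hom[OF f(1)]] arr_Obj[OF E f(1)]
      by (simp add: valid_tup_def base_tup_def)
  qed (rule B)
next
  case (bin f g)
  obtain x a y b z where fg: "f = (x, a, y)" "g = (y, b, z)"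
    using bin.hyps(3) by (cases f; cases g) simp
  show ?case
    using bin.IH unfolding fg valid_tup_def comp_tup_def
    by simp (blast intro: Comp_Hom[OF X(1)])
next
  case (fam k f)
  then show ?case using op by blast
qed

lemma closure_tuple_cat:
  fixes Y :: "'u set" and E :: "'u scat"
  assumes E: "category E"
    and X: "\<And>m. m \<in> M \<Longrightarrow> category (X m)" "\<And>m. m \<in> M \<Longrightarrow> is_functor E (X m) (F m)"
    and B: "\<And>b. b \<in> B \<Longrightarrow> valid_tup E M X F b"
    and op: "\<And>k f. k \<in> K \<Longrightarrow> (\<And>j. j \<in> ar k \<Longrightarrow> valid_tup E M X F (f j)) \<Longrightarrow> P k f \<Longrightarrow>
       valid_tup E M X F (op k f)"
    and Y: "infinite Y" "Arr E \<lesssim> Y" "B \<lesssim> Y" "K \<lesssim> Y" "\<And>k. k \<in> K \<Longrightarrow> (ar k \<rightarrow>\<^sub>E Y) \<lesssim> Y"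
  shows "\<exists>D L \<pi>. tuple_cat E M X F (generated_tups E M X F B K ar P op) D L \<pi> \<and> tight D \<and> Arr D \<lesssim> Y"
proof (rule tuple_cat_exists[OF E X])
  have "base_tup E M F ` Arr E \<union> B \<lesssim> Y"
    by (intro Un_lepoll_self Y lepoll_trans[OF image_lepoll Y(2)])
  then show "generated_tups E M X F B K ar P op \<lesssim> Y"
    by (rule closure_ops_lepoll[OF Y(1) _ Y(4,5)])
next
  fix t assume t: "t \<in> generated_tups E M X F B K ar P op"
  show "valid_tup E M X F t"
    by (rule closure_valid[of E M X F B K ar P op, OF E X B op t])
qed (auto intro: closure_ops.intros)

section \<open>Freely adjoining arrows\<close>

context size_pair
begin

text \<open>Relations are imposed through \<open>Mod\<close>, the class of targets in which they
  hold. In the product of these targets, \<open>E\<close> and the new arrows generate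
  \<open>D\<close>, and the projections are the universal functors. The last conclusion takes the
  place of a quotient: an equation valid in all targets is valid in \<open>D\<close>, and in this
  way \<open>D\<close> itself is seen to satisfy the relations.\<close>

lemma free_arrows:
  fixes E :: "'u scat" and Mod :: "'u scat \<Rightarrow> 'u sfctr \<Rightarrow> ('u \<Rightarrow> 'u) \<Rightarrow> bool"
  assumes E: "small_cat small E" and N: "small N"
    and st: "\<And>n. n \<in> N \<Longrightarrow> s n \<in> Obj E \<and> t n \<in> Obj E"
    and Mod: "\<And>D' F' \<psi>. Mod D' F' \<psi> \<Longrightarrow> category D' \<and> is_functor E D' F' \<and>
       (\<forall>n\<in>N. \<psi> n \<in> Hom D' (OMap F' (s n)) (OMap F' (t n)))"
  obtains D L \<gamma> where "small_cat small D" "is_functor E D L" "\<gamma> \<in> extensional N"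
    "\<And>n. n \<in> N \<Longrightarrow> \<gamma> n \<in> Hom D (OMap L (s n)) (OMap L (t n))"
    "\<And>D' F' \<psi>. Mod D' F' \<psi> \<Longrightarrow>
       \<exists>!H. is_functor D D' H \<and> fcomp E H L = F' \<and> (\<forall>n\<in>N. AMap H (\<gamma> n) = \<psi> n)"
    "\<And>x y f g. f \<in> Hom D x y \<Longrightarrow> g \<in> Hom D x y \<Longrightarrow>
       (\<And>D' F' \<psi> H. Mod D' F' \<psi> \<Longrightarrow> is_functor D D' H \<Longrightarrow> fcomp E H L = F' \<Longrightarrow>
          (\<forall>n\<in>N. AMap H (\<gamma> n) = \<psi> n) \<Longrightarrow> AMap H f = AMap H g) \<Longrightarrow> f = g"
proof -
  note E' = small_catD[OF E]
  define M where "M = {(D', F', \<psi>). Mod D' F' \<psi>}"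
  define X :: "'u scat \<times> 'u sfctr \<times> ('u \<Rightarrow> 'u) \<Rightarrow> 'u scat" where "X = fst"
  define F :: "'u scat \<times> 'u sfctr \<times> ('u \<Rightarrow> 'u) \<Rightarrow> 'u sfctr" where "F m = fst (snd m)" for m
  \<comment> \<open>The component of the new arrow \<open>n\<close> in a target is the arrow that
    this target prescribes for \<open>n\<close>.\<close>
  define new where "new n = (s n, \<lambda>m\<in>M. snd (snd m) n, t n)" for n
  obtain Y where Y: "small Y" "infinite Y" "Arr E \<lesssim> Y" "N \<lesssim> Y" using small_bound[OF E'(4) N] .
  have XF: "category (X m)" "is_functor E (X m) (F m)"
    "n \<in> N \<Longrightarrow> snd (snd m) n \<in> Hom (X m) (OMap (F m) (s n)) (OMap (F m) (t n))" if "m \<in> M" for m n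
    using that Mod by (auto simp: M_def X_def F_def)
  have B: "valid_tup E M X F b" if "b \<in> new ` N" for b
    using that st XF(3) by (auto simp: valid_tup_def new_def)
  \<comment> \<open>There are no operations on families here, so the closure is under composition
    alone.\<close>
  have "\<exists>D L \<pi>. tuple_cat E M X F (generated_tups E M X F (new ` N) ({} :: unit set) (\<lambda>_. {} :: unit set)
      (\<lambda>_ _. True) (\<lambda>_ _. undefined)) D L \<pi> \<and> tight D \<and> Arr D \<lesssim> Y"
  proof (rule closure_tuple_cat[OF E'(1)])
    show "new ` N \<lesssim> Y" using lepoll_trans[OF image_lepoll Y(4)] .
  qed (use XF B Y in auto)
  then obtain D L \<pi> where T: "tuple_cat E M X F (generated_tups E M X F (new ` N) ({} :: unit set) (\<lambda>_. {} :: unit set)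
      (\<lambda>_ _. True) (\<lambda>_ _. undefined)) D L \<pi>" "tight D" "Arr D \<lesssim> Y" by blast
  interpret tuple_cat E M X F "generated_tups E M X F (new ` N) ({} :: unit set) (\<lambda>_. {} :: unit set)
      (\<lambda>_ _. True) (\<lambda>_ _. undefined)" D L \<pi> by (rule T(1))
  have "\<exists>f. f \<in> Arr D \<and> tup f = new n" if "n \<in> N" for n
    by (rule tup_surj[OF closure_ops.base[of "new n"]]) (use that in auto)
  then obtain \<gamma>0 where \<gamma>0: "\<And>n. n \<in> N \<Longrightarrow> \<gamma>0 n \<in> Arr D \<and> tup (\<gamma>0 n) = new n" by metis
  define \<gamma> where "\<gamma> = restrict \<gamma>0 N"
  have \<gamma>: "\<gamma> n \<in> Arr D" "tup (\<gamma> n) = new n" if "n \<in> N" for n using \<gamma>0 that by (auto simp: \<gamma>_def)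
  have \<gamma>H: "\<gamma> n \<in> Hom D (OMap L (s n)) (OMap L (t n))" if "n \<in> N" for n
    using \<gamma>[OF that] st[OF that] by (auto simp: tup_def new_def Hom_def OMap_L)
  have \<pi>\<gamma>: "AMap (\<pi> m) (\<gamma> n) = snd (snd m) n" if "n \<in> N" "m \<in> M" for n m
    using tup_proj[OF that(2), of "\<gamma> n"] \<gamma>(2)[OF that(1)] that(2) by (simp add: new_def)
  show ?thesis
  proof (rule that[of D L \<gamma>])
    show "small_cat small D"
      using T(2,3) cat_D Obj_D E'(3) Y(1) small_lepoll unfolding small_cat_def by auto
    show "is_functor E D L" "\<gamma> \<in> extensional N" by (auto simp: fun_L \<gamma>_def)
    show "\<gamma> n \<in> Hom D (OMap L (s n)) (OMap L (t n))" if "n \<in> N" for n using \<gamma>H[OF that] .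
  next
    fix D' F' \<psi> assume m: "Mod D' F' \<psi>"
    then have m: "(D', F', \<psi>) \<in> M" by (simp add: M_def)
    show "\<exists>!H. is_functor D D' H \<and> fcomp E H L = F' \<and> (\<forall>n\<in>N. AMap H (\<gamma> n) = \<psi> n)"
    proof (rule ex1I[of _ "\<pi> (D', F', \<psi>)"])
      show *: "is_functor D D' (\<pi> (D', F', \<psi>)) \<and> fcomp E (\<pi> (D', F', \<psi>)) L = F' \<and>
          (\<forall>n\<in>N. AMap (\<pi> (D', F', \<psi>)) (\<gamma> n) = \<psi> n)"
        using proj[OF m] proj_L[OF m] \<pi>\<gamma>[OF _ m] by (simp add: X_def F_def)
      fix H assume H: "is_functor D D' H \<and> fcomp E H L = F' \<and> (\<forall>n\<in>N. AMap H (\<gamma> n) = \<psi> n)"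
      have LL: "fcomp E H L = fcomp E (\<pi> (D', F', \<psi>)) L" using H * by simp
      show "H = \<pi> (D', F', \<psi>)"
      proof (rule fctr_eqI[of D D' _ D'])
        show "is_functor D D' H" "is_functor D D' (\<pi> (D', F', \<psi>))" using H * by auto
        show "OMap H x = OMap (\<pi> (D', F', \<psi>)) x" if "x \<in> Obj D" for x
          using LL OMap_L[of x] that fcomp_OMap unfolding Obj_D by metis
        fix f assume f: "f \<in> Arr D"
        show "AMap H f = AMap (\<pi> (D', F', \<psi>)) f"
        proof (rule generated_induct[OF refl _ _ _ _ f])
          show "AMap H (AMap L f) = AMap (\<pi> (D', F', \<psi>)) (AMap L f)" if "f \<in> Arr E" for f
            using LL that fcomp_AMap by metis
          show "AMap H f = AMap (\<pi> (D', F', \<psi>)) f" if f: "f \<in> Arr D" "tup f \<in> new ` N" for f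
          proof -
            obtain n where n: "n \<in> N" "tup f = new n" using f by blast
            then have "f = \<gamma> n" using \<gamma> tup_eqD f(1) by metis
            then show ?thesis using H * n by simp
          qed
          show "AMap H (Comp D g f) = AMap (\<pi> (D', F', \<psi>)) (Comp D g f)"
            if "f \<in> Hom D x y" "g \<in> Hom D y z" "AMap H f = AMap (\<pi> (D', F', \<psi>)) f"
              "AMap H g = AMap (\<pi> (D', F', \<psi>)) g" for f g x y z
            using that H * fun_Comp[of D D' _ f x y g z] by metis
        qed auto
      qed
    qed
  next
    fix x y f g assume fg: "f \<in> Hom D x y" "g \<in> Hom D x y"
      and eq: "\<And>D' F' \<psi> H. Mod D' F' \<psi> \<Longrightarrow> is_functor D D' H \<Longrightarrow> fcomp E H L = F' \<Longrightarrow>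
          (\<forall>n\<in>N. AMap H (\<gamma> n) = \<psi> n) \<Longrightarrow> AMap H f = AMap H g"
    show "f = g"
    proof (rule faithful[OF fg])
      fix m assume m: "m \<in> M"
      obtain D' F' \<psi> where m': "m = (D', F', \<psi>)" by (cases m)
      show "AMap (\<pi> m) f = AMap (\<pi> m) g"
        using eq[of D' F' \<psi> "\<pi> m"] m m' proj[OF m] proj_L[OF m] \<pi>\<gamma>[OF _ m]
        by (auto simp: M_def X_def F_def)
    qed
  qed
qed

section \<open>Existence of the generators\<close>

lemma adjoin_cone_exists:
  assumes E: "small_cat small E" and c: "cone_in ismall E c" and y: "y \<in> Obj E"
  obtains D i \<gamma> where "adjoin_cone small E y c D i \<gamma>"
proof -
  note E' = small_catD[OF E]
  have c': "category (Shape c)" "is_functor (Shape c) E (Diagram c)" "small (Obj (Shape c))"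
    using c ismall_small by (auto simp: cone_in_def small_cat_def)
  note ct = cone_triple_iff[OF E'(1) c'(1,2) y]
  have Mod: "category D' \<and> is_functor E D' F' \<and>
      (\<forall>n\<in>Obj (Shape c). \<psi> n \<in> Hom D' (OMap F' y) (OMap F' (OMap (Diagram c) n)))"
    if "cone_triple small E y c D' F' \<psi>" for D' F' \<psi>
    using that small_catD(1) unfolding ct cone_over_def by auto
  obtain D i \<gamma> where D: "small_cat small D" "is_functor E D i" "\<gamma> \<in> extensional (Obj (Shape c))"
    "\<And>n. n \<in> Obj (Shape c) \<Longrightarrow> \<gamma> n \<in> Hom D (OMap i y) (OMap i (OMap (Diagram c) n))"
    and univ: "\<And>D' F' \<psi>. cone_triple small E y c D' F' \<psi> \<Longrightarrow>
       \<exists>!H. is_functor D D' H \<and> fcomp E H i = F' \<and> (\<forall>n\<in>Obj (Shape c). AMap H (\<gamma> n) = \<psi> n)"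
    and faith: "\<And>a b f g. f \<in> Hom D a b \<Longrightarrow> g \<in> Hom D a b \<Longrightarrow>
       (\<And>D' F' \<psi> H. cone_triple small E y c D' F' \<psi> \<Longrightarrow> is_functor D D' H \<Longrightarrow> fcomp E H i = F' \<Longrightarrow>
          (\<forall>n\<in>Obj (Shape c). AMap H (\<gamma> n) = \<psi> n) \<Longrightarrow> AMap H f = AMap H g) \<Longrightarrow> f = g"
    using free_arrows[where s = "\<lambda>_. y" and t = "OMap (Diagram c)" and Mod = "cone_triple small E y c",
        OF E c'(3) _ Mod] y fun_Obj[OF c'(2)] by blast
  \<comment> \<open>The free arrows were adjoined without any naturality. It holds in
    \<open>D\<close> because it holds in every cone triple.\<close>
  have "Comp D (AMap i (AMap (Diagram c) u)) (\<gamma> (Dom (Shape c) u)) = \<gamma> (Cod (Shape c) u)"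
    if u: "u \<in> Arr (Shape c)" for u
  proof -
    let ?a = "Dom (Shape c) u" and ?b = "Cod (Shape c) u"
    have ab: "?a \<in> Obj (Shape c)" "?b \<in> Obj (Shape c)" using arr_Obj[OF c'(1) u] .
    have 1: "AMap i (AMap (Diagram c) u) \<in> Hom D (OMap i (OMap (Diagram c) ?a)) (OMap i (OMap (Diagram c) ?b))"
      by (intro fun_Hom[OF D(2)] fun_Hom[OF c'(2)] arr_Hom u)
    show ?thesis
    proof (rule faith[OF Comp_Hom[OF small_catD(1)[OF D(1)] D(4)[OF ab(1)] 1] D(4)[OF ab(2)]])
      fix D' F' \<psi> H assume "cone_triple small E y c D' F' \<psi>" and H: "is_functor D D' H"
        "fcomp E H i = F'" "\<forall>n\<in>Obj (Shape c). AMap H (\<gamma> n) = \<psi> n"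
      then have "Comp D' (AMap F' (AMap (Diagram c) u)) (\<psi> ?a) = \<psi> ?b"
        using u unfolding ct cone_over_def by blast
      moreover have "AMap F' (AMap (Diagram c) u) = AMap H (AMap i (AMap (Diagram c) u))"
        using H(2) fun_arr(1)[OF c'(2) u] by auto
      ultimately show "AMap H (Comp D (AMap i (AMap (Diagram c) u)) (\<gamma> ?a)) = AMap H (\<gamma> ?b)"
        using fun_Comp[OF H(1) D(4)[OF ab(1)] 1] H(3) ab by simp
    qed
  qed
  then have "cone_triple small E y c D i \<gamma>"
    unfolding ct cone_over_def using D by auto
  moreover have "\<exists>!H. is_functor D D' H \<and> fcomp E H i = F' \<and> whisker_l (Shape c) H \<gamma> = \<psi>"
    if m: "cone_triple small E y c D' F' \<psi>" for D' F' \<psi>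
  proof -
    \<comment> \<open>Extensionality of \<open>\<psi>\<close> turns the pointwise condition of
      \<open>free_arrows\<close> into an equality of families.\<close>
    have "\<psi> \<in> extensional (Obj (Shape c))" using m unfolding ct cone_over_def by blast
    then have "whisker_l (Shape c) H \<gamma> = \<psi> \<longleftrightarrow> (\<forall>n\<in>Obj (Shape c). AMap H (\<gamma> n) = \<psi> n)"
      for H :: "'u sfctr"
      by (auto simp: whisker_l_def fun_eq_iff restrict_def extensional_def)
    then show ?thesis using univ[OF m] by simp
  qed
  ultimately show ?thesis
    using that[of D i \<gamma>] unfolding adjoin_cone_def by blast
qed

lemma adjoin_lift_exists:
  assumes E: "small_cat small E" and c: "cone_in ismall E c" and y: "y \<in> Obj E"
    and D: "cone_triple small E y c D i \<gamma>"
  obtains D' r f where "adjoin_lift small D c i y \<gamma> D' r f"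
proof -
  note E' = small_catD[OF E]
  have c': "category (Shape c)" "is_functor (Shape c) E (Diagram c)" "Vertex c \<in> Obj E"
    and leg: "\<And>j. j \<in> Obj (Shape c) \<Longrightarrow> Leg c j \<in> Hom E (Vertex c) (OMap (Diagram c) j)"
    using c by (auto simp: cone_in_def small_cat_def is_nat_def const_fctr_def)
  have Ds: "small_cat small D" and i: "is_functor E D i" and
    \<gamma>: "\<And>j. j \<in> Obj (Shape c) \<Longrightarrow> \<gamma> j \<in> Hom D (OMap i y) (OMap i (OMap (Diagram c) j))"
    using D unfolding cone_triple_iff[OF E'(1) c'(1,2) y] cone_over_def by auto
  \<comment> \<open>One arrow is to be adjoined, so the index set is a singleton, with an arbitrary
    element of \<open>'u\<close> as the index.\<close>
  let ?u = "undefined :: 'u"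
  define Mod where "Mod D'' r'' \<psi> = lift_triple small D c i y \<gamma> D'' r'' (\<psi> ?u)" for D'' r'' \<psi>
  have N: "small {?u}" by (rule small_finite) simp
  have Mod': "category D' \<and> is_functor D D' F' \<and>
      (\<forall>n\<in>{?u}. \<psi> n \<in> Hom D' (OMap F' (OMap i y)) (OMap F' (OMap i (Vertex c))))"
    if "Mod D' F' \<psi>" for D' F' \<psi>
    using that small_catD(1) unfolding Mod_def lift_triple_def by auto
  have st: "OMap i y \<in> Obj D \<and> OMap i (Vertex c) \<in> Obj D" if "n \<in> {?u}" for n
    using y c'(3) fun_Obj[OF i] by blast
  show ?thesis
  proof (rule free_arrows[of D "{?u}" "\<lambda>_. OMap i y" "\<lambda>_. OMap i (Vertex c)" Mod, OF Ds N st Mod'])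
    fix D' r \<phi> assume D': "small_cat small D'" "is_functor D D' r"
      "\<And>n. n \<in> {?u} \<Longrightarrow> \<phi> n \<in> Hom D' (OMap r (OMap i y)) (OMap r (OMap i (Vertex c)))"
      and univ: "\<And>D'' F' \<psi>. Mod D'' F' \<psi> \<Longrightarrow>
         \<exists>!H. is_functor D' D'' H \<and> fcomp D H r = F' \<and> (\<forall>n\<in>{?u}. AMap H (\<phi> n) = \<psi> n)"
      and faith: "\<And>a b f g. f \<in> Hom D' a b \<Longrightarrow> g \<in> Hom D' a b \<Longrightarrow>
         (\<And>D'' F' \<psi> H. Mod D'' F' \<psi> \<Longrightarrow> is_functor D' D'' H \<Longrightarrow> fcomp D H r = F' \<Longrightarrow>
            (\<forall>n\<in>{?u}. AMap H (\<phi> n) = \<psi> n) \<Longrightarrow> AMap H f = AMap H g) \<Longrightarrow> f = g"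
    let ?f = "\<phi> ?u"
    have f: "?f \<in> Hom D' (OMap r (OMap i y)) (OMap r (OMap i (Vertex c)))" using D'(3) by blast
    \<comment> \<open>As for cones, the equation with the legs holds in every target and is
      therefore inherited by \<open>D'\<close>.\<close>
    have "Comp D' (AMap r (AMap i (Leg c j))) ?f = AMap r (\<gamma> j)" if j: "j \<in> Obj (Shape c)" for j
    proof -
      have 1: "AMap i (Leg c j) \<in> Hom D (OMap i (Vertex c)) (OMap i (OMap (Diagram c) j))"
        by (intro fun_Hom[OF i] leg j)
      note 2 = fun_Hom[OF D'(2) 1] and 3 = fun_Hom[OF D'(2) \<gamma>[OF j]]
      show ?thesis
      proof (rule faith[OF Comp_Hom[OF small_catD(1)[OF D'(1)] f 2] 3])
        fix D'' F' \<psi> H assume m: "Mod D'' F' \<psi>" and H: "is_functor D' D'' H"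
          "fcomp D H r = F'" "\<forall>n\<in>{?u}. AMap H (\<phi> n) = \<psi> n"
        have "Comp D'' (AMap F' (AMap i (Leg c j))) (\<psi> ?u) = AMap F' (\<gamma> j)"
          using m j unfolding Mod_def lift_triple_def by blast
        then show "AMap H (Comp D' (AMap r (AMap i (Leg c j))) ?f) = AMap H (AMap r (\<gamma> j))"
          using fun_Comp[OF H(1) f 2] H(3) unfolding H(2)[symmetric]
          by (simp add: HomD(1)[OF 1] HomD(1)[OF \<gamma>[OF j]])
      qed
    qed
    then have "lift_triple small D c i y \<gamma> D' r ?f" unfolding lift_triple_def using D' f by blast
    moreover have "\<exists>!H. is_functor D' D'' H \<and> fcomp D H r = r'' \<and> AMap H ?f = f''"
      if "lift_triple small D c i y \<gamma> D'' r'' f''" for D'' r'' f''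
      using univ[of D'' r'' "\<lambda>_. f''"] that by (simp add: Mod_def)
    ultimately show ?thesis using that[of D' r ?f] unfolding adjoin_lift_def by blast
  qed
qed

end

section \<open>Models of a sketch\<close>

abbreviation cone_at :: "'u scat \<Rightarrow> 'u sfctr \<Rightarrow> 'u cone \<Rightarrow> 'u \<Rightarrow> ('u \<Rightarrow> 'u) \<Rightarrow> bool" where
  "cone_at X P c y \<tau> \<equiv> cone_over (Shape c) (Diagram c) X P y \<tau>"

definition fills :: "'u scat \<Rightarrow> 'u sfctr \<Rightarrow> 'u cone \<Rightarrow> 'u \<Rightarrow> ('u \<Rightarrow> 'u) \<Rightarrow> 'u \<Rightarrow> bool" where
  "fills X P c y \<tau> h \<longleftrightarrow> h \<in> Hom X (OMap P y) (OMap P (Vertex c)) \<and>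
     (\<forall>j\<in>Obj (Shape c). Comp X (AMap P (Leg c j)) h = \<tau> j)"

text \<open>
  The test objects are the images of the objects of the base only, so the images of the cones need
  not be limit cones unless \<open>P\<close> is surjective on objects.
\<close>

definition model :: "('u set \<Rightarrow> bool) \<Rightarrow> 'u sketch \<Rightarrow> 'u scat \<Rightarrow> 'u sfctr \<Rightarrow> bool" where
  "model small S X P \<longleftrightarrow> small_cat small X \<and> is_functor (Base S) X P \<and>
     (\<forall>y\<in>Obj (Base S). \<forall>\<alpha>\<in>Ix S. \<forall>\<tau>. cone_at X P (Cone S \<alpha>) y \<tau> \<longrightarrow>
        (\<exists>!h. fills X P (Cone S \<alpha>) y \<tau> h))"

text \<open>Says that no proper set of arrows has the three closure properties. As an induction
  principle over all predicates it passes along a functor by substitution into \<open>W\<close>,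
  which is how \<open>Fib\<close> acquires it.\<close>

definition generated :: "'u sketch \<Rightarrow> 'u scat \<Rightarrow> 'u sfctr \<Rightarrow> bool" where
  "generated S X P \<longleftrightarrow> (\<forall>W.
     (\<forall>f\<in>Arr (Base S). W (AMap P f)) \<longrightarrow>
     (\<forall>x y z f g. f \<in> Hom X x y \<longrightarrow> g \<in> Hom X y z \<longrightarrow> W f \<longrightarrow> W g \<longrightarrow> W (Comp X g f)) \<longrightarrow>
     (\<forall>y\<in>Obj (Base S). \<forall>\<alpha>\<in>Ix S. \<forall>\<tau> h. cone_at X P (Cone S \<alpha>) y \<tau> \<longrightarrow>
        (\<forall>j\<in>Obj (Shape (Cone S \<alpha>)). W (\<tau> j)) \<longrightarrow> fills X P (Cone S \<alpha>) y \<tau> h \<longrightarrow> W h) \<longrightarrow>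
     (\<forall>f\<in>Arr X. W f))"

lemma generatedD:
  assumes "generated S X P"
    and "\<And>f. f \<in> Arr (Base S) \<Longrightarrow> W (AMap P f)"
    and "\<And>x y z f g. f \<in> Hom X x y \<Longrightarrow> g \<in> Hom X y z \<Longrightarrow> W f \<Longrightarrow> W g \<Longrightarrow> W (Comp X g f)"
    and "\<And>y \<alpha> \<tau> h. y \<in> Obj (Base S) \<Longrightarrow> \<alpha> \<in> Ix S \<Longrightarrow> cone_at X P (Cone S \<alpha>) y \<tau> \<Longrightarrow>
        (\<And>j. j \<in> Obj (Shape (Cone S \<alpha>)) \<Longrightarrow> W (\<tau> j)) \<Longrightarrow> fills X P (Cone S \<alpha>) y \<tau> h \<Longrightarrow> W h"
    and "f \<in> Arr X"
  shows "W f"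
  using assms(1)[unfolded generated_def, rule_format, of W f] assms(2-5) by blast

lemma modelD:
  assumes "model small S X P"
  shows "small_cat small X" "category X" "is_functor (Base S) X P"
    "y \<in> Obj (Base S) \<Longrightarrow> \<alpha> \<in> Ix S \<Longrightarrow> cone_at X P (Cone S \<alpha>) y \<tau> \<Longrightarrow>
        \<exists>!h. fills X P (Cone S \<alpha>) y \<tau> h"
  using assms small_catD(1) by (auto simp: model_def)

lemma coneD:
  assumes "cone_in ismall E c"
  shows "Vertex c \<in> Obj E" "category (Shape c)" "is_functor (Shape c) E (Diagram c)"
    "ismall (Obj (Shape c))"
    "j \<in> Obj (Shape c) \<Longrightarrow> Leg c j \<in> Hom E (Vertex c) (OMap (Diagram c) j)"
    "j \<in> Obj (Shape c) \<Longrightarrow> Leg c j \<in> Arr E"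
    "Leg c \<in> extensional (Obj (Shape c))"
  using assms by (auto simp: cone_in_def small_cat_def is_nat_def const_fctr_def Hom_def)

lemma fills_map:
  assumes c: "cone_in ismall E c" and P: "is_functor E X P" and H: "is_functor X X' H"
    and y: "y \<in> Obj E" and h: "fills X P c y \<tau> h"
  shows "fills X' (fcomp E H P) c y (whisker_l (Shape c) H \<tau>) (AMap H h)"
proof -
  have h': "h \<in> Hom X (OMap P y) (OMap P (Vertex c))" using h by (simp add: fills_def)
  have "Comp X' (AMap H (AMap P (Leg c j))) (AMap H h) = AMap H (\<tau> j)" if j: "j \<in> Obj (Shape c)" for j
    using fun_Comp[OF H h' fun_Hom[OF P coneD(5)[OF c j]]] h j by (simp add: fills_def)
  then show ?thesis
    using fun_Hom[OF H h'] y coneD(1,6)[OF c] by (simp add: fills_def whisker_l_def)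
qed

text \<open>The bridge from generators to fillers: what \<open>E[y;\<alpha>]'\<close> classifies is
  a functor on \<open>E[y;\<alpha>]\<close> with a filler of the image of its universal
  cone.\<close>

lemma lift_triple_iff:
  assumes c: "cone_in ismall E c" and i: "is_functor E D i" and y: "y \<in> Obj E"
  shows "lift_triple small D c i y \<gamma> X r f \<longleftrightarrow> small_cat small X \<and> is_functor D X r \<and>
    fills X (fcomp E r i) c y (whisker_l (Shape c) r \<gamma>) f"
  using y coneD(1,6)[OF c] by (auto simp: lift_triple_def fills_def whisker_l_def)

section \<open>Orthogonality in the coslice category\<close>

lemma coslice_Hom:
  "h \<in> Hom (coslice small E) (D, i) (X, P) \<longleftrightarrow>
    (\<exists>H. h = ((D, i), (X, P), H) \<and> small_cat small D \<and> is_functor E D i \<and> small_cat small X \<and>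
       is_functor E X P \<and> is_functor D X H \<and> fcomp E H i = P)"
  unfolding Hom_def coslice_def by (cases h) (auto simp: Let_def)

lemma coslice_Arr:
  "((D, i), (X, P), H) \<in> Arr (coslice small E) \<longleftrightarrow>
    small_cat small D \<and> is_functor E D i \<and> small_cat small X \<and>
       is_functor E X P \<and> is_functor D X H \<and> fcomp E H i = P"
  unfolding coslice_def by (auto simp: Let_def)

lemma coslice_simps [simp]:
  "Dom (coslice small E) (A, B, H) = A" "Cod (coslice small E) (A, B, H) = B"
  "Comp (coslice small E) (B', Z, K) ((D, i), B, H) = ((D, i), Z, fcomp D K H)"
  by (simp_all add: coslice_def Let_def)

text \<open>Arrows of the coslice carry their endpoints, so diagonals there correspond one to one to
  functors; this removes the bookkeeping once and for all.\<close>

lemma coslice_orthogonal: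
  assumes "((D, i), (D', j), r) \<in> Arr (coslice small E)" "((X, P), (Y, Q), p) \<in> Arr (coslice small E)"
  shows "orthogonal (coslice small E) ((D, i), (D', j), r) ((X, P), (Y, Q), p) \<longleftrightarrow>
    (\<forall>u v. is_functor D X u \<longrightarrow> fcomp E u i = P \<longrightarrow> is_functor D' Y v \<longrightarrow> fcomp E v j = Q \<longrightarrow>
       fcomp D p u = fcomp D v r \<longrightarrow>
       (\<exists>!d. is_functor D' X d \<and> fcomp E d j = P \<and> fcomp D d r = u \<and> fcomp D' p d = v))"
    (is "?L \<longleftrightarrow> ?R")
proof -
  let ?C = "coslice small E"
  note a = assms[unfolded coslice_Arr]
  have ex: "(\<exists>!t. t \<in> Hom ?C (D', j) (X, P) \<and> Comp ?C t ((D, i), (D', j), r) = ((D, i), (X, P), u) \<and>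
        Comp ?C ((X, P), (Y, Q), p) t = ((D', j), (Y, Q), v)) \<longleftrightarrow>
      (\<exists>!d. is_functor D' X d \<and> fcomp E d j = P \<and> fcomp D d r = u \<and> fcomp D' p d = v)"
    (is "(\<exists>!t. ?A t) \<longleftrightarrow> (\<exists>!d. ?B d)") for u v
  proof -
    have AB: "?A t \<longleftrightarrow> (\<exists>d. t = ((D', j), (X, P), d) \<and> ?B d)" for t
      unfolding coslice_Hom using a by auto
    show ?thesis unfolding AB by blast
  qed
  show ?thesis
  proof
    assume L: ?L
    show ?R
    proof (intro allI impI)
      fix u v assume uv: "is_functor D X u" "fcomp E u i = P" "is_functor D' Y v" "fcomp E v j = Q"
        "fcomp D p u = fcomp D v r"
      have 1: "((D, i), (X, P), u) \<in> Hom ?C (D, i) (X, P)"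
        "((D', j), (Y, Q), v) \<in> Hom ?C (D', j) (Y, Q)"
        using a uv unfolding coslice_Hom by auto
      show "\<exists>!d. is_functor D' X d \<and> fcomp E d j = P \<and> fcomp D d r = u \<and> fcomp D' p d = v"
        using L[unfolded orthogonal_def coslice_simps, rule_format, OF 1] uv(5) ex by simp
    qed
  next
    assume R: ?R
    show ?L
      unfolding orthogonal_def coslice_simps
    proof (intro ballI impI)
      fix t s assume ts: "t \<in> Hom ?C (D, i) (X, P)" "s \<in> Hom ?C (D', j) (Y, Q)"
        and eq: "Comp ?C ((X, P), (Y, Q), p) t = Comp ?C s ((D, i), (D', j), r)"
      obtain u where u: "t = ((D, i), (X, P), u)" "is_functor D X u" "fcomp E u i = P"
        using ts(1) unfolding coslice_Hom by blast
      obtain v where v: "s = ((D', j), (Y, Q), v)" "is_functor D' Y v" "fcomp E v j = Q"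
        using ts(2) unfolding coslice_Hom by blast
      show "\<exists>!d. d \<in> Hom ?C (D', j) (X, P) \<and>
          Comp ?C d ((D, i), (D', j), r) = t \<and> Comp ?C ((X, P), (Y, Q), p) d = s"
        unfolding u(1) v(1) ex using R u v eq by simp
    qed
  qed
qed

lemma terminal_category: "category terminal_cat"
  by (rule categoryI) (auto simp: terminal_cat_def Let_def Hom_def)

lemma terminal_functor: "is_functor C terminal_cat H \<Longrightarrow> H = const_fctr C terminal_cat undefined"
  by (cases H) (auto simp: is_functor_def functorial_def const_fctr_def terminal_cat_def Let_def
      fun_eq_iff extensional_def Pi_iff)

lemma const_terminal: "category C \<Longrightarrow> is_functor C terminal_cat (const_fctr C terminal_cat undefined)"
  by (rule const_functor[OF _ terminal_category]) (simp_all add: terminal_cat_def Let_def)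

section \<open>The right class in terms of unique fillers\<close>

locale sketch_ctx = size_pair small ismall
  for small ismall :: "'u set \<Rightarrow> bool" +
  fixes S :: "'u sketch"
  assumes sketch: "limit_sketch small ismall S"
begin

abbreviation "E \<equiv> Base S"

lemma small_E: "small_cat small E" and cat_E: "category E" and small_Ix: "small (Ix S)"
  and cone_E: "\<alpha> \<in> Ix S \<Longrightarrow> cone_in ismall E (Cone S \<alpha>)"
  using sketch small_catD(1) by (auto simp: limit_sketch_def)

lemma small_terminal: "small_cat small terminal_cat"
  unfolding small_cat_def using terminal_category
  by (auto simp: terminal_cat_def Let_def tight_def intro: small_finite)

lemma Rclass_Arr: "((X, P), (Y, Q), p) \<in> Rclass small S \<Longrightarrow> ((X, P), (Y, Q), p) \<in> Arr (coslice small E)"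
  by (simp add: Rclass_def right_orth_def)

lemma Xi_Arr:
  assumes "adjoin_cone small E y (Cone S \<alpha>) D i \<gamma>" "adjoin_lift small D (Cone S \<alpha>) i y \<gamma> D' r f"
  shows "((D, i), (D', fcomp E r i), r) \<in> Arr (coslice small E)"
  using assms fcomp_functor[OF cat_E]
  by (auto simp: coslice_Arr adjoin_cone_def adjoin_lift_def cone_triple_def lift_triple_def)

text \<open>A square from the generator at \<open>y\<close> and \<open>\<alpha>\<close> to
  \<open>p\<close> amounts to a cone \<open>\<tau>\<close> in \<open>X\<close> with a filler
  \<open>k\<close> of its image in \<open>Y\<close>, and a diagonal amounts to a filler of
  \<open>\<tau>\<close> over \<open>k\<close>. A terminal \<open>Y\<close> gives models; the
  relative form is what pullbacks and uniqueness of diagonals use.\<close>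

lemma Rclass_relative:
  assumes R: "((X, P), (Y, Q), p) \<in> Rclass small S" and y: "y \<in> Obj E" and \<alpha>: "\<alpha> \<in> Ix S"
    and \<tau>: "cone_at X P (Cone S \<alpha>) y \<tau>"
    and k: "fills Y Q (Cone S \<alpha>) y (whisker_l (Shape (Cone S \<alpha>)) p \<tau>) k"
  shows "\<exists>!h. fills X P (Cone S \<alpha>) y \<tau> h \<and> AMap p h = k"
proof -
  let ?c = "Cone S \<alpha>"
  note c = cone_E[OF \<alpha>]
  note c' = coneD[OF c]
  note ct = cone_triple_iff[OF cat_E c'(2,3) y]
  have Xs: "small_cat small X" and P: "is_functor E X P" and Ys: "small_cat small Y"
    and p: "is_functor X Y p" and Q: "fcomp E p P = Q"
    using Rclass_Arr[OF R] by (auto simp: coslice_Arr)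
  obtain D i \<gamma> where D: "adjoin_cone small E y ?c D i \<gamma>"
    using adjoin_cone_exists[OF small_E c y] .
  then have D': "cone_triple small E y ?c D i \<gamma>" by (simp add: adjoin_cone_def)
  then have i: "small_cat small D" "is_functor E D i" unfolding ct by auto
  obtain D' r f where L: "adjoin_lift small D ?c i y \<gamma> D' r f"
    using adjoin_lift_exists[OF small_E c y D'] .
  then have r: "lift_triple small D ?c i y \<gamma> D' r f" by (simp add: adjoin_lift_def)
  note lt = lift_triple_iff[OF c i(2) y]
  have r': "small_cat small D'" "is_functor D D' r" using r unfolding lt by auto
  note f = r[unfolded lt, THEN conjunct2, THEN conjunct2]
  have f': "f \<in> Arr D'" using f by (simp add: fills_def Hom_def)
  have "((D, i), (D', fcomp E r i), r) \<in> Xi small S"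
    unfolding Xi_def using D L y \<alpha> by blast
  then have "orthogonal (coslice small E) ((D, i), (D', fcomp E r i), r) ((X, P), (Y, Q), p)"
    using R by (simp add: Rclass_def right_orth_def)
  note orth = this[unfolded coslice_orthogonal[OF Xi_Arr[OF D L] Rclass_Arr[OF R]], rule_format]
  \<comment> \<open>The top of the square: the functor on \<open>E[y;\<alpha>]\<close> that
    classifies \<open>\<tau>\<close>.\<close>
  obtain u where u: "is_functor D X u" "fcomp E u i = P" "whisker_l (Shape ?c) u \<gamma> = \<tau>"
    using D Xs P \<tau> unfolding adjoin_cone_def ct by blast
  have pu: "is_functor D Y (fcomp D p u)" by (rule fcomp_functor[OF small_catD(1)[OF i(1)] u(1) p])
  have pui: "fcomp E (fcomp D p u) i = Q" using fcomp_assoc[OF i(2), of p u] u(2) Q by simp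
  have "\<gamma> j \<in> Arr D" if "j \<in> Obj (Shape ?c)" for j
    using D' that unfolding ct cone_over_def Hom_def by blast
  then have wpu: "whisker_l (Shape ?c) (fcomp D p u) \<gamma> = whisker_l (Shape ?c) p \<tau>"
    unfolding u(3)[symmetric] by (auto simp: whisker_l_def)
  have "lift_triple small D ?c i y \<gamma> Y (fcomp D p u) k"
    unfolding lt pui wpu using Ys pu k by blast
  \<comment> \<open>The bottom of the square: it extends \<open>p u\<close> and sends the free arrow
    to \<open>k\<close>.\<close>
  then obtain v where v: "is_functor D' Y v" "fcomp D v r = fcomp D p u" "AMap v f = k"
    and vuniq: "\<And>v'. is_functor D' Y v' \<Longrightarrow> fcomp D v' r = fcomp D p u \<Longrightarrow> AMap v' f = k \<Longrightarrow> v' = v"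
    using L unfolding adjoin_lift_def by metis
  have vQ: "fcomp E v (fcomp E r i) = Q" using fcomp_assoc[OF i(2), of v r] v(2) pui by simp
  obtain d where d: "is_functor D' X d" "fcomp D d r = u" "fcomp D' p d = v"
    and duniq: "\<And>d'. is_functor D' X d' \<Longrightarrow> fcomp E d' (fcomp E r i) = P \<Longrightarrow> fcomp D d' r = u \<Longrightarrow>
       fcomp D' p d' = v \<Longrightarrow> d' = d"
    using orth[OF u(1,2) v(1) vQ v(2)[symmetric]] by blast
  have lift: "lift_triple small D ?c i y \<gamma> X u h \<longleftrightarrow> fills X P ?c y \<tau> h" for h
    unfolding lt u(2,3) using Xs u(1) by blast
  show ?thesis
  proof (rule ex1I[of _ "AMap d f"])
    have dri: "fcomp E d (fcomp E r i) = P" using fcomp_assoc[OF i(2), of d r] d(2) u(2) by simp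
    have dw: "whisker_l (Shape ?c) d (whisker_l (Shape ?c) r \<gamma>) = \<tau>"
      using \<open>\<And>j. j \<in> Obj (Shape ?c) \<Longrightarrow> \<gamma> j \<in> Arr D\<close>
      unfolding u(3)[symmetric] d(2)[symmetric] by (auto simp: whisker_l_def)
    have "fills X P ?c y \<tau> (AMap d f)"
      using fills_map[OF c fcomp_functor[OF cat_E i(2) r'(2)] d(1) y f] unfolding dri dw .
    moreover have "AMap p (AMap d f) = k" using v(3) f' unfolding d(3)[symmetric] by simp
    ultimately show "fills X P ?c y \<tau> (AMap d f) \<and> AMap p (AMap d f) = k" ..
  next
    fix h assume h: "fills X P ?c y \<tau> h \<and> AMap p h = k"
    \<comment> \<open>A filler over \<open>k\<close> induces \<open>d'\<close>, and the uniqueness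
      of \<open>v\<close> gives \<open>p d' = v\<close>; so \<open>d'\<close> is a diagonal of the
      same square.\<close>
    then obtain d' where d': "is_functor D' X d'" "fcomp D d' r = u" "AMap d' f = h"
      using L lift unfolding adjoin_lift_def by metis
    have "fcomp D' p d' = v"
    proof (rule vuniq)
      show "is_functor D' Y (fcomp D' p d')"
        by (rule fcomp_functor[OF small_catD(1)[OF r'(1)] d'(1) p])
      show "fcomp D (fcomp D' p d') r = fcomp D p u"
        using fcomp_assoc[OF r'(2), of p d'] d'(2) by simp
      show "AMap (fcomp D' p d') f = k" using f' d'(3) h by simp
    qed
    moreover have "fcomp E d' (fcomp E r i) = P" using fcomp_assoc[OF i(2), of d' r] d'(2) u(2) by simp
    ultimately have "d' = d" using duniq d' by blast
    then show "h = AMap d f" using d' by simp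
  qed
qed

text \<open>A square to the terminal category commutes and has only one possible bottom. Its
  diagonals are thus the extensions of \<open>u\<close> along \<open>r\<close>, which correspond to
  the fillers of the cone obtained from \<open>\<gamma>\<close> by \<open>u\<close>.\<close>

lemma model_Rclass:
  assumes m: "model small S X P"
  shows "((X, P), (terminal_cat, const_fctr E terminal_cat undefined),
    const_fctr X terminal_cat undefined) \<in> Rclass small S" (is "?p \<in> _")
proof -
  have X: "small_cat small X" "category X" "is_functor E X P" using modelD[OF m] by auto
  have pA: "?p \<in> Arr (coslice small E)"
    unfolding coslice_Arr using X small_terminal const_terminal[OF cat_E] const_terminal[OF X(2)]
      terminal_functor[OF fcomp_functor[OF cat_E X(3) const_terminal[OF X(2)]]] by blast
  show ?thesis
    unfolding Rclass_def right_orth_def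
  proof (clarify, rule conjI[OF pA], clarify)
    fix D i D' j r assume "((D, i), (D', j), r) \<in> Xi small S"
    then obtain y \<alpha> \<gamma> f where j: "j = fcomp E r i" and y: "y \<in> Obj E" and \<alpha>: "\<alpha> \<in> Ix S"
      and D: "adjoin_cone small E y (Cone S \<alpha>) D i \<gamma>"
      and L: "adjoin_lift small D (Cone S \<alpha>) i y \<gamma> D' r f"
      unfolding Xi_def by blast
    let ?c = "Cone S \<alpha>"
    note c = cone_E[OF \<alpha>]
    note c' = coneD[OF c]
    note ct = cone_triple_iff[OF cat_E c'(2,3) y]
    have D': "cone_triple small E y ?c D i \<gamma>" using D by (simp add: adjoin_cone_def)
    then have i: "small_cat small D" "is_functor E D i" unfolding ct by auto
    note lt = lift_triple_iff[OF c i(2) y]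
    have r: "lift_triple small D ?c i y \<gamma> D' r f" using L by (simp add: adjoin_lift_def)
    have r': "small_cat small D'" "is_functor D D' r" using r unfolding lt by auto
    note f = r[unfolded lt, THEN conjunct2, THEN conjunct2]
    show "orthogonal (coslice small E) ((D, i), (D', j), r) ?p"
      unfolding j coslice_orthogonal[OF Xi_Arr[OF D L] pA]
    proof (intro allI impI)
      fix u v assume u: "is_functor D X u" "fcomp E u i = P" and v: "is_functor D' terminal_cat v"
      let ?\<tau> = "whisker_l (Shape ?c) u \<gamma>"
      have "cone_at D i ?c y \<gamma>" using D' unfolding ct by blast
      then have "cone_at X P ?c y ?\<tau>" using cone_over_map[OF c'(2,3) i(2) u(1) y] u(2) by simp
      then obtain h where h: "fills X P ?c y ?\<tau> h" and huniq: "\<And>h'. fills X P ?c y ?\<tau> h' \<Longrightarrow> h' = h"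
        using modelD(4)[OF m y \<alpha>] by blast
      have "lift_triple small D ?c i y \<gamma> X u h" unfolding lt u(2) using X u(1) h by blast
      then obtain d where d: "is_functor D' X d" "fcomp D d r = u" "AMap d f = h"
        and duniq: "\<And>d'. is_functor D' X d' \<Longrightarrow> fcomp D d' r = u \<Longrightarrow> AMap d' f = h \<Longrightarrow> d' = d"
        using L unfolding adjoin_lift_def by metis
      have ass: "fcomp E d' (fcomp E r i) = P" if "fcomp D d' r = u" for d' :: "'u sfctr"
        using fcomp_assoc[OF i(2), of d' r] that u(2) by simp
      show "\<exists>!d. is_functor D' X d \<and> fcomp E d (fcomp E r i) = P \<and> fcomp D d r = u \<and>
          fcomp D' (const_fctr X terminal_cat undefined) d = v"
      proof (rule ex1I[of _ d])
        show "is_functor D' X d \<and> fcomp E d (fcomp E r i) = P \<and> fcomp D d r = u \<and>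
          fcomp D' (const_fctr X terminal_cat undefined) d = v"
          using d ass[OF d(2)] terminal_functor[OF v] terminal_functor[OF
              fcomp_functor[OF small_catD(1)[OF r'(1)] d(1) const_terminal[OF X(2)]]] by simp
        fix d' assume d': "is_functor D' X d' \<and> fcomp E d' (fcomp E r i) = P \<and> fcomp D d' r = u \<and>
          fcomp D' (const_fctr X terminal_cat undefined) d' = v"
        have "\<gamma> j \<in> Arr D" if "j \<in> Obj (Shape ?c)" for j
          using D' that unfolding ct cone_over_def Hom_def by blast
        then have dw: "whisker_l (Shape ?c) d' (whisker_l (Shape ?c) r \<gamma>) = ?\<tau>"
          using d' by (auto simp: whisker_l_def)
        have "fills X P ?c y ?\<tau> (AMap d' f)"
          using fills_map[OF c fcomp_functor[OF cat_E i(2) r'(2)] _ y f, of X d'] d' dw by simp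
        then show "d' = d" using duniq huniq d' by blast
      qed
    qed
  qed
qed

lemma Rclass_model:
  assumes R: "((X, P), (terminal_cat, t), p) \<in> Rclass small S"
  shows "model small S X P"
proof -
  have X: "small_cat small X" and P: "is_functor E X P" and p: "is_functor X terminal_cat p"
    using Rclass_Arr[OF R] by (auto simp: coslice_Arr)
  have pc: "p = const_fctr X terminal_cat undefined" by (rule terminal_functor[OF p])
  have tc: "t = const_fctr E terminal_cat undefined"
    using Rclass_Arr[OF R] terminal_functor by (auto simp: coslice_Arr)
  have "\<exists>!h. fills X P (Cone S \<alpha>) y \<tau> h"
    if y: "y \<in> Obj E" and \<alpha>: "\<alpha> \<in> Ix S" and \<tau>: "cone_at X P (Cone S \<alpha>) y \<tau>" for y \<alpha> \<tau>
  proof -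
    note c = coneD[OF cone_E[OF \<alpha>]]
    have "\<tau> j \<in> Arr X" if "j \<in> Obj (Shape (Cone S \<alpha>))" for j
      using \<tau> that by (auto simp: cone_over_def Hom_def)
    \<comment> \<open>The terminal category has a single arrow, which fills every cone; lying over
      it imposes nothing on a filler in \<open>X\<close>.\<close>
    then have k: "fills terminal_cat t (Cone S \<alpha>) y (whisker_l (Shape (Cone S \<alpha>)) p \<tau>) undefined"
      using y c unfolding pc tc
      by (auto simp: fills_def whisker_l_def const_fctr_def terminal_cat_def Let_def Hom_def)
    have "AMap p h = undefined" if "fills X P (Cone S \<alpha>) y \<tau> h" for h
      using that unfolding pc by (auto simp: fills_def const_fctr_def terminal_cat_def Let_def Hom_def)
    then show ?thesis using Rclass_relative[OF R y \<alpha> \<tau> k] by metis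
  qed
  then show ?thesis unfolding model_def using X P by blast
qed

end

section \<open>The initial model\<close>

context sketch_ctx
begin

text \<open>The operations on families act factorwise, by the unique fillers of the models. Closure
  under them gives existence of fillers in \<open>D\<close>, and joint faithfulness of the
  projections gives uniqueness. The functor to a given model is the projection to the factor indexed
  by that model.\<close>

lemma initial_model_exists:
  "\<exists>D L. model small S D L \<and> generated S D L \<and> Obj D = Obj E \<and> (\<forall>x\<in>Obj E. OMap L x = x) \<and>
     (\<forall>X P. model small S X P \<longrightarrow> (\<exists>H. is_functor D X H \<and> fcomp E H L = P))"
proof -
  define M where "M = {(X, P). model small S X P}"
  define X :: "'u scat \<times> 'u sfctr \<Rightarrow> 'u scat" where "X = fst"
  define F :: "'u scat \<times> 'u sfctr \<Rightarrow> 'u sfctr" where "F = snd"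
  define K where "K = Obj E \<times> Ix S"
  define ar where "ar k = Obj (Shape (Cone S (snd k)))" for k :: "'u \<times> 'u"
  define cmp where "cmp k f m = (\<lambda>j\<in>ar k. fst (snd (f j)) m)"
    for k and f :: "'u \<Rightarrow> ('u, 'u scat \<times> 'u sfctr) tup" and m
  \<comment> \<open>Restricts the operations to families that are cones in every factor. Exactly
    there the filler in each model exists uniquely, so the \<open>THE\<close> in \<open>op\<close>
    denotes it.\<close>
  define guard where "guard k f \<longleftrightarrow>
      (\<forall>j\<in>ar k. fst (f j) = fst k \<and> snd (snd (f j)) = OMap (Diagram (Cone S (snd k))) j) \<and>
      (\<forall>m\<in>M. cone_at (X m) (F m) (Cone S (snd k)) (fst k) (cmp k f m))"
    for k and f :: "'u \<Rightarrow> ('u, 'u scat \<times> 'u sfctr) tup"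
  define op where "op k f = (fst k,
      \<lambda>m\<in>M. THE h. fills (X m) (F m) (Cone S (snd k)) (fst k) (cmp k f m) h, Vertex (Cone S (snd k)))"
    for k and f :: "'u \<Rightarrow> ('u, 'u scat \<times> 'u sfctr) tup"
  let ?G = "generated_tups E M X F {} K ar guard op"
  have m: "model small S (X m) (F m)" if "m \<in> M" for m
    using that by (auto simp: M_def X_def F_def)
  note XF = modelD(2,3)[OF m]
  have the: "fills (X m) (F m) (Cone S (snd k)) (fst k) (cmp k f m) (THE h.
        fills (X m) (F m) (Cone S (snd k)) (fst k) (cmp k f m) h)"
    if "m \<in> M" "k \<in> K" "guard k f" for m k f
  proof -
    have "cone_at (X m) (F m) (Cone S (snd k)) (fst k) (cmp k f m)"
      using that by (simp add: guard_def)
    moreover have "fst k \<in> Obj E" "snd k \<in> Ix S" using that(2) by (auto simp: K_def)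
    ultimately show ?thesis using theI'[OF modelD(4)[OF m[OF that(1)]]] by blast
  qed
  have valid_op: "valid_tup E M X F (op k f)" if k: "k \<in> K" and g: "guard k f" for k f
    using the[OF _ k g] k coneD(1)[OF cone_E]
    by (auto simp: valid_tup_def op_def K_def fills_def)
  \<comment> \<open>The full strength of the size condition: one small set contains \<open>E\<close>
    and the index set and absorbs families over all shapes of the specified cones.\<close>
  obtain Y where Y: "small Y" "infinite Y" "Obj E \<union> Arr E \<union> Ix S \<subseteq> Y"
    "\<And>\<alpha>. \<alpha> \<in> Ix S \<Longrightarrow> (Obj (Shape (Cone S \<alpha>)) \<rightarrow>\<^sub>E Y) \<lesssim> Y"
    by (rule small_closed[of "Obj E \<union> Arr E \<union> Ix S" "Ix S" "\<lambda>\<alpha>. Obj (Shape (Cone S \<alpha>))"])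
      (use small_Un small_catD[OF small_E] small_Ix coneD(4)[OF cone_E] in auto)
  have KY: "K \<lesssim> Y"
    by (rule lepoll_trans[OF subset_imp_lepoll Times_lepoll_self[OF Y(2)]]) (use Y(3) in \<open>auto simp: K_def\<close>)
  have "\<exists>D L \<pi>. tuple_cat E M X F ?G D L \<pi> \<and> tight D \<and> Arr D \<lesssim> Y"
  proof (rule closure_tuple_cat[OF cat_E])
    show "Arr E \<lesssim> Y" using Y(3) by (auto intro: subset_imp_lepoll)
    show "(ar k \<rightarrow>\<^sub>E Y) \<lesssim> Y" if "k \<in> K" for k using that Y(4) by (auto simp: ar_def K_def)
  qed (use XF valid_op Y KY in auto)
  then obtain D L \<pi> where T: "tuple_cat E M X F ?G D L \<pi>" "tight D" "Arr D \<lesssim> Y" by blast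
  interpret T: tuple_cat E M X F ?G D L \<pi> by (rule T(1))
  have Ds: "small_cat small D"
    unfolding small_cat_def using T(2,3) T.cat_D T.Obj_D small_catD(3)[OF small_E] Y(1) small_lepoll by auto
  have cmp_tup: "cmp k (\<lambda>j\<in>ar k. T.tup (\<tau> j)) m = whisker_l (Shape (Cone S (snd k))) (\<pi> m) \<tau>"
    if "m \<in> M" for k \<tau> m
    using T.tup_proj[OF that] by (auto simp: cmp_def ar_def whisker_l_def)
  have guardI: "guard k (\<lambda>j\<in>ar k. T.tup (\<tau> j))"
    if k: "k \<in> K" and \<tau>: "cone_at D L (Cone S (snd k)) (fst k) \<tau>" for k \<tau>
  proof -
    have k': "fst k \<in> Obj E" "snd k \<in> Ix S" using k by (auto simp: K_def)
    note c = coneD[OF cone_E[OF k'(2)]]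
    have "cone_at (X m) (F m) (Cone S (snd k)) (fst k) (cmp k (\<lambda>j\<in>ar k. T.tup (\<tau> j)) m)"
      if "m \<in> M" for m
      using cone_over_map[OF c(2,3) T.fun_L T.proj[OF that] k'(1) \<tau>]
      unfolding cmp_tup[OF that] T.proj_L[OF that] .
    moreover have "fst (T.tup (\<tau> j)) = fst k \<and> snd (snd (T.tup (\<tau> j))) = OMap (Diagram (Cone S (snd k))) j"
      if "j \<in> ar k" for j
      using \<tau> that k' fun_Obj[OF c(3)] by (auto simp: cone_over_def ar_def T.tup_def Hom_def T.OMap_L)
    ultimately show ?thesis by (simp add: guard_def)
  qed
  \<comment> \<open>The converse of \<open>guardI\<close>, with naturality checked in each factor.
    It translates an induction over guarded families of tuples into one over cones in
    \<open>D\<close>.\<close>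
  have guardD: "cone_at D L (Cone S (snd k)) (fst k) (restrict \<tau> (ar k))"
    if k: "k \<in> K" and \<tau>: "\<And>j. j \<in> ar k \<Longrightarrow> \<tau> j \<in> Arr D" and g: "guard k (\<lambda>j\<in>ar k. T.tup (\<tau> j))" for k \<tau>
  proof -
    let ?c = "Cone S (snd k)"
    have k': "fst k \<in> Obj E" "snd k \<in> Ix S" using k by (auto simp: K_def)
    note c = coneD[OF cone_E[OF k'(2)]]
    have H: "\<tau> j \<in> Hom D (OMap L (fst k)) (OMap L (OMap (Diagram ?c) j))" if j: "j \<in> ar k" for j
    proof -
      have "OMap (Diagram ?c) j \<in> Obj E" using fun_Obj[OF c(3)] j by (simp add: ar_def)
      then show ?thesis using g j \<tau>[OF j] k' by (auto simp: guard_def Hom_def T.tup_def T.OMap_L)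
    qed
    have "Comp D (AMap L (AMap (Diagram ?c) u)) (\<tau> (Dom (Shape ?c) u)) = \<tau> (Cod (Shape ?c) u)"
      if u: "u \<in> Arr (Shape ?c)" for u
    proof -
      let ?a = "Dom (Shape ?c) u" and ?b = "Cod (Shape ?c) u"
      have ab: "?a \<in> ar k" "?b \<in> ar k" using arr_Obj[OF c(2) u] by (simp_all add: ar_def)
      have 1: "AMap L (AMap (Diagram ?c) u) \<in> Hom D (OMap L (OMap (Diagram ?c) ?a)) (OMap L (OMap (Diagram ?c) ?b))"
        by (intro fun_Hom[OF T.fun_L] fun_Hom[OF c(3)] arr_Hom u)
      show ?thesis
      proof (rule T.faithful[OF Comp_Hom[OF T.cat_D H[OF ab(1)] 1] H[OF ab(2)]])
        fix m assume m: "m \<in> M"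
        have "cone_at (X m) (F m) ?c (fst k) (whisker_l (Shape ?c) (\<pi> m) \<tau>)"
          using g m unfolding guard_def cmp_tup[OF m, symmetric] by blast
        then have "Comp (X m) (AMap (F m) (AMap (Diagram ?c) u)) (whisker_l (Shape ?c) (\<pi> m) \<tau> ?a) =
            whisker_l (Shape ?c) (\<pi> m) \<tau> ?b"
          using u unfolding cone_over_def by blast
        then have "Comp (X m) (AMap (F m) (AMap (Diagram ?c) u)) (AMap (\<pi> m) (\<tau> ?a)) = AMap (\<pi> m) (\<tau> ?b)"
          using ab by (simp add: whisker_l_def ar_def)
        then show "AMap (\<pi> m) (Comp D (AMap L (AMap (Diagram ?c) u)) (\<tau> ?a)) = AMap (\<pi> m) (\<tau> ?b)"
          using fun_Comp[OF T.proj[OF m] H[OF ab(1)] 1] T.proj_arr_L[OF m fun_arr(1)[OF c(3) u]] by simp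
      qed
    qed
    then show ?thesis using H arr_Obj[OF c(2)] by (auto simp: cone_over_def ar_def)
  qed
  \<comment> \<open>The composites with the legs are compared factor by factor, where the components
    are fillers by the choice of \<open>op\<close>.\<close>
  have opD: "fills D L (Cone S (snd k)) (fst k) \<tau> f"
    if k: "k \<in> K" and \<tau>: "cone_at D L (Cone S (snd k)) (fst k) \<tau>" and f: "f \<in> Arr D"
      and op: "T.tup f = op k (\<lambda>j\<in>ar k. T.tup (\<tau> j))" for k \<tau> f
  proof -
    let ?c = "Cone S (snd k)"
    have k': "fst k \<in> Obj E" "snd k \<in> Ix S" using k by (auto simp: K_def)
    note c = coneD[OF cone_E[OF k'(2)]]
    have fH: "f \<in> Hom D (OMap L (fst k)) (OMap L (Vertex ?c))"
      using op f k' c(1) by (auto simp: T.tup_def op_def Hom_def T.OMap_L)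
    have fi: "fills (X m) (F m) ?c (fst k) (whisker_l (Shape ?c) (\<pi> m) \<tau>) (AMap (\<pi> m) f)"
      if m: "m \<in> M" for m
      using the[OF m k guardI[OF k \<tau>]] T.tup_proj[OF m, of f] m
      unfolding op cmp_tup[OF m] by (simp add: op_def cmp_tup)
    have "Comp D (AMap L (Leg ?c j)) f = \<tau> j" if j: "j \<in> Obj (Shape ?c)" for j
    proof (rule T.faithful[OF Comp_Hom[OF T.cat_D fH fun_Hom[OF T.fun_L c(5)[OF j]]]])
      show "\<tau> j \<in> Hom D (OMap L (fst k)) (OMap L (OMap (Diagram ?c) j))"
        using \<tau> j by (simp add: cone_over_def)
      fix m assume m: "m \<in> M"
      show "AMap (\<pi> m) (Comp D (AMap L (Leg ?c j)) f) = AMap (\<pi> m) (\<tau> j)"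
        using fi[OF m] j fun_Comp[OF T.proj[OF m] fH fun_Hom[OF T.fun_L c(5)[OF j]]]
          T.proj_arr_L[OF m c(6)[OF j]] by (simp add: fills_def whisker_l_def)
    qed
    then show ?thesis using fH by (simp add: fills_def)
  qed
  have "\<exists>!h. fills D L (Cone S \<alpha>) y \<tau> h"
    if y: "y \<in> Obj E" and \<alpha>: "\<alpha> \<in> Ix S" and \<tau>: "cone_at D L (Cone S \<alpha>) y \<tau>" for y \<alpha> \<tau>
  proof -
    note c = coneD[OF cone_E[OF \<alpha>]]
    have k: "(y, \<alpha>) \<in> K" using y \<alpha> by (simp add: K_def)
    have ar: "ar (y, \<alpha>) = Obj (Shape (Cone S \<alpha>))" by (simp add: ar_def)
    \<comment> \<open>Existence: the tuple of all fillers belongs to the closure and so comes from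
      an arrow of \<open>D\<close>.\<close>
    have "op (y, \<alpha>) (\<lambda>j\<in>ar (y, \<alpha>). T.tup (\<tau> j)) \<in> ?G"
    proof (rule closure_ops.fam[OF k])
      show "guard (y, \<alpha>) (\<lambda>j\<in>ar (y, \<alpha>). T.tup (\<tau> j))" by (rule guardI[OF k]) (simp add: \<tau>)
      show "(\<lambda>j\<in>ar (y, \<alpha>). T.tup (\<tau> j)) j \<in> ?G" if j: "j \<in> ar (y, \<alpha>)" for j
      proof -
        have "\<tau> j \<in> Arr D" using \<tau> j unfolding ar cone_over_def Hom_def by blast
        then show ?thesis using T.tup_in[of "\<tau> j"] j by simp
      qed
    qed (rule restrict_extensional)
    then obtain h where h: "h \<in> Arr D" "T.tup h = op (y, \<alpha>) (\<lambda>j\<in>ar (y, \<alpha>). T.tup (\<tau> j))"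
      using T.tup_surj by blast
    have fh: "fills D L (Cone S \<alpha>) y \<tau> h" using opD[OF k _ h] \<tau> by simp
    show ?thesis
    proof (rule ex1I[of _ h])
      show "fills D L (Cone S \<alpha>) y \<tau> h" by (rule fh)
    next
      fix h' assume h': "fills D L (Cone S \<alpha>) y \<tau> h'"
      show "h' = h"
      proof (rule T.faithful)
        show "h' \<in> Hom D (OMap L y) (OMap L (Vertex (Cone S \<alpha>)))"
          "h \<in> Hom D (OMap L y) (OMap L (Vertex (Cone S \<alpha>)))"
          using fh h' by (auto simp: fills_def)
        fix mm assume mm: "mm \<in> M"
        \<comment> \<open>Uniqueness: both arrows project to fillers of one cone in a model.\<close>
        have "cone_at (X mm) (F mm) (Cone S \<alpha>) y (whisker_l (Shape (Cone S \<alpha>)) (\<pi> mm) \<tau>)"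
          using cone_over_map[OF c(2,3) T.fun_L T.proj[OF mm] y \<tau>] unfolding T.proj_L[OF mm] .
        moreover have "fills (X mm) (F mm) (Cone S \<alpha>) y (whisker_l (Shape (Cone S \<alpha>)) (\<pi> mm) \<tau>) (AMap (\<pi> mm) g)"
          if "fills D L (Cone S \<alpha>) y \<tau> g" for g
          using fills_map[OF cone_E[OF \<alpha>] T.fun_L T.proj[OF mm] y that] unfolding T.proj_L[OF mm] .
        ultimately show "AMap (\<pi> mm) h' = AMap (\<pi> mm) h"
          using modelD(4)[OF m[OF mm] y \<alpha>] fh h' by blast
      qed
    qed
  qed
  then have "model small S D L" unfolding model_def using Ds T.fun_L by blast
  moreover have "generated S D L"
    unfolding generated_def
  proof (intro allI impI ballI)
    fix W :: "'u \<Rightarrow> bool" and f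
    assume W: "\<forall>f\<in>Arr E. W (AMap L f)"
      "\<forall>x y z f g. f \<in> Hom D x y \<longrightarrow> g \<in> Hom D y z \<longrightarrow> W f \<longrightarrow> W g \<longrightarrow> W (Comp D g f)"
      and Wf: "\<forall>y\<in>Obj E. \<forall>\<alpha>\<in>Ix S. \<forall>\<tau> h. cone_at D L (Cone S \<alpha>) y \<tau> \<longrightarrow>
        (\<forall>j\<in>Obj (Shape (Cone S \<alpha>)). W (\<tau> j)) \<longrightarrow> fills D L (Cone S \<alpha>) y \<tau> h \<longrightarrow> W h"
      and f: "f \<in> Arr D"
    show "W f"
    proof (rule T.generated_induct[OF refl _ _ _ _ f])
      show "W f" if k: "k \<in> K" and f: "f \<in> Arr D" and h: "\<And>j. j \<in> ar k \<Longrightarrow> h j \<in> Arr D \<and> W (h j)"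
        and g: "guard k (\<lambda>j\<in>ar k. T.tup (h j))" and op: "T.tup f = op k (\<lambda>j\<in>ar k. T.tup (h j))"
        for k h f
      proof -
        let ?\<tau> = "restrict h (ar k)"
        have \<tau>: "cone_at D L (Cone S (snd k)) (fst k) ?\<tau>" using guardD[OF k _ g] h by blast
        have "(\<lambda>j\<in>ar k. T.tup (?\<tau> j)) = (\<lambda>j\<in>ar k. T.tup (h j))" by auto
        then have "fills D L (Cone S (snd k)) (fst k) ?\<tau> f" using opD[OF k \<tau> f] op by simp
        moreover have "fst k \<in> Obj E" "snd k \<in> Ix S" using k by (auto simp: K_def)
        moreover have "\<forall>j\<in>Obj (Shape (Cone S (snd k))). W (?\<tau> j)" using h by (simp add: ar_def)
        ultimately show ?thesis using Wf \<tau> by blast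
      qed
    qed (use W in auto)
  qed
  moreover have "\<exists>H. is_functor D Z H \<and> fcomp E H L = P" if "model small S Z P" for Z P
  proof -
    have "(Z, P) \<in> M" using that by (simp add: M_def)
    then show ?thesis using T.proj[of "(Z, P)"] T.proj_L[of "(Z, P)"] by (auto simp: X_def F_def)
  qed
  ultimately show ?thesis using T.Obj_D T.OMap_L by blast
qed

text \<open>The arrows on which \<open>H\<close> and \<open>H'\<close> agree contain the image of
  \<open>E\<close> and are closed under the generating operations. The condition \<open>uniq\<close>
  compares only the two values at a common arrow. Thus it holds in a model, and also when
  \<open>X\<close> lies over some \<open>Y\<close> by an arrow of the right class and both functors
  have the same composite to \<open>Y\<close>.\<close>

lemma generated_functor_eq:
  assumes g: "generated S D L" and L: "is_functor E D L" and surj: "Obj D \<subseteq> OMap L ` Obj E"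
    and H: "is_functor D X H" "is_functor D X H'"
    and eq: "fcomp E H L = fcomp E H' L"
    and uniq: "\<And>y \<alpha> \<tau> f. y \<in> Obj E \<Longrightarrow> \<alpha> \<in> Ix S \<Longrightarrow> f \<in> Arr D \<Longrightarrow> cone_at X (fcomp E H L) (Cone S \<alpha>) y \<tau> \<Longrightarrow>
       fills X (fcomp E H L) (Cone S \<alpha>) y \<tau> (AMap H f) \<Longrightarrow>
       fills X (fcomp E H L) (Cone S \<alpha>) y \<tau> (AMap H' f) \<Longrightarrow> AMap H f = AMap H' f"
  shows "H = H'"
proof (rule fctr_eqI[OF H])
  show "OMap H x = OMap H' x" if x: "x \<in> Obj D" for x
  proof -
    obtain z where z: "z \<in> Obj E" "x = OMap L z" using surj x by blast
    then show ?thesis using arg_cong[OF eq, of "\<lambda>F. OMap F z"] by simp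
  qed
  show "AMap H f = AMap H' f" if f: "f \<in> Arr D" for f
  proof (rule generatedD[OF g _ _ _ f, where W = "\<lambda>f. AMap H f = AMap H' f"])
    show "AMap H (AMap L f) = AMap H' (AMap L f)" if "f \<in> Arr E" for f
      using arg_cong[OF eq, of "\<lambda>F. AMap F f"] that by simp
    show "AMap H (Comp D g f) = AMap H' (Comp D g f)"
      if "f \<in> Hom D x y" "g \<in> Hom D y z" "AMap H f = AMap H' f" "AMap H g = AMap H' g" for x y z f g
      using fun_Comp[OF H(1) that(1,2)] fun_Comp[OF H(2) that(1,2)] that(3,4) by simp
    show "AMap H h = AMap H' h"
      if y: "y \<in> Obj E" and \<alpha>: "\<alpha> \<in> Ix S" and \<tau>: "cone_at D L (Cone S \<alpha>) y \<tau>"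
        and e: "\<And>j. j \<in> Obj (Shape (Cone S \<alpha>)) \<Longrightarrow> AMap H (\<tau> j) = AMap H' (\<tau> j)"
        and h: "fills D L (Cone S \<alpha>) y \<tau> h" for y \<alpha> \<tau> h
    proof (rule uniq[OF y \<alpha>])
      note c = coneD[OF cone_E[OF \<alpha>]]
      let ?\<sigma> = "whisker_l (Shape (Cone S \<alpha>)) H \<tau>"
      show "h \<in> Arr D" using h by (simp add: fills_def Hom_def)
      show "cone_at X (fcomp E H L) (Cone S \<alpha>) y ?\<sigma>" by (rule cone_over_map[OF c(2,3) L H(1) y \<tau>])
      show "fills X (fcomp E H L) (Cone S \<alpha>) y ?\<sigma> (AMap H h)"
        by (rule fills_map[OF cone_E[OF \<alpha>] L H(1) y h])
      have "?\<sigma> = whisker_l (Shape (Cone S \<alpha>)) H' \<tau>" using e by (auto simp: whisker_l_def)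
      then show "fills X (fcomp E H L) (Cone S \<alpha>) y ?\<sigma> (AMap H' h)"
        using fills_map[OF cone_E[OF \<alpha>] L H(2) y h] eq by simp
    qed
  qed
qed

lemma generated_functor_eq_model:
  assumes g: "generated S D L" and L: "is_functor E D L" and surj: "Obj D \<subseteq> OMap L ` Obj E"
    and H: "is_functor D X H" "is_functor D X H'"
    and eq: "fcomp E H L = P" "fcomp E H' L = P" and m: "model small S X P"
  shows "H = H'"
  by (rule generated_functor_eq[OF g L surj H]) (use eq modelD(4)[OF m] in \<open>auto, blast\<close>)

text \<open>\<open>Z\<close> is the full subcategory of the pullback of \<open>p\<close> and
  \<open>v\<close> on the objects \<open>(L x, P x)\<close>; these suffice because models are tested
  only at images of objects of \<open>E\<close>. A cone in \<open>Z\<close> is filled first in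
  \<open>D\<close>; the image of that filler under \<open>v\<close> is the arrow of \<open>Y\<close>
  over which the right class provides a unique filler in \<open>X\<close>.\<close>

lemma pullback_model:
  assumes R: "((X, P), (Y, Q), p) \<in> Rclass small S"
    and m: "model small S D L" and D: "Obj D = Obj E" "\<And>x. x \<in> Obj E \<Longrightarrow> OMap L x = x"
    and v: "is_functor D Y v" "fcomp E v L = Q"
  obtains Z K a b where "model small S Z K" "is_functor Z D a" "is_functor Z X b"
    "fcomp E a K = L" "fcomp E b K = P" "\<And>f. f \<in> Arr Z \<Longrightarrow> AMap v (AMap a f) = AMap p (AMap b f)"
proof -
  have X: "small_cat small X" "category X" "is_functor E X P" and Y: "small_cat small Y" "category Y" "is_functor E Y Q"
    and p: "is_functor X Y p" "fcomp E p P = Q"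
    using Rclass_Arr[OF R] small_catD(1) by (auto simp: coslice_Arr)
  note m' = modelD[OF m]
  \<comment> \<open>The two factors are indexed by booleans, \<open>True\<close> for
    \<open>D\<close> and \<open>False\<close> for \<open>X\<close>.\<close>
  define XX where "XX i = (if i then D else X)" for i
  define FF where "FF i = (if i then L else P)" for i
  \<comment> \<open>All compatible pairs of arrows rather than a generated set, so that pairs of
    fillers belong to it.\<close>
  define G where "G = {t. valid_tup E UNIV XX FF t \<and> AMap v (fst (snd t) True) = AMap p (fst (snd t) False)}"
  have Gv: "x \<in> Obj E" "y \<in> Obj E" "a True \<in> Hom D (OMap L x) (OMap L y)" "a False \<in> Hom X (OMap P x) (OMap P y)"
    "AMap v (a True) = AMap p (a False)" if "(x, a, y) \<in> G" for x a y
    using that by (auto simp: G_def valid_tup_def XX_def FF_def all_bool_eq)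
  have GI: "(x, a, y) \<in> G" if "x \<in> Obj E" "y \<in> Obj E" "a True \<in> Hom D (OMap L x) (OMap L y)"
    "a False \<in> Hom X (OMap P x) (OMap P y)" "AMap v (a True) = AMap p (a False)" for x a y
    using that by (auto simp: G_def valid_tup_def XX_def FF_def all_bool_eq)
  have XF: "category (XX i)" "is_functor E (XX i) (FF i)" for i
    using X m' by (auto simp: XX_def FF_def)
  obtain B where B: "small B" "infinite B" "Arr D \<lesssim> B" "Arr X \<lesssim> B"
    using small_bound[OF small_catD(4)[OF m'(1)] small_catD(4)[OF X(1)]] .
  have "G \<lesssim> Arr D \<times> Arr X"
    unfolding lepoll_def
  proof (intro exI[of _ "\<lambda>t. (fst (snd t) True, fst (snd t) False)"] conjI)
    show "inj_on (\<lambda>t. (fst (snd t) True, fst (snd t) False)) G"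
    proof (rule inj_onI)
      fix s t assume st: "s \<in> G" "t \<in> G"
        and eq: "(fst (snd s) True, fst (snd s) False) = (fst (snd t) True, fst (snd t) False)"
      obtain x a y where s: "s = (x, a, y)" by (cases s)
      obtain x' a' y' where t: "t = (x', a', y')" by (cases t)
      have "a = a'" using eq unfolding s t fun_eq_iff by (simp add: all_bool_eq)
      \<comment> \<open>The endpoints can be read off from the component in \<open>D\<close>, since
        \<open>L\<close> is the identity on objects.\<close>
      moreover have "x = x'" "y = y'"
        using Gv(1-3)[of x a y] Gv(1-3)[of x' a' y'] st calculation unfolding s t Hom_def by (auto simp: D)
      ultimately show "s = t" unfolding s t by simp
    qed
    show "(\<lambda>t. (fst (snd t) True, fst (snd t) False)) ` G \<subseteq> Arr D \<times> Arr X"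
      using Gv(3,4) by (fastforce simp: Hom_def)
  qed
  also have "\<dots> \<lesssim> B" using Sigma_lepoll_self[OF B(2,3) B(4)] .
  finally have GB: "G \<lesssim> B" .
  have "\<exists>Z K \<pi>. tuple_cat E UNIV XX FF G Z K \<pi> \<and> tight Z \<and> Arr Z \<lesssim> B"
  proof (rule tuple_cat_exists[OF cat_E XF _ _ _ GB])
    show "valid_tup E UNIV XX FF t" if "t \<in> G" for t using that by (simp add: G_def)
    show "base_tup E UNIV FF f \<in> G" if f: "f \<in> Arr E" for f
      unfolding base_tup_def
    proof (rule GI)
      show "AMap v ((\<lambda>m\<in>UNIV. AMap (FF m) f) True) = AMap p ((\<lambda>m\<in>UNIV. AMap (FF m) f) False)"
        using arg_cong[OF v(2), of "\<lambda>F. AMap F f"] arg_cong[OF p(2), of "\<lambda>F. AMap F f"] f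
        by (simp add: FF_def)
    qed (use arr_Obj[OF cat_E f] fun_Hom[OF m'(3) arr_Hom[OF f]] fun_Hom[OF X(3) arr_Hom[OF f]] in
        \<open>simp_all add: FF_def\<close>)
    show "comp_tup UNIV XX g f \<in> G" if fg: "f \<in> G" "g \<in> G" "snd (snd f) = fst g" for f g
    proof -
      obtain x a y where f: "f = (x, a, y)" by (cases f)
      obtain b z where g: "g = (y, b, z)" using fg(3) f by (cases g) auto
      note fv = Gv[OF fg(1)[unfolded f]] and gv = Gv[OF fg(2)[unfolded g]]
      show ?thesis
        unfolding f g comp_tup_def fst_conv snd_conv
        by (rule GI) (use fv gv Comp_Hom[OF m'(2) fv(3) gv(3)] Comp_Hom[OF X(2) fv(4) gv(4)]
          fun_Comp[OF v(1) fv(3) gv(3)] fun_Comp[OF p(1) fv(4) gv(4)] in \<open>simp_all add: XX_def\<close>)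
    qed
  qed
  then obtain Z K \<pi> where T: "tuple_cat E UNIV XX FF G Z K \<pi>" "tight Z" "Arr Z \<lesssim> B" by blast
  interpret T: tuple_cat E UNIV XX FF G Z K \<pi> by (rule T(1))
  have Zs: "small_cat small Z"
    unfolding small_cat_def using T(2,3) T.cat_D T.Obj_D small_catD(3)[OF small_E] B(1) small_lepoll by auto
  have a: "is_functor Z D (\<pi> True)" "fcomp E (\<pi> True) K = L"
    and b: "is_functor Z X (\<pi> False)" "fcomp E (\<pi> False) K = P"
    using T.proj[of True] T.proj[of False] T.proj_L[of True] T.proj_L[of False]
    by (auto simp: XX_def FF_def)
  have eq: "AMap v (AMap (\<pi> True) f) = AMap p (AMap (\<pi> False) f)" if "f \<in> Arr Z" for f
    using Gv(5)[OF T.arr_tup[OF that]] by simp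
  have faith: "f = g" if "f \<in> Hom Z x y" "g \<in> Hom Z x y" "AMap (\<pi> True) f = AMap (\<pi> True) g"
    "AMap (\<pi> False) f = AMap (\<pi> False) g" for x y f g
    by (rule T.faithful[OF that(1,2)]) (metis (full_types) that(3,4))
  have "\<exists>!h. fills Z K (Cone S \<alpha>) y \<tau> h"
    if y: "y \<in> Obj E" and \<alpha>: "\<alpha> \<in> Ix S" and \<tau>: "cone_at Z K (Cone S \<alpha>) y \<tau>" for y \<alpha> \<tau>
  proof -
    let ?c = "Cone S \<alpha>"
    note c = coneD[OF cone_E[OF \<alpha>]]
    let ?\<tau>D = "whisker_l (Shape ?c) (\<pi> True) \<tau>" and ?\<tau>X = "whisker_l (Shape ?c) (\<pi> False) \<tau>"
    have \<tau>D: "cone_at D L ?c y ?\<tau>D" using cone_over_map[OF c(2,3) T.fun_L a(1) y \<tau>] unfolding a(2) .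
    have \<tau>X: "cone_at X P ?c y ?\<tau>X" using cone_over_map[OF c(2,3) T.fun_L b(1) y \<tau>] unfolding b(2) .
    have \<tau>A: "\<tau> j \<in> Arr Z" if "j \<in> Obj (Shape ?c)" for j using \<tau> that by (simp add: cone_over_def Hom_def)
    have \<tau>Y: "whisker_l (Shape ?c) v ?\<tau>D = whisker_l (Shape ?c) p ?\<tau>X"
      using eq[OF \<tau>A] by (auto simp: whisker_l_def)
    obtain h1 where h1: "fills D L ?c y ?\<tau>D h1" and h1u: "\<And>h. fills D L ?c y ?\<tau>D h \<Longrightarrow> h = h1"
      using modelD(4)[OF m y \<alpha> \<tau>D] by blast
    have k: "fills Y Q ?c y (whisker_l (Shape ?c) p ?\<tau>X) (AMap v h1)"
      using fills_map[OF cone_E[OF \<alpha>] m'(3) v(1) y h1] unfolding v(2) \<tau>Y .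
    obtain h2 where h2: "fills X P ?c y ?\<tau>X h2" "AMap p h2 = AMap v h1"
      and h2u: "\<And>h. fills X P ?c y ?\<tau>X h \<Longrightarrow> AMap p h = AMap v h1 \<Longrightarrow> h = h2"
      using Rclass_relative[OF R y \<alpha> \<tau>X k] by blast
    \<comment> \<open>\<open>p h2 = v h1\<close> is the compatibility that makes the pair of fillers
      an arrow of \<open>Z\<close>.\<close>
    have "(y, \<lambda>i. if i then h1 else h2, Vertex ?c) \<in> G"
      by (rule GI) (use y c(1) h1 h2 in \<open>simp_all add: fills_def\<close>)
    from T.tup_arr[OF this] obtain h where h: "h \<in> Hom Z y (Vertex ?c)"
      "AMap (\<pi> True) h = h1" "AMap (\<pi> False) h = h2" by auto
    have hH: "h \<in> Hom Z (OMap K y) (OMap K (Vertex ?c))" using h(1) y c(1) by (simp add: T.OMap_L)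
    show ?thesis
    proof (rule ex1I[of _ h])
      have "Comp Z (AMap K (Leg ?c j)) h = \<tau> j" if j: "j \<in> Obj (Shape ?c)" for j
      proof (rule faith)
        note KL = fun_Hom[OF T.fun_L c(5)[OF j]]
        show "Comp Z (AMap K (Leg ?c j)) h \<in> Hom Z (OMap K y) (OMap K (OMap (Diagram ?c) j))"
          by (rule Comp_Hom[OF T.cat_D hH KL])
        show "\<tau> j \<in> Hom Z (OMap K y) (OMap K (OMap (Diagram ?c) j))"
          using \<tau> j by (simp add: cone_over_def)
        show "AMap (\<pi> True) (Comp Z (AMap K (Leg ?c j)) h) = AMap (\<pi> True) (\<tau> j)"
          using fun_Comp[OF a(1) hH KL] h(2) h1 j arg_cong[OF a(2), of "\<lambda>F. AMap F (Leg ?c j)"] c(6)[OF j]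
          by (simp add: fills_def whisker_l_def)
        show "AMap (\<pi> False) (Comp Z (AMap K (Leg ?c j)) h) = AMap (\<pi> False) (\<tau> j)"
          using fun_Comp[OF b(1) hH KL] h(3) h2 j arg_cong[OF b(2), of "\<lambda>F. AMap F (Leg ?c j)"] c(6)[OF j]
          by (simp add: fills_def whisker_l_def)
      qed
      then show "fills Z K ?c y \<tau> h" using hH by (simp add: fills_def)
    next
      fix h' assume h': "fills Z K ?c y \<tau> h'"
      then have h'H: "h' \<in> Hom Z (OMap K y) (OMap K (Vertex ?c))" by (simp add: fills_def)
      have 1: "AMap (\<pi> True) h' = h1"
        using h1u fills_map[OF cone_E[OF \<alpha>] T.fun_L a(1) y h'] unfolding a(2) by blast
      have "AMap (\<pi> False) h' = h2"
        using h2u fills_map[OF cone_E[OF \<alpha>] T.fun_L b(1) y h'] eq[OF HomD(1)[OF h'H]] 1 unfolding b(2) by simp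
      then show "h' = h" using faith[OF h'H hH] 1 h by simp
    qed
  qed
  then have "model small S Z K" unfolding model_def using Zs T.fun_L by blast
  then show ?thesis using that a b eq by blast
qed

end

section \<open>Images of cones, and limit cones\<close>

lemma cone_in_map:
  assumes cat_E: "category E" and c: "cone_in ismall E c" and X: "category X" "is_functor E X P"
  shows "cone_in ismall X (map_cone P c)"
proof -
  note c' = coneD[OF c]
  have n: "is_nat (Shape c) E (const_fctr (Shape c) E (Vertex c)) (Diagram c) (Leg c)"
    using c by (simp add: cone_in_def)
  \<comment> \<open>A cone in \<open>E\<close> is a cone over the identity functor at its own
    vertex, so \<open>cone_over_map\<close> can transport it along \<open>P\<close>.\<close>
  have "cone_at E (id_fctr E) c (Vertex c) (Leg c)"
    using n is_nat_cone_over[OF c'(2) cat_E cat_E c'(3) id_functor[OF cat_E] c'(1)]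
    by (simp add: c'(1) fcomp_id_left[OF c'(3)])
  from cone_over_map[OF c'(2,3) id_functor[OF cat_E] X(2) c'(1) this]
  have "cone_at X P c (Vertex c) (whisker_l (Shape c) P (Leg c))"
    by (simp add: fcomp_id_right[OF X(2)])
  then have "is_nat (Shape c) X (const_fctr (Shape c) X (OMap P (Vertex c))) (fcomp (Shape c) P (Diagram c))
      (whisker_l (Shape c) P (Leg c))"
    using is_nat_cone_over[OF c'(2) cat_E X(1) c'(3) X(2) c'(1)] by blast
  then show ?thesis
    using c fun_Obj[OF X(2) c'(1)] fcomp_functor[OF c'(2,3) X(2)]
    by (simp add: cone_in_def map_cone_def)
qed

lemma map_cone_comp:
  assumes c: "cone_in ismall E c" and P: "is_functor E X P"
  shows "map_cone H (map_cone P c) = map_cone (fcomp E H P) c"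
  using coneD(1,6)[OF c] fcomp_assoc[OF coneD(3)[OF c], of H P]
  by (auto simp: map_cone_def whisker_l_def)

lemma map_cone_id:
  assumes c: "cone_in ismall E c" shows "map_cone (id_fctr E) c = c"
proof -
  have "whisker_l (Shape c) (id_fctr E) (Leg c) = Leg c"
    using coneD(6,7)[OF c] by (auto simp: whisker_l_def fun_eq_iff restrict_def extensional_def)
  then show ?thesis using coneD(1)[OF c] fcomp_id_left[OF coneD(3)[OF c]] by (simp add: map_cone_def)
qed

text \<open>The composites of the legs with \<open>a\<close> form a cone, and \<open>a\<close> and
  \<open>b\<close> are both factorizations of it.\<close>

lemma limit_cone_mono:
  assumes X: "category X" and c: "cone_in ismall X c" and lim: "limit_cone X c"
    and ab: "a \<in> Hom X z (Vertex c)" "b \<in> Hom X z (Vertex c)"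
    and eq: "\<And>j. j \<in> Obj (Shape c) \<Longrightarrow> Comp X (Leg c j) a = Comp X (Leg c j) b"
  shows "a = b"
proof -
  note c' = coneD[OF c]
  let ?\<tau> = "\<lambda>j\<in>Obj (Shape c). Comp X (Leg c j) a"
  have z: "z \<in> Obj X" using Hom_Obj(1)[OF X ab(1)] .
  have n: "Comp X (AMap (Diagram c) u) (Leg c (Dom (Shape c) u)) = Leg c (Cod (Shape c) u)"
    if "u \<in> Arr (Shape c)" for u
    using c that is_nat_const[OF c'(2) X c'(3,1)] by (simp add: cone_in_def)
  have "is_nat (Shape c) X (const_fctr (Shape c) X z) (Diagram c) ?\<tau>"
    unfolding is_nat_const[OF c'(2) X c'(3) z]
  proof (intro conjI ballI)
    show "?\<tau> i \<in> Hom X z (OMap (Diagram c) i)" if "i \<in> Obj (Shape c)" for i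
      using Comp_Hom[OF X ab(1) c'(5)[OF that]] that by simp
    show "Comp X (AMap (Diagram c) u) (?\<tau> (Dom (Shape c) u)) = ?\<tau> (Cod (Shape c) u)"
      if u: "u \<in> Arr (Shape c)" for u
      using arr_Obj[OF c'(2) u] n[OF u]
        Comp_assoc[OF X ab(1) c'(5)[OF arr_Obj(1)[OF c'(2) u]] fun_Hom[OF c'(3) arr_Hom[OF u]]] by simp
  qed simp
  then have "\<exists>!h. h \<in> Hom X z (Vertex c) \<and> (\<forall>i\<in>Obj (Shape c). Comp X (Leg c i) h = ?\<tau> i)"
    using lim z unfolding limit_cone_def by blast
  moreover have "\<forall>i\<in>Obj (Shape c). Comp X (Leg c i) a = ?\<tau> i" "\<forall>i\<in>Obj (Shape c). Comp X (Leg c i) b = ?\<tau> i"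
    using eq by simp_all
  ultimately show ?thesis using ab by blast
qed

section \<open>The universal realization\<close>

context sketch_ctx
begin

lemma initial_Lclass:
  assumes m: "model small S D L" and g: "generated S D L"
    and D: "Obj D = Obj E" "\<And>x. x \<in> Obj E \<Longrightarrow> OMap L x = x"
    and univ: "\<And>X P. model small S X P \<Longrightarrow> \<exists>H. is_functor D X H \<and> fcomp E H L = P"
  shows "((E, id_fctr E), (D, L), L) \<in> Lclass small S"
proof -
  note m' = modelD[OF m]
  have surj: "Obj D \<subseteq> OMap L ` Obj E" using D by force
  have lA: "((E, id_fctr E), (D, L), L) \<in> Arr (coslice small E)"
    unfolding coslice_Arr using small_E id_functor[OF cat_E] m' fcomp_id_right[OF m'(3)] by blast
  have "orthogonal (coslice small E) ((E, id_fctr E), (D, L), L) ((X, P), (Y, Q), p)"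
    if R: "((X, P), (Y, Q), p) \<in> Rclass small S" for X P Y Q p
  proof -
    have X: "category X" "is_functor E X P" and p: "is_functor X Y p" "fcomp E p P = Q"
      using Rclass_Arr[OF R] small_catD(1) by (auto simp: coslice_Arr)
    show ?thesis
      unfolding coslice_orthogonal[OF lA Rclass_Arr[OF R]]
    proof (intro allI impI)
      fix u v assume u: "is_functor E X u" "fcomp E u (id_fctr E) = P"
        and v: "is_functor D Y v" "fcomp E v L = Q"
      have uP: "u = P" using fcomp_id_right[OF u(1)] u(2) by simp
      obtain Z K a b where Z: "model small S Z K" and a: "is_functor Z D a" "fcomp E a K = L"
        and b: "is_functor Z X b" "fcomp E b K = P"
        and ab: "\<And>f. f \<in> Arr Z \<Longrightarrow> AMap v (AMap a f) = AMap p (AMap b f)"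
        using pullback_model[OF R m D v] by metis
      obtain H where H: "is_functor D Z H" "fcomp E H L = K" using univ[OF Z] by blast
      define d where "d = fcomp D b H"
      have d: "is_functor D X d" unfolding d_def by (rule fcomp_functor[OF m'(2) H(1) b(1)])
      have dL: "fcomp E d L = P" unfolding d_def fcomp_assoc[OF m'(3), symmetric] H(2) by (rule b(2))
      \<comment> \<open>\<open>a H\<close> is an endofunctor of the initial model under
        \<open>E\<close>, hence the identity; this makes \<open>H\<close> a section of
        \<open>a\<close>.\<close>
      have aid: "fcomp D a H = id_fctr D"
        by (rule generated_functor_eq_model[OF g m'(3) surj fcomp_functor[OF m'(2) H(1) a(1)] id_functor[OF m'(2)] _ _ m])
          (simp_all add: fcomp_assoc[OF m'(3), symmetric] H(2) a(2) fcomp_id_left[OF m'(3)])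
      have aH: "AMap a (AMap H f) = f" if "f \<in> Arr D" for f
        using that arg_cong[OF aid, of "\<lambda>F. AMap F f"] by simp
      have pd: "fcomp D p d = v"
      proof (rule fctr_eqI[OF fcomp_functor[OF m'(2) d p(1)] v(1)])
        show "OMap (fcomp D p d) x = OMap v x" if x: "x \<in> Obj D" for x
        proof -
          obtain z where z: "z \<in> Obj E" "x = OMap L z" using surj x by blast
          have "OMap d x = OMap P z" using z arg_cong[OF dL, of "\<lambda>F. OMap F z"] by simp
          moreover have "OMap v x = OMap p (OMap P z)"
            using z arg_cong[OF v(2), of "\<lambda>F. OMap F z"] arg_cong[OF p(2), of "\<lambda>F. OMap F z"] by simp
          ultimately show ?thesis using x by simp
        qed
        show "AMap (fcomp D p d) f = AMap v f" if "f \<in> Arr D" for f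
          using ab[OF fun_arr(1)[OF H(1) that]] aH[OF that] that by (simp add: d_def)
      qed
      show "\<exists>!d. is_functor D X d \<and> fcomp E d L = P \<and> fcomp E d L = u \<and> fcomp D p d = v"
      proof (rule ex1I[of _ d])
        show "is_functor D X d \<and> fcomp E d L = P \<and> fcomp E d L = u \<and> fcomp D p d = v"
          using d dL pd uP by simp
        fix d' assume d': "is_functor D X d' \<and> fcomp E d' L = P \<and> fcomp E d' L = u \<and> fcomp D p d' = v"
        show "d' = d"
        \<comment> \<open>\<open>X\<close> need not be a model. Two diagonals have the same
          composite to \<open>Y\<close>, so uniqueness of fillers over a given arrow of
          \<open>Y\<close> is enough.\<close>
        proof (rule generated_functor_eq[OF g m'(3) surj _ d])
          show "is_functor D X d'" "fcomp E d' L = fcomp E d L" using d' dL by auto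
          fix y \<alpha> \<tau> f assume y: "y \<in> Obj E" and \<alpha>: "\<alpha> \<in> Ix S" and f: "f \<in> Arr D"
            and \<tau>: "cone_at X (fcomp E d' L) (Cone S \<alpha>) y \<tau>"
            and fi: "fills X (fcomp E d' L) (Cone S \<alpha>) y \<tau> (AMap d' f)"
              "fills X (fcomp E d' L) (Cone S \<alpha>) y \<tau> (AMap d f)"
          have e: "fcomp E d' L = P" using d' by blast
          have "AMap p (AMap d' f) = AMap v f" "AMap p (AMap d f) = AMap v f"
            using f d' pd fcomp_AMap[OF f, of p] by metis+
          moreover have "fills Y Q (Cone S \<alpha>) y (whisker_l (Shape (Cone S \<alpha>)) p \<tau>) (AMap p (AMap d f))"
            using fills_map[OF cone_E[OF \<alpha>] X(2) p(1) y fi(2)[unfolded e]] unfolding p(2) .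
          ultimately show "AMap d' f = AMap d f"
            using Rclass_relative[OF R y \<alpha> \<tau>[unfolded e], of "AMap p (AMap d f)"] fi unfolding e by metis
        qed
      qed
    qed
  qed
  then show ?thesis using lA unfolding Lclass_def left_orth_def by fastforce
qed

text \<open>The constructed initial model supplies a factorization, so the choice operator selects
  one. Of the selected one only the classes of its two arrows are known, and all later facts on
  \<open>Fib\<close> start from these.\<close>

lemma bang_factorization:
  obtains D L t where "factorization (coslice small E) (Lclass small S) (Rclass small S) (bang E)
      (((E, id_fctr E), (D, L), L), ((D, L), (terminal_cat, const_fctr E terminal_cat undefined), t))"
    "Fib small S = D" "Lbang small S = L"
proof -
  let ?fac = "factorization (coslice small E) (Lclass small S) (Rclass small S) (bang E)"
  obtain D0 L0 where D0: "model small S D0 L0" "generated S D0 L0" "Obj D0 = Obj E"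
     "\<And>x. x \<in> Obj E \<Longrightarrow> OMap L0 x = x"
     "\<And>X P. model small S X P \<Longrightarrow> (\<exists>H. is_functor D0 X H \<and> fcomp E H L0 = P)"
    using initial_model_exists by blast
  note m = modelD[OF D0(1)]
  have "?fac (((E, id_fctr E), (D0, L0), L0), ((D0, L0),
      (terminal_cat, const_fctr E terminal_cat undefined), const_fctr D0 terminal_cat undefined))"
    using initial_Lclass[OF D0] model_Rclass[OF D0(1)]
      terminal_functor[OF fcomp_functor[OF cat_E m(3) const_terminal[OF m(2)]]]
    by (simp add: factorization_def bang_def Let_def)
  then have fac: "?fac (bang_factorization small S)"
    unfolding bang_factorization_def by (rule someI)
  obtain A B H B' C t where lr: "bang_factorization small S = ((A, B, H), (B', C, t))"
    by (cases "bang_factorization small S") auto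
  obtain D L where B: "B = (D, L)" by (cases B)
  obtain E' I where A: "A = (E', I)" by (cases A)
  have f: "(A, B, H) \<in> Lclass small S" "(B', C, t) \<in> Rclass small S" "B = B'"
    "Comp (coslice small E) (B', C, t) (A, B, H) = bang E"
    using fac unfolding lr factorization_def by auto
  \<comment> \<open>The composite is \<open>bang E\<close>, which fixes the outer objects. The left
    arrow then starts at the identity of \<open>E\<close> and must equal the structure functor of
    its target.\<close>
  then have AC: "A = (E, id_fctr E)" "C = (terminal_cat, const_fctr E terminal_cat undefined)"
    by (auto simp: A bang_def Let_def)
  have "(A, B, H) \<in> Arr (coslice small E)" using f(1) by (simp add: Lclass_def left_orth_def)
  then have "is_functor E D H" "fcomp E H (id_fctr E) = L" unfolding AC B coslice_Arr by auto
  then have HL: "H = L" using fcomp_id_right[of E D H] by simp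
  show ?thesis
    by (rule that[of D L t]) (use fac lr AC B HL f(3) in \<open>auto simp: Fib_def Lbang_def\<close>)
qed

abbreviation "Ef \<equiv> Fib small S"
abbreviation "Lf \<equiv> Lbang small S"

lemma Fib_model: "model small S Ef Lf"
  and Fib_Lclass: "((E, id_fctr E), (Ef, Lf), Lf) \<in> Lclass small S"
  by (rule bang_factorization, auto simp: factorization_def dest!: Rclass_model)+

lemmas small_Ef = modelD(1)[OF Fib_model]
lemmas cat_Ef = modelD(2)[OF Fib_model]
lemmas fun_Lf = modelD(3)[OF Fib_model]

text \<open>A model gives an arrow of the right class to the terminal object. The square with top
  \<open>P\<close> commutes automatically, and its diagonal is the required functor.\<close>

lemma Fib_universal:
  assumes m: "model small S X P"
  shows "\<exists>!H. is_functor Ef X H \<and> fcomp E H Lf = P"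
proof -
  let ?T = "terminal_cat :: 'u scat"
  note m' = modelD[OF m]
  have lA: "((E, id_fctr E), (Ef, Lf), Lf) \<in> Arr (coslice small E)"
    using Fib_Lclass by (simp add: Lclass_def left_orth_def)
  note R = model_Rclass[OF m]
  have "orthogonal (coslice small E) ((E, id_fctr E), (Ef, Lf), Lf)
      ((X, P), (?T, const_fctr E ?T undefined), const_fctr X ?T undefined)"
    using Fib_Lclass R by (simp add: Lclass_def left_orth_def)
  note o = this[unfolded coslice_orthogonal[OF lA Rclass_Arr[OF R]], rule_format]
  have t: "fcomp E (const_fctr Ef ?T undefined) Lf = const_fctr E ?T undefined"
    "fcomp E (const_fctr X ?T undefined) P = const_fctr E ?T undefined"
    "\<And>H. is_functor Ef X H \<Longrightarrow>
       fcomp Ef (const_fctr X ?T undefined) H = const_fctr Ef ?T undefined"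
    using terminal_functor[OF fcomp_functor[OF cat_E fun_Lf const_terminal[OF cat_Ef]]]
      terminal_functor[OF fcomp_functor[OF cat_E m'(3) const_terminal[OF m'(2)]]]
      terminal_functor[OF fcomp_functor[OF cat_Ef _ const_terminal[OF m'(2)]]] by auto
  have "\<exists>!d. is_functor Ef X d \<and> fcomp E d Lf = P \<and> fcomp E d Lf = P \<and>
      fcomp Ef (const_fctr X ?T undefined) d = const_fctr Ef ?T undefined"
    by (rule o[OF m'(3) fcomp_id_right[OF m'(3)] const_terminal[OF cat_Ef] t(1)]) (simp add: t)
  then show ?thesis using t(3) by metis
qed

lemma Fib_functor_eq:
  assumes "model small S X P" "is_functor Ef X H" "is_functor Ef X H'"
    "fcomp E H Lf = P" "fcomp E H' Lf = P"
  shows "H = H'"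
  using Fib_universal[OF assms(1)] assms(2-5) by blast

text \<open>\<open>Fib\<close> is compared with the constructed model \<open>D\<close>:
  \<open>e d\<close> is an endofunctor of \<open>Fib\<close> under \<open>E\<close>, hence the
  identity. This gives surjectivity on objects; injectivity holds because \<open>d\<close> followed
  from \<open>Lf\<close> is the identity on objects of \<open>E\<close>; generation follows by
  pulling predicates back along \<open>e\<close>.\<close>

lemma Fib_objects: "bij_betw (OMap Lf) (Obj E) (Obj Ef)"
  and Fib_generated: "generated S Ef Lf"
proof -
  obtain D L where D: "model small S D L" "generated S D L" "Obj D = Obj E"
     "\<And>x. x \<in> Obj E \<Longrightarrow> OMap L x = x"
     "\<And>X P. model small S X P \<Longrightarrow> (\<exists>H. is_functor D X H \<and> fcomp E H L = P)"
    using initial_model_exists by blast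
  note m = modelD[OF D(1)]
  obtain d where d: "is_functor Ef D d" "fcomp E d Lf = L" using Fib_universal[OF D(1)] by blast
  obtain e where e: "is_functor D Ef e" "fcomp E e L = Lf" using D(5)[OF Fib_model] by blast
  have ed: "fcomp Ef e d = id_fctr Ef"
    by (rule Fib_functor_eq[OF Fib_model fcomp_functor[OF cat_Ef d(1) e(1)] id_functor[OF cat_Ef]])
      (simp_all add: fcomp_assoc[OF fun_Lf, symmetric] d(2) e(2) fcomp_id_left[OF fun_Lf])
  have dL: "OMap d (OMap Lf x) = x" if "x \<in> Obj E" for x
    using arg_cong[OF d(2), of "\<lambda>F. OMap F x"] D(4) that by simp
  have eL: "OMap e x = OMap Lf x" if "x \<in> Obj E" for x
    using arg_cong[OF e(2), of "\<lambda>F. OMap F x"] D(4)[OF that] that by simp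
  have "z \<in> OMap Lf ` Obj E" if z: "z \<in> Obj Ef" for z
  proof -
    have "OMap d z \<in> Obj E" using fun_Obj[OF d(1) z] D(3) by simp
    moreover have "OMap e (OMap d z) = z" using arg_cong[OF ed, of "\<lambda>F. OMap F z"] z by simp
    ultimately show ?thesis using eL by force
  qed
  then show "bij_betw (OMap Lf) (Obj E) (Obj Ef)"
    unfolding bij_betw_def using dL fun_Obj[OF fun_Lf] by (auto intro!: inj_onI) metis
  show "generated S Ef Lf"
    unfolding generated_def
  proof (intro allI impI ballI)
    fix W f assume W: "\<forall>f\<in>Arr E. W (AMap Lf f)"
      "\<forall>x y z f g. f \<in> Hom Ef x y \<longrightarrow> g \<in> Hom Ef y z \<longrightarrow> W f \<longrightarrow> W g \<longrightarrow> W (Comp Ef g f)"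
      "\<forall>y\<in>Obj E. \<forall>\<alpha>\<in>Ix S. \<forall>\<tau> h. cone_at Ef Lf (Cone S \<alpha>) y \<tau> \<longrightarrow>
        (\<forall>j\<in>Obj (Shape (Cone S \<alpha>)). W (\<tau> j)) \<longrightarrow> fills Ef Lf (Cone S \<alpha>) y \<tau> h \<longrightarrow> W h"
      and f: "f \<in> Arr Ef"
    have "W (AMap e g)" if g: "g \<in> Arr D" for g
    proof (rule generatedD[OF D(2) _ _ _ g, where W = "\<lambda>g. W (AMap e g)"])
      show "W (AMap e (AMap L f))" if "f \<in> Arr E" for f
        using W(1) that arg_cong[OF e(2), of "\<lambda>F. AMap F f"] by simp
      show "W (AMap e (Comp D g f))"
        if "f \<in> Hom D x y" "g \<in> Hom D y z" "W (AMap e f)" "W (AMap e g)" for x y z f g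
        using W(2) fun_Hom[OF e(1) that(1)] fun_Hom[OF e(1) that(2)] fun_Comp[OF e(1) that(1,2)] that(3,4)
        by metis
      show "W (AMap e h)"
        if y: "y \<in> Obj E" and \<alpha>: "\<alpha> \<in> Ix S" and \<tau>: "cone_at D L (Cone S \<alpha>) y \<tau>"
          and w: "\<And>j. j \<in> Obj (Shape (Cone S \<alpha>)) \<Longrightarrow> W (AMap e (\<tau> j))"
          and h: "fills D L (Cone S \<alpha>) y \<tau> h" for y \<alpha> \<tau> h
      proof -
        note c = coneD[OF cone_E[OF \<alpha>]]
        have "cone_at Ef Lf (Cone S \<alpha>) y (whisker_l (Shape (Cone S \<alpha>)) e \<tau>)"
          using cone_over_map[OF c(2,3) m(3) e(1) y \<tau>] unfolding e(2) .
        moreover have "fills Ef Lf (Cone S \<alpha>) y (whisker_l (Shape (Cone S \<alpha>)) e \<tau>) (AMap e h)"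
          using fills_map[OF cone_E[OF \<alpha>] m(3) e(1) y h] unfolding e(2) .
        moreover have "\<forall>j\<in>Obj (Shape (Cone S \<alpha>)). W (whisker_l (Shape (Cone S \<alpha>)) e \<tau> j)"
          using w by (simp add: whisker_l_def)
        ultimately show ?thesis using W(3) y \<alpha> by blast
      qed
    qed
    then have "W (AMap e (AMap d f))" using fun_arr(1)[OF d(1) f] by blast
    then show "W f" using arg_cong[OF ed, of "\<lambda>F. AMap F f"] f by simp
  qed
qed

lemma Fib_obj: assumes "x \<in> Obj Ef" obtains y where "y \<in> Obj E" "x = OMap Lf y"
  using Fib_objects assms unfolding bij_betw_def by blast

lemma limit_cone_iff_fills:
  assumes \<alpha>: "\<alpha> \<in> Ix S" and X: "category X" "is_functor E X P"
    and y: "y \<in> Obj E"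
  shows "is_nat (Shape (map_cone P (Cone S \<alpha>))) X (const_fctr (Shape (map_cone P (Cone S \<alpha>))) X (OMap P y))
      (Diagram (map_cone P (Cone S \<alpha>))) \<tau> \<longleftrightarrow> cone_at X P (Cone S \<alpha>) y \<tau>"
    "(h \<in> Hom X (OMap P y) (Vertex (map_cone P (Cone S \<alpha>))) \<and>
       (\<forall>i\<in>Obj (Shape (map_cone P (Cone S \<alpha>))). Comp X (Leg (map_cone P (Cone S \<alpha>)) i) h = \<tau> i)) \<longleftrightarrow>
     fills X P (Cone S \<alpha>) y \<tau> h"
  using is_nat_cone_over[OF coneD(2)[OF cone_E[OF \<alpha>]] cat_E X(1) coneD(3)[OF cone_E[OF \<alpha>]] X(2) y]
  by (auto simp: map_cone_def fills_def whisker_l_def)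

lemma limit_cones_model:
  assumes X: "small_cat small X" "is_functor E X P"
    and lim: "\<And>\<alpha>. \<alpha> \<in> Ix S \<Longrightarrow> limit_cone X (map_cone P (Cone S \<alpha>))"
  shows "model small S X P"
  unfolding model_def
proof (intro conjI ballI allI impI X)
  fix y \<alpha> \<tau> assume y: "y \<in> Obj E" and \<alpha>: "\<alpha> \<in> Ix S" and \<tau>: "cone_at X P (Cone S \<alpha>) y \<tau>"
  note iff = limit_cone_iff_fills[OF \<alpha> small_catD(1)[OF X(1)] X(2) y]
  show "\<exists>!h. fills X P (Cone S \<alpha>) y \<tau> h"
    using lim[OF \<alpha>] fun_Obj[OF X(2) y] \<tau> unfolding limit_cone_def iff(1)[symmetric] iff(2)[symmetric] by blast
qed

text \<open>A limit cone is tested at all objects, a model only at images of objects of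
  \<open>E\<close>. In \<open>Fib\<close> every object is such an image, so the two tests
  agree.\<close>

lemma Fib_limit_cone:
  assumes \<alpha>: "\<alpha> \<in> Ix S" shows "limit_cone Ef (map_cone Lf (Cone S \<alpha>))"
  unfolding limit_cone_def
proof (intro ballI allI impI)
  fix x \<tau> assume x: "x \<in> Obj Ef"
    and \<tau>: "is_nat (Shape (map_cone Lf (Cone S \<alpha>))) Ef (const_fctr (Shape (map_cone Lf (Cone S \<alpha>))) Ef x)
      (Diagram (map_cone Lf (Cone S \<alpha>))) \<tau>"
  obtain y where y: "y \<in> Obj E" "x = OMap Lf y" using Fib_obj[OF x] .
  note iff = limit_cone_iff_fills[OF \<alpha> cat_Ef fun_Lf y(1)]
  show "\<exists>!h. h \<in> Hom Ef x (Vertex (map_cone Lf (Cone S \<alpha>))) \<and>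
       (\<forall>i\<in>Obj (Shape (map_cone Lf (Cone S \<alpha>))). Comp Ef (Leg (map_cone Lf (Cone S \<alpha>)) i) h = \<tau> i)"
    unfolding y(2) iff(2) using modelD(4)[OF Fib_model y(1) \<alpha>] \<tau>[unfolded y(2) iff(1)] .
qed

text \<open>
  The arrows of \<open>Fib\<close> at which a family is natural are closed under composition and under the
  arrows induced by the limit cones of the target.
\<close>

lemma Fib_natural:
  assumes X: "category X"
    and lim: "\<And>\<alpha>. \<alpha> \<in> Ix S \<Longrightarrow> limit_cone X (map_cone (fcomp E K Lf) (Cone S \<alpha>))"
    and H: "is_functor Ef X H" and K: "is_functor Ef X K"
    and \<theta>: "\<And>x. x \<in> Obj Ef \<Longrightarrow> \<theta> x \<in> Hom X (OMap H x) (OMap K x)"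
    and nat: "\<And>f. f \<in> Arr E \<Longrightarrow> Comp X (\<theta> (OMap Lf (Cod E f))) (AMap H (AMap Lf f)) =
        Comp X (AMap K (AMap Lf f)) (\<theta> (OMap Lf (Dom E f)))"
    and f: "f \<in> Arr Ef"
  shows "Comp X (\<theta> (Cod Ef f)) (AMap H f) = Comp X (AMap K f) (\<theta> (Dom Ef f))"
proof (rule generatedD[OF Fib_generated _ _ _ f,
      where W = "\<lambda>f. Comp X (\<theta> (Cod Ef f)) (AMap H f) = Comp X (AMap K f) (\<theta> (Dom Ef f))"])
  show "Comp X (\<theta> (Cod Ef (AMap Lf f))) (AMap H (AMap Lf f)) =
      Comp X (AMap K (AMap Lf f)) (\<theta> (Dom Ef (AMap Lf f)))" if "f \<in> Arr E" for f
    using nat[OF that] fun_arr[OF fun_Lf that] by simp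
  show "Comp X (\<theta> (Cod Ef (Comp Ef g f))) (AMap H (Comp Ef g f)) =
      Comp X (AMap K (Comp Ef g f)) (\<theta> (Dom Ef (Comp Ef g f)))"
    if f: "f \<in> Hom Ef x y" and g: "g \<in> Hom Ef y z"
      and nf: "Comp X (\<theta> (Cod Ef f)) (AMap H f) = Comp X (AMap K f) (\<theta> (Dom Ef f))"
      and ng: "Comp X (\<theta> (Cod Ef g)) (AMap H g) = Comp X (AMap K g) (\<theta> (Dom Ef g))" for x y z f g
  proof -
    note o = Hom_Obj[OF cat_Ef f] Hom_Obj[OF cat_Ef g]
    note Hf = fun_Hom[OF H f] and Hg = fun_Hom[OF H g] and Kf = fun_Hom[OF K f] and Kg = fun_Hom[OF K g]
    have "Comp X (\<theta> z) (Comp X (AMap H g) (AMap H f)) = Comp X (Comp X (\<theta> z) (AMap H g)) (AMap H f)"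
      by (rule Comp_assoc[OF X Hf Hg \<theta>[OF o(4)]])
    also have "\<dots> = Comp X (Comp X (AMap K g) (\<theta> y)) (AMap H f)"
      using ng HomD[OF g] by simp
    also have "\<dots> = Comp X (AMap K g) (Comp X (\<theta> y) (AMap H f))"
      by (rule Comp_assoc[OF X Hf \<theta>[OF o(2)] Kg, symmetric])
    also have "\<dots> = Comp X (AMap K g) (Comp X (AMap K f) (\<theta> x))" using nf HomD[OF f] by simp
    also have "\<dots> = Comp X (Comp X (AMap K g) (AMap K f)) (\<theta> x)"
      by (rule Comp_assoc[OF X \<theta>[OF o(1)] Kf Kg])
    finally show ?thesis
      using HomD[OF Comp_Hom[OF cat_Ef f g]] fun_Comp[OF H f g] fun_Comp[OF K f g] by simp
  qed
  show "Comp X (\<theta> (Cod Ef h)) (AMap H h) = Comp X (AMap K h) (\<theta> (Dom Ef h))"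
    if y: "y \<in> Obj E" and \<alpha>: "\<alpha> \<in> Ix S" and \<tau>: "cone_at Ef Lf (Cone S \<alpha>) y \<tau>"
      and n: "\<And>j. j \<in> Obj (Shape (Cone S \<alpha>)) \<Longrightarrow>
        Comp X (\<theta> (Cod Ef (\<tau> j))) (AMap H (\<tau> j)) = Comp X (AMap K (\<tau> j)) (\<theta> (Dom Ef (\<tau> j)))"
      and h: "fills Ef Lf (Cone S \<alpha>) y \<tau> h" for y \<alpha> \<tau> h
  proof -
    let ?c = "Cone S \<alpha>" and ?P = "fcomp E K Lf"
    let ?v = "OMap Lf (Vertex ?c)" and ?y = "OMap Lf y"
    note c = coneD[OF cone_E[OF \<alpha>]]
    have oy: "?y \<in> Obj Ef" and ov: "?v \<in> Obj Ef" using fun_Obj[OF fun_Lf] y c(1) by auto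
    have hH: "h \<in> Hom Ef ?y ?v" using h by (simp add: fills_def)
    note Hh = fun_Hom[OF H hH] and Kh = fun_Hom[OF K hH]
    \<comment> \<open>After composition with the leg at \<open>j\<close>, both sides of the
      naturality square at \<open>h\<close> become \<open>K (\<tau> j)\<close> following
      \<open>\<theta>\<close>: one by naturality at the leg and at \<open>\<tau> j\<close>, the
      other by functoriality. The legs are jointly monic, whence the square itself.\<close>
    have eq: "Comp X (AMap K (AMap Lf (Leg ?c j))) (Comp X (\<theta> ?v) (AMap H h)) = Comp X (AMap K (\<tau> j)) (\<theta> ?y)"
      "Comp X (AMap K (AMap Lf (Leg ?c j))) (Comp X (AMap K h) (\<theta> ?y)) = Comp X (AMap K (\<tau> j)) (\<theta> ?y)"
      if j: "j \<in> Obj (Shape ?c)" for j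
    proof -
      let ?d = "OMap Lf (OMap (Diagram ?c) j)"
      have od: "?d \<in> Obj Ef" using fun_Obj[OF fun_Lf] fun_Obj[OF c(3)] j by auto
      have l: "AMap Lf (Leg ?c j) \<in> Hom Ef ?v ?d" by (rule fun_Hom[OF fun_Lf c(5)[OF j]])
      note Hl = fun_Hom[OF H l] and Kl = fun_Hom[OF K l]
      have t: "\<tau> j \<in> Hom Ef ?y ?d" using \<tau> j by (simp add: cone_over_def)
      have lh: "Comp Ef (AMap Lf (Leg ?c j)) h = \<tau> j" using h j by (simp add: fills_def)
      have nl: "Comp X (\<theta> ?d) (AMap H (AMap Lf (Leg ?c j))) = Comp X (AMap K (AMap Lf (Leg ?c j))) (\<theta> ?v)"
        using nat[OF c(6)[OF j]] HomD[OF c(5)[OF j]] by simp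
      have "Comp X (AMap K (AMap Lf (Leg ?c j))) (Comp X (\<theta> ?v) (AMap H h)) =
          Comp X (Comp X (AMap K (AMap Lf (Leg ?c j))) (\<theta> ?v)) (AMap H h)"
        by (rule Comp_assoc[OF X Hh \<theta>[OF ov] Kl])
      also have "\<dots> = Comp X (\<theta> ?d) (Comp X (AMap H (AMap Lf (Leg ?c j))) (AMap H h))"
        unfolding nl[symmetric] by (rule Comp_assoc[OF X Hh Hl \<theta>[OF od], symmetric])
      also have "\<dots> = Comp X (\<theta> ?d) (AMap H (\<tau> j))" using fun_Comp[OF H hH l] lh by simp
      also have "\<dots> = Comp X (AMap K (\<tau> j)) (\<theta> ?y)" using n[OF j] HomD[OF t] by simp
      finally show "Comp X (AMap K (AMap Lf (Leg ?c j))) (Comp X (\<theta> ?v) (AMap H h)) =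
        Comp X (AMap K (\<tau> j)) (\<theta> ?y)" .
      have "Comp X (AMap K (AMap Lf (Leg ?c j))) (Comp X (AMap K h) (\<theta> ?y)) =
          Comp X (Comp X (AMap K (AMap Lf (Leg ?c j))) (AMap K h)) (\<theta> ?y)"
        by (rule Comp_assoc[OF X \<theta>[OF oy] Kh Kl])
      then show "Comp X (AMap K (AMap Lf (Leg ?c j))) (Comp X (AMap K h) (\<theta> ?y)) =
        Comp X (AMap K (\<tau> j)) (\<theta> ?y)" using fun_Comp[OF K hH l] lh by simp
    qed
    have KL: "is_functor E X ?P" by (rule fcomp_functor[OF cat_E fun_Lf K])
    have "Comp X (\<theta> ?v) (AMap H h) = Comp X (AMap K h) (\<theta> ?y)"
    proof (rule limit_cone_mono[OF X cone_in_map[OF cat_E cone_E[OF \<alpha>] X KL] lim[OF \<alpha>]])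
      show "Comp X (\<theta> ?v) (AMap H h) \<in> Hom X (OMap H ?y) (Vertex (map_cone ?P ?c))"
        "Comp X (AMap K h) (\<theta> ?y) \<in> Hom X (OMap H ?y) (Vertex (map_cone ?P ?c))"
        using Comp_Hom[OF X Hh \<theta>[OF ov]] Comp_Hom[OF X \<theta>[OF oy] Kh] c(1) by (simp_all add: map_cone_def)
      show "Comp X (Leg (map_cone ?P ?c) j) (Comp X (\<theta> ?v) (AMap H h)) =
          Comp X (Leg (map_cone ?P ?c) j) (Comp X (AMap K h) (\<theta> ?y))"
        if "j \<in> Obj (Shape (map_cone ?P ?c))" for j
        using eq[of j] that c(6)[of j] by (simp add: map_cone_def whisker_l_def)
    qed
    then show ?thesis using HomD[OF hH] by simp
  qed
qed

end

section \<open>The 2-categories of sketches\<close>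

lemma is_nat_Hom: "is_nat C D F G \<tau> \<Longrightarrow> x \<in> Obj C \<Longrightarrow> \<tau> x \<in> Hom D (OMap F x) (OMap G x)"
  by (simp add: is_nat_def)

lemma is_nat_Comp:
  "is_nat C D F G \<tau> \<Longrightarrow> f \<in> Hom C x y \<Longrightarrow> Comp D (\<tau> y) (AMap F f) = Comp D (AMap G f) (\<tau> x)"
  by (auto simp: is_nat_def Hom_def)

lemma is_natI:
  assumes "\<tau> \<in> extensional (Obj C)"
    and "\<And>x. x \<in> Obj C \<Longrightarrow> \<tau> x \<in> Hom D (OMap F x) (OMap G x)"
    and "\<And>f x y. f \<in> Hom C x y \<Longrightarrow> Comp D (\<tau> y) (AMap F f) = Comp D (AMap G f) (\<tau> x)"
  shows "is_nat C D F G \<tau>"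
  unfolding is_nat_def using assms by (auto simp: Hom_def)

lemma id_nat_is_nat:
  assumes "category C" "category D" "is_functor C D F"
  shows "is_nat C D F F (id_nat C D F)"
proof (rule is_natI)
  show "id_nat C D F x \<in> Hom D (OMap F x) (OMap F x)" if "x \<in> Obj C" for x
    using Idt_Hom[OF assms(2) fun_Obj[OF assms(3) that]] that by (simp add: id_nat_def)
  show "Comp D (id_nat C D F y) (AMap F f) = Comp D (AMap F f) (id_nat C D F x)"
    if f: "f \<in> Hom C x y" for f x y
    using Comp_Idt[OF assms(2) fun_Hom[OF assms(3) f]] Idt_Comp[OF assms(2) fun_Hom[OF assms(3) f]]
      Hom_Obj[OF assms(1) f] by (simp add: id_nat_def)
qed (simp add: id_nat_def)

lemma vcomp_is_nat:
  assumes "category C" "category D" "is_functor C D F" "is_functor C D G" "is_functor C D K"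
    and s: "is_nat C D F G \<sigma>" and t: "is_nat C D G K \<tau>"
  shows "is_nat C D F K (vcomp_nat C D \<tau> \<sigma>)"
proof (rule is_natI)
  show "vcomp_nat C D \<tau> \<sigma> x \<in> Hom D (OMap F x) (OMap K x)" if "x \<in> Obj C" for x
    using Comp_Hom[OF assms(2) is_nat_Hom[OF s that] is_nat_Hom[OF t that]] that
    by (simp add: vcomp_nat_def)
  show "Comp D (vcomp_nat C D \<tau> \<sigma> y) (AMap F f) = Comp D (AMap K f) (vcomp_nat C D \<tau> \<sigma> x)"
    if f: "f \<in> Hom C x y" for f x y
  proof -
    note o = Hom_Obj[OF assms(1) f]
    have "Comp D (Comp D (\<tau> y) (\<sigma> y)) (AMap F f) = Comp D (\<tau> y) (Comp D (\<sigma> y) (AMap F f))"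
      by (rule Comp_assoc[OF assms(2) fun_Hom[OF assms(3) f] is_nat_Hom[OF s o(2)] is_nat_Hom[OF t o(2)], symmetric])
    also have "\<dots> = Comp D (\<tau> y) (Comp D (AMap G f) (\<sigma> x))" using is_nat_Comp[OF s f] by simp
    also have "\<dots> = Comp D (Comp D (\<tau> y) (AMap G f)) (\<sigma> x)"
      by (rule Comp_assoc[OF assms(2) is_nat_Hom[OF s o(1)] fun_Hom[OF assms(4) f] is_nat_Hom[OF t o(2)]])
    also have "\<dots> = Comp D (Comp D (AMap K f) (\<tau> x)) (\<sigma> x)" using is_nat_Comp[OF t f] by simp
    also have "\<dots> = Comp D (AMap K f) (Comp D (\<tau> x) (\<sigma> x))"
      by (rule Comp_assoc[OF assms(2) is_nat_Hom[OF s o(1)] is_nat_Hom[OF t o(1)] fun_Hom[OF assms(5) f], symmetric])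
    finally show ?thesis using o by (simp add: vcomp_nat_def)
  qed
qed (simp add: vcomp_nat_def)

lemma whisker_r_is_nat:
  assumes "category C" "is_functor C D F" "is_nat D X G K \<tau>"
  shows "is_nat C X (fcomp C G F) (fcomp C K F) (whisker_r C F \<tau>)"
proof (rule is_natI)
  show "whisker_r C F \<tau> x \<in> Hom X (OMap (fcomp C G F) x) (OMap (fcomp C K F) x)" if "x \<in> Obj C" for x
    using is_nat_Hom[OF assms(3) fun_Obj[OF assms(2) that]] that by (simp add: whisker_r_def)
  show "Comp X (whisker_r C F \<tau> y) (AMap (fcomp C G F) f) = Comp X (AMap (fcomp C K F) f) (whisker_r C F \<tau> x)"
    if f: "f \<in> Hom C x y" for f x y
    using is_nat_Comp[OF assms(3) fun_Hom[OF assms(2) f]] Hom_Obj[OF assms(1) f] HomD(1)[OF f]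
    by (simp add: whisker_r_def)
qed (simp add: whisker_r_def)

lemma whisker_l_is_nat:
  assumes C: "category C" and F: "is_functor C D F" "is_functor C D G" and H: "is_functor D X H"
    and t: "is_nat C D F G \<tau>"
  shows "is_nat C X (fcomp C H F) (fcomp C H G) (whisker_l C H \<tau>)"
proof (rule is_natI)
  show "whisker_l C H \<tau> x \<in> Hom X (OMap (fcomp C H F) x) (OMap (fcomp C H G) x)" if "x \<in> Obj C" for x
    using fun_Hom[OF H is_nat_Hom[OF t that]] that by (simp add: whisker_l_def)
  show "Comp X (whisker_l C H \<tau> y) (AMap (fcomp C H F) f) = Comp X (AMap (fcomp C H G) f) (whisker_l C H \<tau> x)"
    if f: "f \<in> Hom C x y" for f x y
  proof -
    note o = Hom_Obj[OF C f]
    show ?thesis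
      using fun_Comp[OF H fun_Hom[OF F(1) f] is_nat_Hom[OF t o(2)]]
        fun_Comp[OF H is_nat_Hom[OF t o(1)] fun_Hom[OF F(2) f]] is_nat_Comp[OF t f] o HomD(1)[OF f]
      by (simp add: whisker_l_def)
  qed
qed (simp add: whisker_l_def)

lemma s2mor_eqI:
  fixes s t :: "'u s2mor"
  assumes "TSrc s = TSrc t" "TTrg s = TTrg t"
    and "TNat s \<in> extensional A" "TNat t \<in> extensional A" "\<And>x. x \<in> A \<Longrightarrow> TNat s x = TNat t x"
  shows "s = t"
proof -
  have "TNat s = TNat t" by (rule extensionalityI[OF assms(3,4)]) (rule assms(5))
  then show ?thesis using assms(1,2) by (cases s; cases t) simp
qed

lemma vcomp_nat_apply [simp]: "x \<in> Obj C \<Longrightarrow> vcomp_nat C D \<tau> \<sigma> x = Comp D (\<tau> x) (\<sigma> x)"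
  by (simp add: vcomp_nat_def)

lemma id_nat_apply [simp]: "x \<in> Obj C \<Longrightarrow> id_nat C D F x = Idt D (OMap F x)"
  by (simp add: id_nat_def)

lemma vcomp_nat_ext [simp]: "vcomp_nat C D \<tau> \<sigma> \<in> extensional (Obj C)"
  by (simp add: vcomp_nat_def)

lemma id_nat_ext [simp]: "id_nat C D F \<in> extensional (Obj C)"
  by (simp add: id_nat_def)

lemma smor_comp_simps [simp]:
  "MSrc (smor_comp n m) = MSrc m" "MTrg (smor_comp n m) = MTrg n"
  "MFun (smor_comp n m) = fcomp (Base (MSrc m)) (MFun n) (MFun m)"
  "MIx (smor_comp n m) = compose (Ix (MSrc m)) (MIx n) (MIx m)"
  by (simp_all add: smor_comp_def)

lemma sketchD:
  assumes "limit_sketch small ismall S"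
  shows "small_cat small (Base S)" "category (Base S)" "small (Ix S)" "Cone S \<in> extensional (Ix S)"
    "\<alpha> \<in> Ix S \<Longrightarrow> cone_in ismall (Base S) (Cone S \<alpha>)"
  using assms small_catD(1) by (auto simp: limit_sketch_def)

section \<open>The 2-category \<open>LS\<close>\<close>

context sketch_size
begin

abbreviation "lsk \<equiv> limit_sketch small ismall"
abbreviation "K \<equiv> LS small ismall"

lemma LS_simps [simp]:
  "Cell0 K = {S. lsk S}"
  "Src1 K = MSrc" "Trg1 K = MTrg"
  "Src2 K = TSrc" "Trg2 K = TTrg"
  "Comp1 K = smor_comp"
  by (simp_all add: LS_def Let_def)

lemma Cell1_LS:
  "m \<in> Cell1 K \<longleftrightarrow>
     lsk (MSrc m) \<and> lsk (MTrg m) \<and> sketch_mor m"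
  by (simp add: LS_def Let_def)

lemma Cell2_LS:
  "t \<in> Cell2 K \<longleftrightarrow>
     TSrc t \<in> Cell1 K \<and> TTrg t \<in> Cell1 K \<and> sketch_2mor t"
  by (simp add: LS_def Let_def)

lemma Id1_LS [simp]:
  "MSrc (Id1 K S) = S" "MTrg (Id1 K S) = S"
  "MFun (Id1 K S) = id_fctr (Base S)" "MIx (Id1 K S) = (\<lambda>\<alpha>\<in>Ix S. \<alpha>)"
  by (simp_all add: LS_def Let_def)

lemma Id2_LS [simp]:
  "TSrc (Id2 K m) = m" "TTrg (Id2 K m) = m"
  "TNat (Id2 K m) = id_nat (Base (MSrc m)) (Base (MTrg m)) (MFun m)"
  by (simp_all add: LS_def Let_def)

lemma VComp_LS [simp]:
  "TSrc (VComp K t s) = TSrc s" "TTrg (VComp K t s) = TTrg t"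
  "TNat (VComp K t s) =
     vcomp_nat (Base (MSrc (TSrc s))) (Base (MTrg (TSrc s))) (TNat t) (TNat s)"
  by (simp_all add: LS_def Let_def)

lemma HComp_LS [simp]:
  "TSrc (HComp K t s) = smor_comp (TSrc t) (TSrc s)"
  "TTrg (HComp K t s) = smor_comp (TTrg t) (TTrg s)"
  by (simp_all add: LS_def Let_def)

lemma HComp_TNat:
  "TNat (HComp K t s) = vcomp_nat (Base (MSrc (TSrc s))) (Base (MTrg (TSrc t)))
     (whisker_r (Base (MSrc (TSrc s))) (MFun (TTrg s)) (TNat t))
     (whisker_l (Base (MSrc (TSrc s))) (MFun (TSrc t)) (TNat s))"
  by (simp add: LS_def Let_def)

lemma HComp_apply [simp]:
  "x \<in> Obj (Base (MSrc (TSrc s))) \<Longrightarrow> TNat (HComp K t s) x =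
     Comp (Base (MTrg (TSrc t))) (TNat t (OMap (MFun (TTrg s)) x)) (AMap (MFun (TSrc t)) (TNat s x))"
  by (simp add: HComp_TNat vcomp_nat_def whisker_r_def whisker_l_def)

lemma Cell1D:
  assumes "m \<in> Cell1 K"
  shows "lsk (MSrc m)" "lsk (MTrg m)"
    "is_functor (Base (MSrc m)) (Base (MTrg m)) (MFun m)" "MIx m \<in> Ix (MSrc m) \<rightarrow>\<^sub>E Ix (MTrg m)"
    "\<alpha> \<in> Ix (MSrc m) \<Longrightarrow> map_cone (MFun m) (Cone (MSrc m) \<alpha>) = Cone (MTrg m) (MIx m \<alpha>)"
    "category (Base (MSrc m))" "category (Base (MTrg m))"
  using assms sketchD(2) by (auto simp: Cell1_LS sketch_mor_def)

lemma Cell2D: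
  assumes "t \<in> Cell2 K"
  shows "TSrc t \<in> Cell1 K" "TTrg t \<in> Cell1 K"
    "MSrc (TTrg t) = MSrc (TSrc t)" "MTrg (TTrg t) = MTrg (TSrc t)"
    "is_nat (Base (MSrc (TSrc t))) (Base (MTrg (TSrc t))) (MFun (TSrc t)) (MFun (TTrg t)) (TNat t)"
    "TNat t \<in> extensional (Obj (Base (MSrc (TSrc t))))"
    "is_functor (Base (MSrc (TSrc t))) (Base (MTrg (TSrc t))) (MFun (TTrg t))"
proof -
  show *: "TSrc t \<in> Cell1 K" "TTrg t \<in> Cell1 K"
    "MSrc (TTrg t) = MSrc (TSrc t)" "MTrg (TTrg t) = MTrg (TSrc t)"
    "is_nat (Base (MSrc (TSrc t))) (Base (MTrg (TSrc t))) (MFun (TSrc t)) (MFun (TTrg t)) (TNat t)"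
    using assms by (auto simp: Cell2_LS sketch_2mor_def)
  show "TNat t \<in> extensional (Obj (Base (MSrc (TSrc t))))" using *(5) by (simp add: is_nat_def)
  show "is_functor (Base (MSrc (TSrc t))) (Base (MTrg (TSrc t))) (MFun (TTrg t))"
    using Cell1D(3)[OF *(2)] *(3,4) by simp
qed

lemma smor_eqI:
  fixes m n :: "'u smor"
  assumes "m \<in> Cell1 K" "n \<in> Cell1 K"
    and "MSrc m = MSrc n" "MTrg m = MTrg n"
    and "\<And>x. x \<in> Obj (Base (MSrc n)) \<Longrightarrow> OMap (MFun m) x = OMap (MFun n) x"
    and "\<And>f. f \<in> Arr (Base (MSrc n)) \<Longrightarrow> AMap (MFun m) f = AMap (MFun n) f"
    and "\<And>\<alpha>. \<alpha> \<in> Ix (MSrc n) \<Longrightarrow> MIx m \<alpha> = MIx n \<alpha>"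
  shows "m = n"
proof -
  have "MFun m = MFun n"
    by (rule fctr_eqI[of "Base (MSrc n)" _ _ "Base (MTrg n)"])
      (use Cell1D(3)[OF assms(1)] Cell1D(3)[OF assms(2)] assms(3-6) in auto)
  moreover have "MIx m = MIx n"
    by (rule PiE_ext[of _ "Ix (MSrc n)" "\<lambda>_. Ix (MTrg n)"])
      (use Cell1D(4)[OF assms(1)] Cell1D(4)[OF assms(2)] assms(3,4,7) in auto)
  ultimately show ?thesis using assms(3,4) by (cases m; cases n) simp
qed

lemma Id1_Cell1:
  assumes "lsk S" shows "Id1 K S \<in> Cell1 K"
  using assms id_functor[OF sketchD(2)[OF assms]] map_cone_id[OF sketchD(5)[OF assms]]
  by (simp add: Cell1_LS sketch_mor_def)

lemma smor_comp_Cell1: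
  assumes m: "m \<in> Cell1 K" and n: "n \<in> Cell1 K" and eq: "MSrc n = MTrg m"
  shows "smor_comp n m \<in> Cell1 K"
proof -
  note m' = Cell1D[OF m] and n' = Cell1D[OF n, unfolded eq]
  have "compose (Ix (MSrc m)) (MIx n) (MIx m) \<in> Ix (MSrc m) \<rightarrow>\<^sub>E Ix (MTrg n)"
    using m'(4) n'(4) by (auto simp: compose_def)
  moreover have "map_cone (fcomp (Base (MSrc m)) (MFun n) (MFun m)) (Cone (MSrc m) \<alpha>) =
      Cone (MTrg n) (compose (Ix (MSrc m)) (MIx n) (MIx m) \<alpha>)" if \<alpha>: "\<alpha> \<in> Ix (MSrc m)" for \<alpha>
    using map_cone_comp[OF sketchD(5)[OF m'(1) \<alpha>] m'(3), of "MFun n"] m'(5)[OF \<alpha>] \<alpha>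
      n'(5)[OF PiE_mem[OF m'(4) \<alpha>]] by (simp add: compose_def)
  ultimately show ?thesis
    using m' n' fcomp_functor[OF m'(6) m'(3) n'(3)] by (simp add: Cell1_LS sketch_mor_def)
qed

lemma smor_comp_assoc:
  assumes "f \<in> Cell1 K" "g \<in> Cell1 K" "h \<in> Cell1 K"
    "MSrc g = MTrg f" "MSrc h = MTrg g"
  shows "smor_comp h (smor_comp g f) = smor_comp (smor_comp h g) f"
proof (rule smor_eqI)
  show "smor_comp h (smor_comp g f) \<in> Cell1 K"
    "smor_comp (smor_comp h g) f \<in> Cell1 K"
    using assms by (auto intro!: smor_comp_Cell1)
  show "MIx (smor_comp h (smor_comp g f)) \<alpha> = MIx (smor_comp (smor_comp h g) f) \<alpha>"
    if "\<alpha> \<in> Ix (MSrc (smor_comp (smor_comp h g) f))" for \<alpha>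
    using that PiE_mem[OF Cell1D(4)[OF assms(1)]] assms(4) by (simp add: compose_def)
qed (use fun_Obj[OF Cell1D(3)[OF assms(1)]] fun_arr[OF Cell1D(3)[OF assms(1)]] assms(4) in auto)

lemma smor_comp_Id:
  assumes "f \<in> Cell1 K"
  shows "smor_comp f (Id1 K (MSrc f)) = f" "smor_comp (Id1 K (MTrg f)) f = f"
proof -
  note f = Cell1D[OF assms]
  show "smor_comp f (Id1 K (MSrc f)) = f"
    by (rule smor_eqI[OF smor_comp_Cell1[OF Id1_Cell1[OF f(1)] assms] assms])
      (auto simp: compose_def)
  show "smor_comp (Id1 K (MTrg f)) f = f"
    by (rule smor_eqI[OF smor_comp_Cell1[OF assms Id1_Cell1[OF f(2)]] assms])
      (use fun_Obj[OF f(3)] fun_arr[OF f(3)] PiE_mem[OF f(4)] in \<open>auto simp: compose_def\<close>)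
qed

lemma category_cat1_LS: "category (cat1 K)"
proof (rule categoryI)
qed (auto simp: cat1_def Hom_def Cell1D(1,2) Id1_Cell1 smor_comp_Cell1 smor_comp_Id smor_comp_assoc)

lemma Id2_Cell2:
  assumes "m \<in> Cell1 K" shows "Id2 K m \<in> Cell2 K"
  using assms id_nat_is_nat[OF Cell1D(6,7,3)[OF assms]] by (simp add: Cell2_LS sketch_2mor_def)

lemma VComp_Cell2:
  assumes s: "s \<in> Cell2 K" and t: "t \<in> Cell2 K" and eq: "TSrc t = TTrg s"
  shows "VComp K t s \<in> Cell2 K"
proof -
  note s' = Cell2D[OF s] and t' = Cell2D[OF t]
  note m = Cell1D[OF s'(1)]
  have "is_nat (Base (MSrc (TSrc s))) (Base (MTrg (TSrc s))) (MFun (TTrg s)) (MFun (TTrg t)) (TNat t)"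
    "is_functor (Base (MSrc (TSrc s))) (Base (MTrg (TSrc s))) (MFun (TTrg t))"
    using t'(5,7) eq s'(3,4) by simp_all
  then show ?thesis
    using vcomp_is_nat[OF m(6,7,3) s'(7) _ s'(5)] s' t' eq by (simp add: Cell2_LS sketch_2mor_def)
qed

lemma category_catV_LS: "category (catV K)"
proof (rule categoryI)
  fix f x y assume "f \<in> Hom (catV K) x y"
  then have f: "f \<in> Cell2 K" "TSrc f = x" "TTrg f = y" by (auto simp: catV_def Hom_def)
  note f' = Cell2D[OF f(1), unfolded f(2,3)]
  note X = Cell1D[OF f'(1)]
  show "Comp (catV K) f (Idt (catV K) x) = f"
    by (rule s2mor_eqI[of _ _ "Obj (Base (MSrc x))"])
      (use f f'(6) Comp_Idt[OF X(7) is_nat_Hom[OF f'(5)]] in \<open>auto simp: catV_def\<close>)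
  show "Comp (catV K) (Idt (catV K) y) f = f"
    by (rule s2mor_eqI[of _ _ "Obj (Base (MSrc x))"])
      (use f f'(3,4,6) Idt_Comp[OF X(7) is_nat_Hom[OF f'(5)]] in \<open>auto simp: catV_def\<close>)
next
  fix f g h x y z w
  assume "f \<in> Hom (catV K) x y" "g \<in> Hom (catV K) y z"
    "h \<in> Hom (catV K) z w"
  then have f: "f \<in> Cell2 K" "TSrc f = x" "TTrg f = y"
    and g: "g \<in> Cell2 K" "TSrc g = y" "TTrg g = z"
    and h: "h \<in> Cell2 K" "TSrc h = z" "TTrg h = w" by (auto simp: catV_def Hom_def)
  note f' = Cell2D[OF f(1), unfolded f(2,3)] and g' = Cell2D[OF g(1), unfolded g(2,3)]
    and h' = Cell2D[OF h(1), unfolded h(2,3)]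
  note X = Cell1D[OF f'(1)]
  have s: "MSrc y = MSrc x" "MTrg y = MTrg x" "MSrc z = MSrc x" "MTrg z = MTrg x"
    using f'(3,4) g'(3,4) by auto
  show "Comp (catV K) h (Comp (catV K) g f) =
      Comp (catV K) (Comp (catV K) h g) f"
    by (rule s2mor_eqI[of _ _ "Obj (Base (MSrc x))"])
      (use f g h s Comp_assoc[OF X(7) is_nat_Hom[OF f'(5)] is_nat_Hom[OF g'(5)[unfolded s]] is_nat_Hom[OF h'(5)[unfolded s]]]
        in \<open>auto simp: catV_def\<close>)
qed (auto simp: catV_def Hom_def Id2_Cell2 VComp_Cell2 Cell2D(1,2))

lemma HComp_Cell2:
  assumes s: "s \<in> Cell2 K" and t: "t \<in> Cell2 K"
    and eq: "MSrc (TSrc t) = MTrg (TSrc s)"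
  shows "HComp K t s \<in> Cell2 K"
proof -
  note s' = Cell2D[OF s] and t' = Cell2D[OF t, unfolded eq]
  note m = Cell1D[OF s'(1)] and n = Cell1D[OF t'(1), unfolded eq]
  have "is_nat (Base (MSrc (TSrc s))) (Base (MTrg (TSrc t)))
      (fcomp (Base (MSrc (TSrc s))) (MFun (TSrc t)) (MFun (TSrc s)))
      (fcomp (Base (MSrc (TSrc s))) (MFun (TTrg t)) (MFun (TTrg s))) (TNat (HComp K t s))"
    unfolding HComp_TNat
    by (rule vcomp_is_nat[OF m(6) n(7) fcomp_functor[OF m(6,3) n(3)] fcomp_functor[OF m(6) s'(7) n(3)]
          fcomp_functor[OF m(6) s'(7) t'(7)] whisker_l_is_nat[OF m(6,3) s'(7) n(3) s'(5)]
          whisker_r_is_nat[OF m(6) s'(7) t'(5)]])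
  moreover have "smor_comp (TSrc t) (TSrc s) \<in> Cell1 K"
    "smor_comp (TTrg t) (TTrg s) \<in> Cell1 K"
    using smor_comp_Cell1[OF s'(1) t'(1) eq] smor_comp_Cell1[OF s'(2) t'(2)] s' t' eq by auto
  ultimately show ?thesis using s' t' by (simp add: Cell2_LS sketch_2mor_def)
qed

lemma HComp_ext [simp]: "TNat (HComp K t s) \<in> extensional (Obj (Base (MSrc (TSrc s))))"
  by (simp add: HComp_TNat)

lemma category_catH_LS: "category (catH K)"
proof (rule categoryI)
  fix f S T assume "f \<in> Hom (catH K) S T"
  then have f: "f \<in> Cell2 K" "MSrc (TSrc f) = S" "MTrg (TSrc f) = T"
    by (auto simp: catH_def Hom_def)
  note f' = Cell2D[OF f(1), unfolded f(2,3)]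
  note m = Cell1D[OF f'(1), unfolded f(2,3)] and n = Cell1D[OF f'(2), unfolded f'(3,4)]
  have 1: "AMap (id_fctr (Base T)) (TNat f x) = TNat f x" if "x \<in> Obj (Base S)" for x
    using HomD(1)[OF is_nat_Hom[OF f'(5) that]] by simp
  show "Comp (catH K) f (Idt (catH K) S) = f"
    by (rule s2mor_eqI[of _ _ "Obj (Base S)"])
      (use f f' smor_comp_Id(1)[OF f'(1)] smor_comp_Id(1)[OF f'(2)]
        HComp_ext[of f "Id2 K (Id1 K S)"]
        Comp_Idt[OF m(7) is_nat_Hom[OF f'(5)]] fun_Idt[OF m(3)] in \<open>auto simp: catH_def\<close>)
  show "Comp (catH K) (Idt (catH K) T) f = f"
    by (rule s2mor_eqI[of _ _ "Obj (Base S)"])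
      (use f f' smor_comp_Id(2)[OF f'(1)] smor_comp_Id(2)[OF f'(2)]
        HComp_ext[of "Id2 K (Id1 K T)" f] 1
        Idt_Comp[OF m(7) is_nat_Hom[OF f'(5)]] fun_Obj[OF f'(7)] in \<open>auto simp: catH_def\<close>)
next
  fix f g h S T U V
  assume "f \<in> Hom (catH K) S T" "g \<in> Hom (catH K) T U"
    "h \<in> Hom (catH K) U V"
  then have f: "f \<in> Cell2 K" "MSrc (TSrc f) = S" "MTrg (TSrc f) = T"
    and g: "g \<in> Cell2 K" "MSrc (TSrc g) = T" "MTrg (TSrc g) = U"
    and h: "h \<in> Cell2 K" "MSrc (TSrc h) = U" "MTrg (TSrc h) = V"
    by (auto simp: catH_def Hom_def)
  note f' = Cell2D[OF f(1), unfolded f(2,3)] and g' = Cell2D[OF g(1), unfolded g(2,3)]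
    and h' = Cell2D[OF h(1), unfolded h(2,3)]
  note fs = Cell1D[OF f'(1), unfolded f(2,3)] and gs = Cell1D[OF g'(1), unfolded g(2,3)]
    and hs = Cell1D[OF h'(1), unfolded h(2,3)]
  show "Comp (catH K) h (Comp (catH K) g f) =
      Comp (catH K) (Comp (catH K) h g) f"
  proof (rule s2mor_eqI[of _ _ "Obj (Base S)"])
    fix x assume x: "x \<in> Obj (Base S)"
    let ?y = "OMap (MFun (TTrg f)) x"
    have y: "?y \<in> Obj (Base T)" by (rule fun_Obj[OF f'(7) x])
    have a: "TNat f x \<in> Hom (Base T) (OMap (MFun (TSrc f)) x) ?y" by (rule is_nat_Hom[OF f'(5) x])
    note b = is_nat_Hom[OF g'(5) y]
    note ga = fun_Hom[OF gs(3) a]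
    note hb = fun_Hom[OF hs(3) b] and hga = fun_Hom[OF hs(3) ga]
    note c = is_nat_Hom[OF h'(5) fun_Obj[OF g'(7) y]]
    show "TNat (Comp (catH K) h (Comp (catH K) g f)) x =
      TNat (Comp (catH K) (Comp (catH K) h g) f) x"
      using x y f(2,3) f'(3) g(2,3) h(2,3) HomD(1)[OF a] fun_Comp[OF hs(3) ga b] Comp_assoc[OF hs(7) hga hb c]
      by (simp add: catH_def)
  qed (use f g h f' g' h' smor_comp_assoc[OF f'(1) g'(1) h'(1)] smor_comp_assoc[OF f'(2) g'(2) h'(2)]
      HComp_ext[of h "HComp K g f"]
      HComp_ext[of "HComp K h g" f] in \<open>auto simp: catH_def\<close>)
qed (auto simp: catH_def Hom_def Id2_Cell2 Id1_Cell1 HComp_Cell2 Cell2D(1,2) Cell1D(1,2))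

lemma LS_interchange:
  assumes a: "a \<in> Cell2 K" and a': "a' \<in> Cell2 K"
    and b: "b \<in> Cell2 K" and b': "b' \<in> Cell2 K"
    and e: "TSrc a' = TTrg a" "TSrc b' = TTrg b" "MSrc (TSrc b) = MTrg (TSrc a)"
  shows "HComp K (VComp K b' b) (VComp K a' a) =
     VComp K (HComp K b' a') (HComp K b a)"
proof (rule s2mor_eqI[of _ _ "Obj (Base (MSrc (TSrc a)))"])
  note aD = Cell2D[OF a] and bD = Cell2D[OF b, unfolded e(3)] and a'D = Cell2D[OF a', unfolded e(1)]
    and b'D = Cell2D[OF b', unfolded e(2)]
  note m = Cell1D[OF aD(1)] and n = Cell1D[OF bD(1), unfolded e(3)]
  fix x assume x: "x \<in> Obj (Base (MSrc (TSrc a)))"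
  let ?X = "Base (MTrg (TSrc b))"
  note ax = is_nat_Hom[OF aD(5) x]
  have a'x: "TNat a' x \<in> Hom (Base (MTrg (TSrc a))) (OMap (MFun (TTrg a)) x) (OMap (MFun (TTrg a')) x)"
    using is_nat_Hom[OF a'D(5)] x aD(3,4) by simp
  have y2: "OMap (MFun (TTrg a)) x \<in> Obj (Base (MTrg (TSrc a)))"
    and y3: "OMap (MFun (TTrg a')) x \<in> Obj (Base (MTrg (TSrc a)))"
    using Hom_Obj[OF m(7) a'x] by auto
  note b2 = is_nat_Hom[OF bD(5) y2] and b3 = is_nat_Hom[OF bD(5) y3]
  have b'3: "TNat b' (OMap (MFun (TTrg a')) x) \<in> Hom ?X (OMap (MFun (TTrg b)) (OMap (MFun (TTrg a')) x))
      (OMap (MFun (TTrg b')) (OMap (MFun (TTrg a')) x))"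
    using is_nat_Hom[OF b'D(5)] y3 bD(3,4) by simp
  note na = fun_Hom[OF n(3) ax] and na' = fun_Hom[OF n(3) a'x]
  note n'a' = fun_Hom[OF bD(7) a'x]
  let ?b3 = "TNat b (OMap (MFun (TTrg a')) x)" and ?b2 = "TNat b (OMap (MFun (TTrg a)) x)"
    and ?b'3 = "TNat b' (OMap (MFun (TTrg a')) x)"
    and ?na = "AMap (MFun (TSrc b)) (TNat a x)" and ?na' = "AMap (MFun (TSrc b)) (TNat a' x)"
    and ?n'a' = "AMap (MFun (TTrg b)) (TNat a' x)"
  have "Comp ?X (Comp ?X ?b'3 ?b3) (Comp ?X ?na' ?na) = Comp ?X ?b'3 (Comp ?X ?b3 (Comp ?X ?na' ?na))"
    by (rule Comp_assoc[OF n(7) Comp_Hom[OF n(7) na na'] b3 b'3, symmetric])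
  also have "Comp ?X ?b3 (Comp ?X ?na' ?na) = Comp ?X (Comp ?X ?b3 ?na') ?na"
    by (rule Comp_assoc[OF n(7) na na' b3])
  \<comment> \<open>The one step beyond associativity and functoriality: naturality of
    \<open>b\<close> at the component of \<open>a'\<close>.\<close>
  also have "Comp ?X ?b3 ?na' = Comp ?X ?n'a' ?b2" by (rule is_nat_Comp[OF bD(5) a'x])
  also have "Comp ?X (Comp ?X ?n'a' ?b2) ?na = Comp ?X ?n'a' (Comp ?X ?b2 ?na)"
    by (rule Comp_assoc[OF n(7) na b2 n'a', symmetric])
  also have "Comp ?X ?b'3 (Comp ?X ?n'a' (Comp ?X ?b2 ?na)) = Comp ?X (Comp ?X ?b'3 ?n'a') (Comp ?X ?b2 ?na)"
    by (rule Comp_assoc[OF n(7) Comp_Hom[OF n(7) na b2] n'a' b'3])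
  finally show "TNat (HComp K (VComp K b' b) (VComp K a' a)) x =
     TNat (VComp K (HComp K b' a') (HComp K b a)) x"
    using x y2 y3 e aD(3,4) bD(3,4) fun_Comp[OF n(3) ax a'x] by simp
qed (use HComp_ext[of "VComp K b' b" "VComp K a' a"] in simp_all)

lemma two_category_LS: "two_category K"
proof -
  have "HComp K (Id2 K g) (Id2 K f) =
      Id2 K (smor_comp g f)"
    if f: "f \<in> Cell1 K" and g: "g \<in> Cell1 K" and e: "MSrc g = MTrg f" for f g
  proof (rule s2mor_eqI[of _ _ "Obj (Base (MSrc f))"])
    note f' = Cell1D[OF f] and g' = Cell1D[OF g, unfolded e]
    fix x assume x: "x \<in> Obj (Base (MSrc f))"
    have y: "OMap (MFun f) x \<in> Obj (Base (MTrg f))" by (rule fun_Obj[OF f'(3) x])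
    show "TNat (HComp K (Id2 K g) (Id2 K f)) x =
        TNat (Id2 K (smor_comp g f)) x"
      using x y e fun_Idt[OF g'(3) y] Comp_Idt[OF g'(7) Idt_Hom[OF g'(7) fun_Obj[OF g'(3) y]]] by simp
  qed (use HComp_ext[of "Id2 K g" "Id2 K f"]
      id_nat_ext[of "Base (MSrc f)"] in simp_all)
  then show ?thesis
    unfolding two_category_def
    using category_cat1_LS category_catV_LS category_catH_LS LS_interchange
    by (auto simp: Cell2D(3,4))
qed

end

text \<open>The laws are inherited. Since the two 1-cells of a 2-cell are parallel, a 2-cell
  retained because of its source has its target 1-cell in the subcategory as well.\<close>

lemma two_category_full_sub:
  assumes K: "two_category K" shows "two_category (full_sub K P)"
proof -
  have c: "category (cat1 K)" "category (catV K)" "category (catH K)"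
    and st: "\<And>a. a \<in> Cell2 K \<Longrightarrow> Src1 K (Src2 K a) = Src1 K (Trg2 K a) \<and> Trg1 K (Src2 K a) = Trg1 K (Trg2 K a)"
    using K unfolding two_category_def by blast+
  have "category (cat1 (full_sub K P))" "category (catV (full_sub K P))"
    using c(1,2) st unfolding category_def by (auto simp: cat1_def catV_def full_sub_def Hom_def)
  moreover have "category (catH (full_sub K P))"
    using c(3) unfolding category_def by (auto simp: catH_def full_sub_def Hom_def)
  ultimately show ?thesis
    using K unfolding two_category_def by (simp add: full_sub_def)
qed

section \<open>Reflective full sub-2-categories\<close>

text \<open>Functoriality of \<open>F\<close> is not assumed; it follows by cancelling the unit with
  \<open>unique1\<close> and \<open>unique2\<close>. Existence of extensions along the unit is
  contained in \<open>F1\<close> and \<open>counit\<close>: a 1-cell \<open>g\<close> to an object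
  satisfying \<open>P\<close> extends to the retraction following \<open>F1 F g\<close>.\<close>

locale two_reflection =
  fixes K :: "('o, 'f, 'c) two_cat" and P :: "'o \<Rightarrow> bool"
    and F :: "('o, 'f, 'c, 'o, 'f, 'c) two_fun" and \<eta> :: "'o \<Rightarrow> 'f"
  assumes two_category: "two_category K"
    and F0: "x \<in> Cell0 K \<Longrightarrow> F0 F x \<in> Cell0 K" "x \<in> Cell0 K \<Longrightarrow> P (F0 F x)"
    and unit: "x \<in> Cell0 K \<Longrightarrow> \<eta> x \<in> Hom (cat1 K) x (F0 F x)"
    and F1: "f \<in> Hom (cat1 K) x y \<Longrightarrow> F1 F f \<in> Hom (cat1 K) (F0 F x) (F0 F y)"
    and F1_unit: "f \<in> Hom (cat1 K) x y \<Longrightarrow> Comp1 K (F1 F f) (\<eta> x) = Comp1 K (\<eta> y) f"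
    and F2: "a \<in> Hom (catV K) f g \<Longrightarrow> F2 F a \<in> Hom (catV K) (F1 F f) (F1 F g)"
    and F2_unit: "a \<in> Hom (catH K) x y \<Longrightarrow> HComp K (F2 F a) (Id2 K (\<eta> x)) = HComp K (Id2 K (\<eta> y)) a"
    and counit: "y \<in> Cell0 K \<Longrightarrow> P y \<Longrightarrow> \<exists>e\<in>Hom (cat1 K) (F0 F y) y. Comp1 K e (\<eta> y) = Id1 K y"
    and unique1: "x \<in> Cell0 K \<Longrightarrow> P y \<Longrightarrow> g \<in> Hom (cat1 K) (F0 F x) y \<Longrightarrow> g' \<in> Hom (cat1 K) (F0 F x) y \<Longrightarrow>
       Comp1 K g (\<eta> x) = Comp1 K g' (\<eta> x) \<Longrightarrow> g = g'"
    and unique2: "x \<in> Cell0 K \<Longrightarrow> P y \<Longrightarrow> g \<in> Hom (cat1 K) (F0 F x) y \<Longrightarrow>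
       a \<in> Hom (catV K) g g' \<Longrightarrow> a' \<in> Hom (catV K) g g' \<Longrightarrow>
       HComp K a (Id2 K (\<eta> x)) = HComp K a' (Id2 K (\<eta> x)) \<Longrightarrow> a = a'"
begin

lemma cat1: "category (cat1 K)" and catV: "category (catV K)" and catH: "category (catH K)"
  using two_category unfolding two_category_def by blast+

lemma cat_simps [simp]:
  "Obj (cat1 K) = Cell0 K" "Arr (cat1 K) = Cell1 K" "Dom (cat1 K) = Src1 K" "Cod (cat1 K) = Trg1 K"
  "Idt (cat1 K) = Id1 K" "Comp (cat1 K) = Comp1 K"
  "Obj (catV K) = Cell1 K" "Arr (catV K) = Cell2 K" "Dom (catV K) = Src2 K" "Cod (catV K) = Trg2 K"
  "Idt (catV K) = Id2 K" "Comp (catV K) = VComp K"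
  "Obj (catH K) = Cell0 K" "Arr (catH K) = Cell2 K" "Idt (catH K) = (\<lambda>x. Id2 K (Id1 K x))"
  "Comp (catH K) = HComp K" "Dom (catH K) = (\<lambda>a. Src1 K (Src2 K a))"
  "Cod (catH K) = (\<lambda>a. Trg1 K (Src2 K a))"
  by (simp_all add: cat1_def catV_def catH_def)

lemmas comp1 = Comp_Hom[OF cat1, unfolded cat_simps] and assoc1 = Comp_assoc[OF cat1, unfolded cat_simps]
  and idl1 = Idt_Comp[OF cat1, unfolded cat_simps] and idr1 = Comp_Idt[OF cat1, unfolded cat_simps]
  and id1 = Idt_Hom[OF cat1, unfolded cat_simps]
lemmas compV = Comp_Hom[OF catV, unfolded cat_simps] and idlV = Idt_Comp[OF catV, unfolded cat_simps]
  and idV = Idt_Hom[OF catV, unfolded cat_simps]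
lemmas compH = Comp_Hom[OF catH, unfolded cat_simps] and assocH = Comp_assoc[OF catH, unfolded cat_simps]
  and idlH = Idt_Comp[OF catH, unfolded cat_simps] and idrH = Comp_Idt[OF catH, unfolded cat_simps]

lemma catV_catH:
  assumes "a \<in> Hom (catV K) f g" "f \<in> Hom (cat1 K) x y"
  shows "a \<in> Hom (catH K) x y" "g \<in> Hom (cat1 K) x y"
  using assms two_category arr_Obj(2)[OF catV, of a] unfolding two_category_def Hom_def by auto

lemma Id2_Hom: "f \<in> Hom (cat1 K) x y \<Longrightarrow> Id2 K f \<in> Hom (catV K) f f"
  using idV[of f] by (simp add: Hom_def)

lemma Id2_HomH: "f \<in> Hom (cat1 K) x y \<Longrightarrow> Id2 K f \<in> Hom (catH K) x y"
  using catV_catH(1)[OF Id2_Hom] by blast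

lemma HComp_V:
  assumes "a \<in> Hom (catV K) f f'" "f \<in> Hom (cat1 K) x y" "b \<in> Hom (catV K) g g'" "g \<in> Hom (cat1 K) y z"
  shows "HComp K b a \<in> Hom (catV K) (Comp1 K g f) (Comp1 K g' f')"
  using HomD(1)[OF compH[OF catV_catH(1)[OF assms(1,2)] catV_catH(1)[OF assms(3,4)]]] assms two_category
  unfolding two_category_def Hom_def by auto

lemma HComp_Id2:
  "f \<in> Hom (cat1 K) x y \<Longrightarrow> g \<in> Hom (cat1 K) y z \<Longrightarrow> HComp K (Id2 K g) (Id2 K f) = Id2 K (Comp1 K g f)"
  using two_category unfolding two_category_def Hom_def by auto

lemma interchange:
  assumes "a \<in> Hom (catV K) f f'" "a' \<in> Hom (catV K) f' f''" "f \<in> Hom (cat1 K) x y"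
    and "b \<in> Hom (catV K) g g'" "b' \<in> Hom (catV K) g' g''" "g \<in> Hom (cat1 K) y z"
  shows "HComp K (VComp K b' b) (VComp K a' a) = VComp K (HComp K b' a') (HComp K b a)"
  using two_category assms unfolding two_category_def Hom_def by simp

lemma cell2E:
  assumes "a \<in> Cell2 K"
  obtains f g x y where "a \<in> Hom (catV K) f g" "f \<in> Hom (cat1 K) x y" "x \<in> Cell0 K" "y \<in> Cell0 K"
    "Src2 K a = f" "Trg2 K a = g" "Src1 K f = x" "Trg1 K f = y"
proof (rule that[of "Src2 K a" "Trg2 K a" "Src1 K (Src2 K a)" "Trg1 K (Src2 K a)"])
  show "a \<in> Hom (catV K) (Src2 K a) (Trg2 K a)" using assms by (simp add: Hom_def)
  have "Src2 K a \<in> Cell1 K" using arr_Obj(1)[OF catV] assms by simp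
  then show "Src2 K a \<in> Hom (cat1 K) (Src1 K (Src2 K a)) (Trg1 K (Src2 K a))"
    "Src1 K (Src2 K a) \<in> Cell0 K" "Trg1 K (Src2 K a) \<in> Cell0 K"
    using arr_Obj[OF cat1, of "Src2 K a"] by (auto simp: Hom_def)
qed simp_all

lemma Hom_Cell0:
  assumes "f \<in> Hom (cat1 K) x y" shows "x \<in> Cell0 K" "y \<in> Cell0 K"
  using Hom_Obj[OF cat1 assms] by simp_all

section \<open>2-functoriality of \<open>F\<close>, by cancelling the unit\<close>

lemma F1_Id1: "x \<in> Cell0 K \<Longrightarrow> F1 F (Id1 K x) = Id1 K (F0 F x)"
  by (rule unique1[OF _ F0(2) F1[OF id1] id1[OF F0(1)]])
    (simp_all add: F1_unit[OF id1] idr1[OF unit] idl1[OF unit])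

lemma F1_Comp1:
  assumes f: "f \<in> Hom (cat1 K) x y" and g: "g \<in> Hom (cat1 K) y z"
  shows "F1 F (Comp1 K g f) = Comp1 K (F1 F g) (F1 F f)"
proof (rule unique1[OF Hom_Cell0(1)[OF f] F0(2)[OF Hom_Cell0(2)[OF g]] F1[OF comp1[OF f g]] comp1[OF F1[OF f] F1[OF g]]])
  note u = unit[OF Hom_Cell0(1)[OF f]] unit[OF Hom_Cell0(1)[OF g]] unit[OF Hom_Cell0(2)[OF g]]
  have "Comp1 K (F1 F (Comp1 K g f)) (\<eta> x) = Comp1 K (Comp1 K (\<eta> z) g) f"
    using F1_unit[OF comp1[OF f g]] assoc1[OF f g u(3)] by simp
  also have "\<dots> = Comp1 K (F1 F g) (Comp1 K (\<eta> y) f)"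
    using F1_unit[OF g] assoc1[OF f u(2) F1[OF g]] by simp
  also have "\<dots> = Comp1 K (Comp1 K (F1 F g) (F1 F f)) (\<eta> x)"
    using F1_unit[OF f] assoc1[OF u(1) F1[OF f] F1[OF g]] by simp
  finally show "Comp1 K (F1 F (Comp1 K g f)) (\<eta> x) = Comp1 K (Comp1 K (F1 F g) (F1 F f)) (\<eta> x)" .
qed

lemma F2_Id2:
  assumes f: "f \<in> Hom (cat1 K) x y" shows "F2 F (Id2 K f) = Id2 K (F1 F f)"
proof (rule unique2[OF Hom_Cell0(1)[OF f] F0(2)[OF Hom_Cell0(2)[OF f]] F1[OF f] F2[OF Id2_Hom[OF f]] Id2_Hom[OF F1[OF f]]])
  note u = unit[OF Hom_Cell0(1)[OF f]] unit[OF Hom_Cell0(2)[OF f]]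
  show "HComp K (F2 F (Id2 K f)) (Id2 K (\<eta> x)) = HComp K (Id2 K (F1 F f)) (Id2 K (\<eta> x))"
    using F2_unit[OF Id2_HomH[OF f]] HComp_Id2[OF f u(2)] HComp_Id2[OF u(1) F1[OF f]] F1_unit[OF f] by simp
qed

lemma F2_VComp:
  assumes a: "a \<in> Hom (catV K) f g" and b: "b \<in> Hom (catV K) g h" and f: "f \<in> Hom (cat1 K) x y"
  shows "F2 F (VComp K b a) = VComp K (F2 F b) (F2 F a)"
proof (rule unique2[OF Hom_Cell0(1)[OF f] F0(2)[OF Hom_Cell0(2)[OF f]] F1[OF f] F2[OF compV[OF a b]] compV[OF F2[OF a] F2[OF b]]])
  note u = unit[OF Hom_Cell0(1)[OF f]] unit[OF Hom_Cell0(2)[OF f]]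
  note i = Id2_Hom[OF u(1)] Id2_Hom[OF u(2)]
  \<comment> \<open>With the identity 2-cell of the unit written as a vertical composite with
    itself, the interchange law distributes whiskering over vertical composition.\<close>
  have ii: "VComp K (Id2 K (\<eta> x)) (Id2 K (\<eta> x)) = Id2 K (\<eta> x)" "VComp K (Id2 K (\<eta> y)) (Id2 K (\<eta> y)) = Id2 K (\<eta> y)"
    using idlV[OF i(1)] idlV[OF i(2)] .
  have "HComp K (F2 F (VComp K b a)) (Id2 K (\<eta> x)) = VComp K (HComp K (Id2 K (\<eta> y)) b) (HComp K (Id2 K (\<eta> y)) a)"
    using F2_unit[OF catV_catH(1)[OF compV[OF a b] f]] interchange[OF a b f i(2) i(2) u(2)] ii(2) by simp
  also have "\<dots> = VComp K (HComp K (F2 F b) (Id2 K (\<eta> x))) (HComp K (F2 F a) (Id2 K (\<eta> x)))"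
    using F2_unit[OF catV_catH(1)[OF a f]] F2_unit[OF catV_catH(1)[OF b catV_catH(2)[OF a f]]] by simp
  also have "\<dots> = HComp K (VComp K (F2 F b) (F2 F a)) (Id2 K (\<eta> x))"
    using interchange[OF i(1) i(1) u(1) F2[OF a] F2[OF b] F1[OF f]] ii(1) by simp
  finally show "HComp K (F2 F (VComp K b a)) (Id2 K (\<eta> x)) = HComp K (VComp K (F2 F b) (F2 F a)) (Id2 K (\<eta> x))" .
qed

lemma F2_HComp:
  assumes a: "a \<in> Hom (catV K) f f'" and f: "f \<in> Hom (cat1 K) x y"
    and b: "b \<in> Hom (catV K) g g'" and g: "g \<in> Hom (cat1 K) y z"
  shows "F2 F (HComp K b a) = HComp K (F2 F b) (F2 F a)"
proof (rule unique2[OF Hom_Cell0(1)[OF f] F0(2)[OF Hom_Cell0(2)[OF g]] F1[OF comp1[OF f g]] F2[OF HComp_V[OF a f b g]]])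
  note f' = catV_catH(2)[OF a f] and g' = catV_catH(2)[OF b g]
  \<comment> \<open>\<open>unique2\<close> compares parallel 2-cells, and \<open>F1_Comp1\<close> at
    both ends makes these two parallel.\<close>
  show "HComp K (F2 F b) (F2 F a) \<in> Hom (catV K) (F1 F (Comp1 K g f)) (F1 F (Comp1 K g' f'))"
    using HComp_V[OF F2[OF a] F1[OF f] F2[OF b] F1[OF g]] F1_Comp1[OF f g] F1_Comp1[OF f' g'] by simp
  note u = Id2_HomH[OF unit[OF Hom_Cell0(1)[OF f]]] Id2_HomH[OF unit[OF Hom_Cell0(1)[OF g]]]
    Id2_HomH[OF unit[OF Hom_Cell0(2)[OF g]]]
  note aH = catV_catH(1)[OF a f] and bH = catV_catH(1)[OF b g] and FaH = catV_catH(1)[OF F2[OF a] F1[OF f]]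
    and FbH = catV_catH(1)[OF F2[OF b] F1[OF g]]
  have "HComp K (F2 F (HComp K b a)) (Id2 K (\<eta> x)) = HComp K (HComp K (Id2 K (\<eta> z)) b) a"
    using F2_unit[OF compH[OF aH bH]] assocH[OF aH bH u(3)] by simp
  also have "\<dots> = HComp K (F2 F b) (HComp K (Id2 K (\<eta> y)) a)"
    using F2_unit[OF bH] assocH[OF aH u(2) FbH] by simp
  also have "\<dots> = HComp K (HComp K (F2 F b) (F2 F a)) (Id2 K (\<eta> x))"
    using F2_unit[OF aH] assocH[OF u(1) FaH FbH] by simp
  finally show "HComp K (F2 F (HComp K b a)) (Id2 K (\<eta> x)) = HComp K (HComp K (F2 F b) (F2 F a)) (Id2 K (\<eta> x))" .
qed

text \<open>By \<open>unique1\<close> there is only one candidate for objects satisfying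
  \<open>P\<close>. The equation that defines it is one of the two triangle identities.\<close>

definition \<epsilon> :: "'o \<Rightarrow> 'f" where
  "\<epsilon> y = (SOME e. e \<in> Hom (cat1 K) (F0 F y) y \<and> Comp1 K e (\<eta> y) = Id1 K y)"

lemma \<epsilon>:
  assumes "y \<in> Cell0 K" "P y"
  shows "\<epsilon> y \<in> Hom (cat1 K) (F0 F y) y" "Comp1 K (\<epsilon> y) (\<eta> y) = Id1 K y"
  using someI_ex[of "\<lambda>e. e \<in> Hom (cat1 K) (F0 F y) y \<and> Comp1 K e (\<eta> y) = Id1 K y"] counit[OF assms]
  unfolding \<epsilon>_def by auto

lemma counit_natural1:
  assumes f: "f \<in> Hom (cat1 K) x y" and P: "P x" "P y"
  shows "Comp1 K (\<epsilon> y) (F1 F f) = Comp1 K f (\<epsilon> x)"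
proof -
  note x = Hom_Cell0(1)[OF f] and y = Hom_Cell0(2)[OF f]
  note ex = \<epsilon>[OF x P(1)] and ey = \<epsilon>[OF y P(2)]
  show ?thesis
  proof (rule unique1[OF x P(2) comp1[OF F1[OF f] ey(1)] comp1[OF ex(1) f]])
    have "Comp1 K (Comp1 K (\<epsilon> y) (F1 F f)) (\<eta> x) = Comp1 K (\<epsilon> y) (Comp1 K (\<eta> y) f)"
      using assoc1[OF unit[OF x] F1[OF f] ey(1)] F1_unit[OF f] by simp
    also have "\<dots> = f" using assoc1[OF f unit[OF y] ey(1)] ey(2) idl1[OF f] by simp
    also have "\<dots> = Comp1 K (Comp1 K f (\<epsilon> x)) (\<eta> x)"
      using assoc1[OF unit[OF x] ex(1) f] ex(2) idr1[OF f] by simp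
    finally show "Comp1 K (Comp1 K (\<epsilon> y) (F1 F f)) (\<eta> x) = Comp1 K (Comp1 K f (\<epsilon> x)) (\<eta> x)" .
  qed
qed

lemma counit_natural2:
  assumes a: "a \<in> Hom (catV K) f g" and f: "f \<in> Hom (cat1 K) x y" and P: "P x" "P y"
  shows "HComp K (Id2 K (\<epsilon> y)) (F2 F a) = HComp K a (Id2 K (\<epsilon> x))"
proof -
  note x = Hom_Cell0(1)[OF f] and y = Hom_Cell0(2)[OF f] and g = catV_catH(2)[OF a f]
  note ex = \<epsilon>[OF x P(1)] and ey = \<epsilon>[OF y P(2)] and aH = catV_catH(1)[OF a f]
  note u = unit[OF x] unit[OF y]
  show ?thesis
  proof (rule unique2[OF x P(2) comp1[OF ex(1) f] _ HComp_V[OF Id2_Hom[OF ex(1)] ex(1) a f]])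
    \<comment> \<open>Naturality of the counit at the two ends of \<open>a\<close> makes the 2-cells
      parallel, as \<open>unique2\<close> requires.\<close>
    show "HComp K (Id2 K (\<epsilon> y)) (F2 F a) \<in> Hom (catV K) (Comp1 K f (\<epsilon> x)) (Comp1 K g (\<epsilon> x))"
      using HComp_V[OF F2[OF a] F1[OF f] Id2_Hom[OF ey(1)] ey(1)] counit_natural1[OF f P] counit_natural1[OF g P]
      by simp
    have "HComp K (HComp K (Id2 K (\<epsilon> y)) (F2 F a)) (Id2 K (\<eta> x)) = HComp K (Id2 K (\<epsilon> y)) (HComp K (Id2 K (\<eta> y)) a)"
      using assocH[OF Id2_HomH[OF u(1)] catV_catH(1)[OF F2[OF a] F1[OF f]] Id2_HomH[OF ey(1)]] F2_unit[OF aH] by simp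
    also have "\<dots> = a"
      using assocH[OF aH Id2_HomH[OF u(2)] Id2_HomH[OF ey(1)]] HComp_Id2[OF u(2) ey(1)] ey(2) idlH[OF aH] by simp
    also have "\<dots> = HComp K (HComp K a (Id2 K (\<epsilon> x))) (Id2 K (\<eta> x))"
      using assocH[OF Id2_HomH[OF u(1)] Id2_HomH[OF ex(1)] aH] HComp_Id2[OF u(1) ex(1)] ex(2) idrH[OF aH] by simp
    finally show "HComp K (HComp K (Id2 K (\<epsilon> y)) (F2 F a)) (Id2 K (\<eta> x)) =
        HComp K (HComp K a (Id2 K (\<epsilon> x))) (Id2 K (\<eta> x))" .
  qed
qed

text \<open>After composition with \<open>\<eta> x\<close>, naturality of the unit turns the left
  side into the counit following two units, and the retraction property removes one of them.\<close>

lemma triangle: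
  assumes x: "x \<in> Cell0 K" shows "Comp1 K (\<epsilon> (F0 F x)) (F1 F (\<eta> x)) = Id1 K (F0 F x)"
proof (rule unique1[OF x F0(2)[OF x] _ id1[OF F0(1)[OF x]]])
  note u = unit[OF x] and e = \<epsilon>[OF F0[OF x]]
  show "Comp1 K (\<epsilon> (F0 F x)) (F1 F (\<eta> x)) \<in> Hom (cat1 K) (F0 F x) (F0 F x)" by (rule comp1[OF F1[OF u] e(1)])
  have "Comp1 K (Comp1 K (\<epsilon> (F0 F x)) (F1 F (\<eta> x))) (\<eta> x) = Comp1 K (\<epsilon> (F0 F x)) (Comp1 K (\<eta> (F0 F x)) (\<eta> x))"
    using assoc1[OF u F1[OF u] e(1)] F1_unit[OF u] by simp
  also have "\<dots> = Comp1 K (Id1 K (F0 F x)) (\<eta> x)"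
    using assoc1[OF u unit[OF F0(1)[OF x]] e(1)] e(2) by simp
  finally show "Comp1 K (Comp1 K (\<epsilon> (F0 F x)) (F1 F (\<eta> x))) (\<eta> x) = Comp1 K (Id1 K (F0 F x)) (\<eta> x)" .
qed

lemma full_sub_sel [simp]:
  "Cell0 (full_sub K P) = {x \<in> Cell0 K. P x}"
  "Cell1 (full_sub K P) = {f \<in> Cell1 K. P (Src1 K f) \<and> P (Trg1 K f)}"
  "Cell2 (full_sub K P) = {a \<in> Cell2 K. P (Src1 K (Src2 K a)) \<and> P (Trg1 K (Src2 K a))}"
  "Src1 (full_sub K P) = Src1 K" "Trg1 (full_sub K P) = Trg1 K"
  "Src2 (full_sub K P) = Src2 K" "Trg2 (full_sub K P) = Trg2 K"
  "Id1 (full_sub K P) = Id1 K" "Id2 (full_sub K P) = Id2 K"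
  "Comp1 (full_sub K P) = Comp1 K" "VComp (full_sub K P) = VComp K" "HComp (full_sub K P) = HComp K"
  by (simp_all add: full_sub_def)

lemma two_functor_F: "two_functor K (full_sub K P) F"
proof -
  let ?M = "full_sub K P"
  let ?F01 = "\<lparr>OMap = F0 F, AMap = F1 F\<rparr>"
  let ?F12 = "\<lparr>OMap = F1 F, AMap = F2 F\<rparr>"
  let ?F02 = "\<lparr>OMap = F0 F, AMap = F2 F\<rparr>"
  have H1: "f \<in> Hom (cat1 ?M) x y \<longleftrightarrow> f \<in> Hom (cat1 K) x y \<and> P x \<and> P y" for f x y
    unfolding Hom_def by (auto simp: cat1_def)
  have 1: "functorial (cat1 K) (cat1 ?M) ?F01"
  proof (rule functorialI)
    fix f x y assume f: "f \<in> Hom (cat1 K) x y"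
    show "AMap ?F01 f \<in>
        Hom (cat1 ?M) (OMap ?F01 x) (OMap ?F01 y)"
      using F1[OF f] F0(2) Hom_Cell0[OF f] by (simp add: H1)
  qed (use F0 F1_Id1 F1_Comp1 in \<open>simp_all add: cat1_def[of ?M]\<close>)
  have HomV: "a \<in> Hom (catV ?M) f g \<longleftrightarrow> a \<in> Hom (catV K) f g \<and> P (Src1 K f) \<and> P (Trg1 K f)" for a f g
    unfolding Hom_def by (auto simp: catV_def)
  have HomH: "a \<in> Hom (catH ?M) x y \<longleftrightarrow> a \<in> Hom (catH K) x y \<and> P x \<and> P y" for a x y
    unfolding Hom_def by (auto simp: catH_def)
  have F1': "F1 F f \<in> Cell1 K" "Src1 K (F1 F f) = F0 F (Src1 K f)" "Trg1 K (F1 F f) = F0 F (Trg1 K f)"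
    "Src1 K f \<in> Cell0 K" "Trg1 K f \<in> Cell0 K"
    if "f \<in> Cell1 K" for f
    using F1[of f "Src1 K f" "Trg1 K f"] Hom_Cell0[of f "Src1 K f" "Trg1 K f"] that by (auto simp: Hom_def)
  have V1: "f \<in> Cell1 K" if "a \<in> Hom (catV K) f g" for a f g
    using Hom_Obj(1)[OF catV that] by simp
  have C1: "f \<in> Hom (cat1 K) (Src1 K f) (Trg1 K f)" if "f \<in> Cell1 K" for f
    using that by (simp add: Hom_def)
  have 2: "functorial (catV K) (catV ?M) ?F12"
  proof (rule functorialI)
    fix f assume "f \<in> Obj (catV K)"
    then have f: "f \<in> Cell1 K" by simp
    show "OMap ?F12 f \<in> Obj (catV ?M)"
      using F1'[OF f] F0(2) by (simp add: catV_def[of ?M])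
    show "AMap ?F12 (Idt (catV K) f) =
        Idt (catV ?M) (OMap ?F12 f)"
      using F2_Id2[OF C1[OF f]] by (simp add: catV_def[of ?M])
  next
    fix a f g assume a: "a \<in> Hom (catV K) f g"
    show "AMap ?F12 a \<in>
        Hom (catV ?M) (OMap ?F12 f) (OMap ?F12 g)"
      using F2[OF a] F1'[OF V1[OF a]] F0(2) by (simp add: HomV)
    fix b h assume b: "b \<in> Hom (catV K) g h"
    show "AMap ?F12 (Comp (catV K) b a) =
        Comp (catV ?M) (AMap ?F12 b) (AMap ?F12 a)"
      using F2_VComp[OF a b C1[OF V1[OF a]]] by (simp add: catV_def[of ?M])
  qed
  \<comment> \<open>Endpoints in the horizontal category are 0-cells; the 1-cells of a 2-cell are
    recovered here so that the preceding lemmas apply.\<close>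
  have HVE: "\<exists>f g. a \<in> Hom (catV K) f g \<and> f \<in> Hom (cat1 K) x y" if "a \<in> Hom (catH K) x y" for a x y
  proof -
    have a: "a \<in> Cell2 K" "Src1 K (Src2 K a) = x" "Trg1 K (Src2 K a) = y"
      using that by (auto simp: Hom_def)
    show ?thesis using a cell2E[OF a(1)] by metis
  qed
  have 3: "functorial (catH K) (catH ?M) ?F02"
  proof (rule functorialI)
    fix x assume "x \<in> Obj (catH K)"
    then have x: "x \<in> Cell0 K" by simp
    show "OMap ?F02 x \<in> Obj (catH ?M)" using F0[OF x] by (simp add: catH_def[of ?M])
    show "AMap ?F02 (Idt (catH K) x) =
        Idt (catH ?M) (OMap ?F02 x)"
      using F2_Id2[OF id1[OF x]] F1_Id1[OF x] by (simp add: catH_def[of ?M])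
  next
    fix a x y assume "a \<in> Hom (catH K) x y"
    then obtain f f' where a: "a \<in> Hom (catV K) f f'" "f \<in> Hom (cat1 K) x y" using HVE by blast
    show "AMap ?F02 a \<in>
        Hom (catH ?M) (OMap ?F02 x) (OMap ?F02 y)"
      using catV_catH(1)[OF F2[OF a(1)] F1[OF a(2)]] F0(2) Hom_Cell0[OF a(2)] by (simp add: HomH)
    fix b z assume "b \<in> Hom (catH K) y z"
    then obtain g g' where b: "b \<in> Hom (catV K) g g'" "g \<in> Hom (cat1 K) y z" using HVE by blast
    show "AMap ?F02 (Comp (catH K) b a) =
        Comp (catH ?M) (AMap ?F02 b) (AMap ?F02 a)"
      using F2_HComp[OF a b] by (simp add: catH_def[of ?M])
  qed
  show ?thesis unfolding two_functor_def using 1 2 3 by blast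
qed

lemma two_functor_inclusion: "two_functor (full_sub K P) K two_id"
  unfolding two_functor_def functorial_def
  using cat1 catV catH by (auto simp: two_id_def cat1_def catV_def catH_def)

theorem left_two_adjoint_inclusion: "left_two_adjoint K (full_sub K P) F two_id"
proof -
  let ?M = "full_sub K P"
  have \<eta>: "two_natural K K two_id (two_comp two_id F) \<eta>"
    unfolding two_natural_def
  proof (intro conjI ballI)
    fix f assume f: "f \<in> Cell1 K"
    show "Comp1 K (\<eta> (Trg1 K f)) (F1 two_id f) = Comp1 K (F1 (two_comp two_id F) f) (\<eta> (Src1 K f))"
      using F1_unit[of f "Src1 K f" "Trg1 K f"] f by (simp add: two_id_def two_comp_def Hom_def)
  next
    fix a assume a: "a \<in> Cell2 K"
    show "HComp K (Id2 K (\<eta> (Trg1 K (Src2 K a)))) (F2 two_id a) =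
        HComp K (F2 (two_comp two_id F) a) (Id2 K (\<eta> (Src1 K (Src2 K a))))"
      using F2_unit[of a "Src1 K (Src2 K a)" "Trg1 K (Src2 K a)"] a
      by (simp add: two_id_def two_comp_def Hom_def)
  qed (use unit in \<open>simp add: two_id_def two_comp_def\<close>)
  have \<epsilon>': "two_natural ?M ?M (two_comp F two_id) two_id \<epsilon>"
    unfolding two_natural_def
  proof (intro conjI ballI)
    fix x assume "x \<in> Cell0 ?M"
    then have x: "x \<in> Cell0 K" "P x" by auto
    show "\<epsilon> x \<in> Hom (cat1 ?M) (F0 (two_comp F two_id) x) (F0 two_id x)"
      using \<epsilon>(1)[OF x] F0(2)[OF x(1)] x(2) by (simp add: two_id_def two_comp_def cat1_def Hom_def)
  next
    fix f assume f: "f \<in> Cell1 ?M"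
    show "Comp1 ?M (\<epsilon> (Trg1 ?M f)) (F1 (two_comp F two_id) f) = Comp1 ?M (F1 two_id f) (\<epsilon> (Src1 ?M f))"
      using counit_natural1[of f "Src1 K f" "Trg1 K f"] f by (simp add: two_id_def two_comp_def Hom_def)
  next
    fix a assume a: "a \<in> Cell2 ?M"
    then have "a \<in> Cell2 K" by simp
    then obtain f g x y where "a \<in> Hom (catV K) f g" "f \<in> Hom (cat1 K) x y" "x \<in> Cell0 K" "y \<in> Cell0 K"
      "Src2 K a = f" "Trg2 K a = g" "Src1 K f = x" "Trg1 K f = y"
      by (rule cell2E)
    then show "HComp ?M (Id2 ?M (\<epsilon> (Trg1 ?M (Src2 ?M a)))) (F2 (two_comp F two_id) a) =
        HComp ?M (F2 two_id a) (Id2 ?M (\<epsilon> (Src1 ?M (Src2 ?M a))))"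
      using counit_natural2[of a f g x y] a by (simp add: two_id_def two_comp_def)
  qed
  have tri: "\<forall>x\<in>Cell0 K. Comp1 ?M (\<epsilon> (F0 F x)) (F1 F (\<eta> x)) = Id1 ?M (F0 F x)"
    "\<forall>y\<in>Cell0 ?M. Comp1 K (F1 two_id (\<epsilon> y)) (\<eta> (F0 two_id y)) = Id1 K (F0 two_id y)"
    using triangle \<epsilon>(2) by (simp_all add: two_id_def)
  show ?thesis
    unfolding left_two_adjoint_def
    by (intro conjI exI[of _ \<eta>] exI[of _ \<epsilon>] two_category two_category_full_sub two_functor_F
        two_functor_inclusion \<eta> \<epsilon>' tri)
qed

end

section \<open>Universal realization as a reflection\<close>

context size_pair
begin

lemma sketch_ctx: "limit_sketch small ismall S \<Longrightarrow> sketch_ctx small ismall S"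
  by unfold_locales

lemma Fr0_simps [simp]:
  "Base (Fr0 small S) = Fib small S" "Ix (Fr0 small S) = Ix S"
  "\<alpha> \<in> Ix S \<Longrightarrow> Cone (Fr0 small S) \<alpha> = map_cone (Lbang small S) (Cone S \<alpha>)"
  by (simp_all add: Fr0_def)

lemma Fr0_sketch:
  assumes S: "lsk S" shows "lsk (Fr0 small S)"
proof -
  interpret sketch_ctx small ismall S by (rule sketch_ctx[OF S])
  show ?thesis
    unfolding limit_sketch_def
    using small_Ef small_Ix cone_in_map[OF cat_E cone_E cat_Ef fun_Lf] by (simp add: Fr0_def)
qed

lemma Fr0_realized:
  assumes S: "lsk S" shows "realized (Fr0 small S)"
  unfolding realized_def using sketch_ctx.Fib_limit_cone[OF sketch_ctx[OF S]] by simp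

text \<open>The identity on indices, because \<open>Fr\<close> keeps the index set and replaces each
  cone by its image in \<open>Fib\<close>.\<close>

definition unit :: "'u sketch \<Rightarrow> 'u smor" where
  "unit S = \<lparr>MSrc = S, MTrg = Fr0 small S, MFun = Lbang small S, MIx = (\<lambda>\<alpha>\<in>Ix S. \<alpha>)\<rparr>"

lemma unit_simps [simp]:
  "MSrc (unit S) = S" "MTrg (unit S) = Fr0 small S" "MFun (unit S) = Lbang small S"
  "MIx (unit S) = (\<lambda>\<alpha>\<in>Ix S. \<alpha>)"
  by (simp_all add: unit_def)

lemma unit_Cell1:
  assumes S: "lsk S" shows "unit S \<in> Cell1 K"
  using S Fr0_sketch[OF S] sketch_ctx.fun_Lf[OF sketch_ctx[OF S]] by (simp add: Cell1_LS sketch_mor_def)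

text \<open>A sketch morphism sends the specified cones to specified cones of the target, and these
  are limit cones when the target is realized.\<close>

lemma Cell1_model:
  assumes m: "m \<in> Cell1 K" and r: "realized (MTrg m)"
  shows "model small (MSrc m) (Base (MTrg m)) (MFun m)"
proof -
  note m' = Cell1D[OF m]
  show ?thesis
  proof (rule sketch_ctx.limit_cones_model[OF sketch_ctx[OF m'(1)] sketchD(1)[OF m'(2)] m'(3)])
    fix \<alpha> assume \<alpha>: "\<alpha> \<in> Ix (MSrc m)"
    then show "limit_cone (Base (MTrg m)) (map_cone (MFun m) (Cone (MSrc m) \<alpha>))"
      using r PiE_mem[OF m'(4) \<alpha>] m'(5)[OF \<alpha>] by (simp add: realized_def)
  qed
qed

text \<open>Extending the underlying functor suffices: the cones of \<open>Fr0\<close> are images of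
  cones of \<open>S\<close>, so the extension treats them as \<open>m\<close> treats the original
  ones.\<close>

lemma extend_Cell1:
  assumes m: "m \<in> Cell1 K" and S: "MSrc m = S"
    and H: "is_functor (Fib small S) (Base (MTrg m)) H" "fcomp (Base S) H (Lbang small S) = MFun m"
  shows "\<lparr>MSrc = Fr0 small S, MTrg = MTrg m, MFun = H, MIx = MIx m\<rparr> \<in> Cell1 K" (is "?n \<in> _")
    and "smor_comp \<lparr>MSrc = Fr0 small S, MTrg = MTrg m, MFun = H, MIx = MIx m\<rparr> (unit S) = m"
proof -
  note m' = Cell1D[OF m, unfolded S]
  interpret sketch_ctx small ismall S by (rule sketch_ctx[OF m'(1)])
  have "map_cone H (map_cone Lf (Cone S \<alpha>)) = Cone (MTrg m) (MIx m \<alpha>)" if \<alpha>: "\<alpha> \<in> Ix S" for \<alpha>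
    using map_cone_comp[OF cone_E[OF \<alpha>] fun_Lf, of H] H(2) m'(5)[OF \<alpha>] by simp
  then show n: "?n \<in> Cell1 K"
    using m' H(1) Fr0_sketch[OF m'(1)] by (simp add: Cell1_LS sketch_mor_def)
  have "smor_comp ?n (unit S) \<in> Cell1 K" using smor_comp_Cell1[OF unit_Cell1[OF m'(1)] n] by simp
  then show "smor_comp ?n (unit S) = m"
    by (rule smor_eqI[OF _ m]) (use S H(2) in \<open>auto simp: compose_def\<close>)
qed

lemma unit_unique1:
  assumes S: "lsk S" and g: "g \<in> Cell1 K" "g' \<in> Cell1 K" and Sg: "MSrc g = Fr0 small S" "MSrc g' = Fr0 small S"
    and T: "MTrg g = MTrg g'" "realized (MTrg g)" and eq: "smor_comp g (unit S) = smor_comp g' (unit S)"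
  shows "g = g'"
proof (rule smor_eqI[OF g])
  interpret sketch_ctx small ismall S by (rule sketch_ctx[OF S])
  \<comment> \<open>The composite with the unit is a model because its target is realized, so the
    universal property of \<open>Fib\<close> determines the underlying functor.\<close>
  have "model small S (Base (MTrg g)) (fcomp E (MFun g) Lf)"
    using Cell1_model[OF smor_comp_Cell1[OF unit_Cell1[OF S] g(1)]] Sg T by simp
  moreover have "fcomp E (MFun g) Lf = fcomp E (MFun g') Lf" using arg_cong[OF eq, of MFun] by simp
  ultimately have "MFun g = MFun g'"
    using Fib_functor_eq[of "Base (MTrg g)" _ "MFun g" "MFun g'"] Cell1D(3)[OF g(1)] Cell1D(3)[OF g(2)] Sg T by simp
  then show "\<And>x. OMap (MFun g) x = OMap (MFun g') x" "\<And>f. AMap (MFun g) f = AMap (MFun g') f" by simp_all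
  show "MIx g \<alpha> = MIx g' \<alpha>" if "\<alpha> \<in> Ix (MSrc g')" for \<alpha>
    using fun_cong[OF arg_cong[OF eq, of MIx], of \<alpha>] that Sg by (simp add: compose_def)
qed (use Sg T in simp_all)

lemma HComp_Id2_right:
  assumes a: "a \<in> Cell2 K" and m: "m \<in> Cell1 K" and e: "MSrc (TSrc a) = MTrg m"
    and x: "x \<in> Obj (Base (MSrc m))"
  shows "TNat (HComp K a (Id2 K m)) x = TNat a (OMap (MFun m) x)"
proof -
  note a' = Cell2D[OF a, unfolded e] and n = Cell1D[OF Cell2D(1)[OF a], unfolded e]
  have y: "OMap (MFun m) x \<in> Obj (Base (MTrg m))" by (rule fun_Obj[OF Cell1D(3)[OF m] x])
  show ?thesis using x y fun_Idt[OF n(3) y] Comp_Idt[OF n(7) is_nat_Hom[OF a'(5) y]] by simp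
qed

lemma HComp_Id2_left:
  assumes a: "a \<in> Cell2 K" and m: "m \<in> Cell1 K" and e: "MSrc m = MTrg (TSrc a)"
    and x: "x \<in> Obj (Base (MSrc (TSrc a)))"
  shows "TNat (HComp K (Id2 K m) a) x = AMap (MFun m) (TNat a x)"
proof -
  note a' = Cell2D[OF a] and n = Cell1D[OF m, unfolded e]
  have y: "OMap (MFun (TTrg a)) x \<in> Obj (Base (MTrg (TSrc a)))" by (rule fun_Obj[OF a'(7) x])
  show ?thesis using x y e Idt_Comp[OF n(7) fun_Hom[OF n(3) is_nat_Hom[OF a'(5) x]]] by simp
qed

text \<open>Whiskering with the unit retains the components at images of objects of the base, and
  every object of \<open>Fib\<close> is such an image.\<close>

lemma unit_unique2:
  assumes S: "lsk S" and a: "a \<in> Cell2 K" "a' \<in> Cell2 K" and e: "TSrc a = TSrc a'" "TTrg a = TTrg a'"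
    and Sa: "MSrc (TSrc a) = Fr0 small S" and eq: "HComp K a (Id2 K (unit S)) = HComp K a' (Id2 K (unit S))"
  shows "a = a'"
proof (rule s2mor_eqI[OF e])
  interpret sketch_ctx small ismall S by (rule sketch_ctx[OF S])
  show "TNat a \<in> extensional (Obj Ef)" "TNat a' \<in> extensional (Obj Ef)"
    using Cell2D(6)[OF a(1)] Cell2D(6)[OF a(2)] e Sa by simp_all
  fix x assume "x \<in> Obj Ef"
  then obtain y where y: "y \<in> Obj E" "x = OMap Lf y" by (rule Fib_obj)
  show "TNat a x = TNat a' x"
    using HComp_Id2_right[OF a(1) unit_Cell1[OF S], of y] HComp_Id2_right[OF a(2) unit_Cell1[OF S], of y]
      eq e Sa y by simp
qed

lemma Fr1:
  assumes m: "m \<in> Cell1 K"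
  shows "Fr1 small m \<in> Cell1 K" "MSrc (Fr1 small m) = Fr0 small (MSrc m)"
    "MTrg (Fr1 small m) = Fr0 small (MTrg m)"
    "smor_comp (Fr1 small m) (unit (MSrc m)) = smor_comp (unit (MTrg m)) m"
proof -
  note m' = Cell1D[OF m]
  let ?n = "smor_comp (unit (MTrg m)) m"
  have n: "?n \<in> Cell1 K" by (rule smor_comp_Cell1[OF m unit_Cell1[OF m'(2)]]) simp
  \<comment> \<open>The target \<open>Fr0 small (MTrg m)\<close> is realized, so
    \<open>Fib_universal\<close> applies and the \<open>THE\<close> in \<open>Fr1\<close>
    denotes.\<close>
  have mod: "model small (MSrc m) (Fib small (MTrg m)) (fcomp (Base (MSrc m)) (Lbang small (MTrg m)) (MFun m))"
    using Cell1_model[OF n] Fr0_realized[OF m'(2)] by simp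
  let ?H = "THE Fh. is_functor (Fib small (MSrc m)) (Fib small (MTrg m)) Fh \<and>
      fcomp (Base (MSrc m)) Fh (Lbang small (MSrc m)) = fcomp (Base (MSrc m)) (Lbang small (MTrg m)) (MFun m)"
  have H: "is_functor (Fib small (MSrc m)) (Fib small (MTrg m)) ?H \<and>
      fcomp (Base (MSrc m)) ?H (Lbang small (MSrc m)) = fcomp (Base (MSrc m)) (Lbang small (MTrg m)) (MFun m)"
    by (rule theI'[OF sketch_ctx.Fib_universal[OF sketch_ctx[OF m'(1)] mod]])
  have "MIx ?n = MIx m"
    using PiE_mem[OF m'(4)] m'(4) by (auto simp: compose_def fun_eq_iff PiE_def extensional_def)
  then have F: "Fr1 small m = \<lparr>MSrc = Fr0 small (MSrc m), MTrg = MTrg ?n, MFun = ?H, MIx = MIx ?n\<rparr>"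
    by (simp add: Fr1_def Let_def)
  show "Fr1 small m \<in> Cell1 K" "smor_comp (Fr1 small m) (unit (MSrc m)) = ?n"
    unfolding F using H by (intro extend_Cell1[OF n]; simp)+
  show "MSrc (Fr1 small m) = Fr0 small (MSrc m)" "MTrg (Fr1 small m) = Fr0 small (MTrg m)"
    by (simp_all add: F)
qed

lemma Fr1_OMap:
  assumes m: "m \<in> Cell1 K" and x: "x \<in> Obj (Base (MSrc m))"
  shows "OMap (MFun (Fr1 small m)) (OMap (Lbang small (MSrc m)) x) = OMap (Lbang small (MTrg m)) (OMap (MFun m) x)"
  using arg_cong[OF Fr1(4)[OF m], of "\<lambda>n. OMap (MFun n) x"] x by simp

lemma Fr1_AMap:
  assumes m: "m \<in> Cell1 K" and f: "f \<in> Arr (Base (MSrc m))"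
  shows "AMap (MFun (Fr1 small m)) (AMap (Lbang small (MSrc m)) f) = AMap (Lbang small (MTrg m)) (AMap (MFun m) f)"
  using arg_cong[OF Fr1(4)[OF m], of "\<lambda>n. AMap (MFun n) f"] f by simp

text \<open>The equation with the unit prescribes the components at images of objects of the base.
  As the unit is bijective on objects, they form a unique family on \<open>Fib\<close>, and
  \<open>Fib_natural\<close> extends its naturality from the image of the base to all
  arrows.\<close>

lemma Fr2:
  assumes t: "t \<in> Cell2 K"
  shows "Fr2 small t \<in> Cell2 K" "TSrc (Fr2 small t) = Fr1 small (TSrc t)" "TTrg (Fr2 small t) = Fr1 small (TTrg t)"
    "HComp K (Fr2 small t) (Id2 K (unit (MSrc (TSrc t)))) = HComp K (Id2 K (unit (MTrg (TSrc t)))) t"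
proof -
  let ?S = "MSrc (TSrc t)" and ?T = "MTrg (TSrc t)"
  note t' = Cell2D[OF t]
  note m = Cell1D[OF t'(1)] and n = Cell1D[OF t'(2), unfolded t'(3,4)]
  note Fm = Fr1[OF t'(1)] and Fn = Fr1[OF t'(2), unfolded t'(3,4)]
  have fm: "is_functor (Fib small ?S) (Fib small ?T) (MFun (Fr1 small (TSrc t)))"
    and fn: "is_functor (Fib small ?S) (Fib small ?T) (MFun (Fr1 small (TTrg t)))"
    using Cell1D(3)[OF Fm(1)] Cell1D(3)[OF Fn(1)] Fm Fn by simp_all
  interpret sketch_ctx small ismall ?S by (rule sketch_ctx[OF m(1)])
  interpret T: sketch_ctx small ismall ?T by (rule sketch_ctx[OF m(2)])
  let ?good = "\<lambda>\<theta>. is_nat Ef T.Ef (MFun (Fr1 small (TSrc t))) (MFun (Fr1 small (TTrg t))) \<theta> \<and>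
      whisker_r E Lf \<theta> = whisker_l E T.Lf (TNat t)"
  \<comment> \<open>Injectivity of \<open>Lf\<close> on objects makes this independent of a choice
    of preimage.\<close>
  define \<theta> where "\<theta> = (\<lambda>z\<in>Obj Ef. AMap T.Lf (TNat t (inv_into (Obj E) (OMap Lf) z)))"
  have \<theta>: "\<theta> (OMap Lf x) = AMap T.Lf (TNat t x)" if "x \<in> Obj E" for x
    using that fun_Obj[OF fun_Lf that] inv_into_f_f[OF bij_betw_imp_inj_on[OF Fib_objects] that]
    by (simp add: \<theta>_def)
  have O: "OMap (MFun (Fr1 small (TSrc t))) (OMap Lf x) = OMap T.Lf (OMap (MFun (TSrc t)) x)"
    "OMap (MFun (Fr1 small (TTrg t))) (OMap Lf x) = OMap T.Lf (OMap (MFun (TTrg t)) x)" if "x \<in> Obj E" for x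
    using Fr1_OMap[OF t'(1) that] Fr1_OMap[OF t'(2), of x] that t'(3,4) by simp_all
  have A: "AMap (MFun (Fr1 small (TSrc t))) (AMap Lf f) = AMap T.Lf (AMap (MFun (TSrc t)) f)"
    "AMap (MFun (Fr1 small (TTrg t))) (AMap Lf f) = AMap T.Lf (AMap (MFun (TTrg t)) f)" if "f \<in> Arr E" for f
    using Fr1_AMap[OF t'(1) that] Fr1_AMap[OF t'(2), of f] that t'(3,4) by simp_all
  have \<theta>H: "\<theta> z \<in> Hom T.Ef (OMap (MFun (Fr1 small (TSrc t))) z) (OMap (MFun (Fr1 small (TTrg t))) z)"
    if z: "z \<in> Obj Ef" for z
  proof -
    obtain x where x: "x \<in> Obj E" "z = OMap Lf x" using z by (rule Fib_obj)
    show ?thesis unfolding x(2) \<theta>[OF x(1)] O[OF x(1)]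
      by (rule fun_Hom[OF T.fun_Lf is_nat_Hom[OF t'(5) x(1)]])
  qed
  \<comment> \<open>\<open>TTrg t\<close> sends specified cones of the source to specified cones of
    the target, and the unit of the target sends those to limit cones.\<close>
  have lim: "limit_cone T.Ef (map_cone (fcomp E (MFun (Fr1 small (TTrg t))) Lf) (Cone ?S \<alpha>))"
    if \<alpha>: "\<alpha> \<in> Ix ?S" for \<alpha>
  proof -
    have "fcomp E (MFun (Fr1 small (TTrg t))) Lf = fcomp E T.Lf (MFun (TTrg t))"
      using arg_cong[OF Fn(4), of MFun] t'(3) by simp
    then have "map_cone (fcomp E (MFun (Fr1 small (TTrg t))) Lf) (Cone ?S \<alpha>) =
        map_cone T.Lf (Cone ?T (MIx (TTrg t) \<alpha>))"
      using map_cone_comp[OF cone_E[OF \<alpha>] n(3), of T.Lf] n(5)[OF \<alpha>] by simp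
    then show ?thesis using T.Fib_limit_cone[OF PiE_mem[OF n(4) \<alpha>]] by simp
  qed
  have \<theta>n: "Comp T.Ef (\<theta> (Cod Ef f)) (AMap (MFun (Fr1 small (TSrc t))) f) =
      Comp T.Ef (AMap (MFun (Fr1 small (TTrg t))) f) (\<theta> (Dom Ef f))" if f: "f \<in> Arr Ef" for f
  proof (rule Fib_natural[OF T.cat_Ef lim fm fn \<theta>H _ f])
    fix g assume g: "g \<in> Arr E"
    note gH = arr_Hom[OF g] and o = arr_Obj[OF cat_E g]
    have "AMap T.Lf (Comp (Base ?T) (TNat t (Cod E g)) (AMap (MFun (TSrc t)) g)) =
        AMap T.Lf (Comp (Base ?T) (AMap (MFun (TTrg t)) g) (TNat t (Dom E g)))"
      using is_nat_Comp[OF t'(5) gH] by simp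
    then show "Comp T.Ef (\<theta> (OMap Lf (Cod E g))) (AMap (MFun (Fr1 small (TSrc t))) (AMap Lf g)) =
        Comp T.Ef (AMap (MFun (Fr1 small (TTrg t))) (AMap Lf g)) (\<theta> (OMap Lf (Dom E g)))"
      using fun_Comp[OF T.fun_Lf fun_Hom[OF m(3) gH] is_nat_Hom[OF t'(5) o(2)]]
        fun_Comp[OF T.fun_Lf is_nat_Hom[OF t'(5) o(1)] fun_Hom[OF t'(7) gH]]
      by (simp add: \<theta> o A g)
  qed
  have good: "?good \<theta>"
    using \<theta>H \<theta>n \<theta> by (auto simp: is_nat_def whisker_r_def whisker_l_def) (simp add: \<theta>_def)
  have "\<theta>' = \<theta>" if g: "?good \<theta>'" for \<theta>'
  proof (rule extensionalityI[of _ "Obj Ef"])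
    show "\<theta>' \<in> extensional (Obj Ef)" "\<theta> \<in> extensional (Obj Ef)" using g good by (auto simp: is_nat_def)
    fix z assume "z \<in> Obj Ef"
    then obtain x where x: "x \<in> Obj E" "z = OMap Lf x" by (rule Fib_obj)
    have "whisker_r E Lf \<theta>' = whisker_r E Lf \<theta>" using g good by simp
    then have "whisker_r E Lf \<theta>' x = whisker_r E Lf \<theta> x" by simp
    then show "\<theta>' z = \<theta> z" using x by (simp add: whisker_r_def)
  qed
  then have "(THE \<theta>. ?good \<theta>) = \<theta>" using good by blast
  then have F: "Fr2 small t = \<lparr>TSrc = Fr1 small (TSrc t), TTrg = Fr1 small (TTrg t), TNat = \<theta>\<rparr>"
    by (simp add: Fr2_def Let_def)
  show FC: "Fr2 small t \<in> Cell2 K" unfolding F using good Fm Fn by (simp add: Cell2_LS sketch_2mor_def)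
  show "TSrc (Fr2 small t) = Fr1 small (TSrc t)" "TTrg (Fr2 small t) = Fr1 small (TTrg t)" by (simp_all add: F)
  note u = unit_Cell1[OF m(1)] unit_Cell1[OF m(2)]
  show "HComp K (Fr2 small t) (Id2 K (unit ?S)) = HComp K (Id2 K (unit ?T)) t"
  proof (rule s2mor_eqI[of _ _ "Obj E"])
    show "TSrc (HComp K (Fr2 small t) (Id2 K (unit ?S))) = TSrc (HComp K (Id2 K (unit ?T)) t)"
      "TTrg (HComp K (Fr2 small t) (Id2 K (unit ?S))) = TTrg (HComp K (Id2 K (unit ?T)) t)"
      using Fm(4) Fn(4) t'(3) by (simp_all add: F)
    show "TNat (HComp K (Fr2 small t) (Id2 K (unit ?S))) \<in> extensional (Obj E)"
      "TNat (HComp K (Id2 K (unit ?T)) t) \<in> extensional (Obj E)"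
      using HComp_ext[of "Fr2 small t" "Id2 K (unit ?S)"] by simp_all
    show "TNat (HComp K (Fr2 small t) (Id2 K (unit ?S))) x = TNat (HComp K (Id2 K (unit ?T)) t) x"
      if x: "x \<in> Obj E" for x
      using HComp_Id2_right[OF FC u(1), of x] HComp_Id2_left[OF t u(2), of x] x \<theta>[OF x] Fm(2) by (simp add: F)
  qed
qed

lemma two_reflection_Fr: "two_reflection K realized (Fr small) unit"
proof
  have Hom1: "f \<in> Hom (cat1 K) x y \<longleftrightarrow> f \<in> Cell1 K \<and> MSrc f = x \<and> MTrg f = y" for f x y
    by (simp add: cat1_def Hom_def)
  have HomV: "a \<in> Hom (catV K) f g \<longleftrightarrow> a \<in> Cell2 K \<and> TSrc a = f \<and> TTrg a = g" for a f g
    by (simp add: catV_def Hom_def)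
  have HomH: "a \<in> Hom (catH K) x y \<longleftrightarrow> a \<in> Cell2 K \<and> MSrc (TSrc a) = x \<and> MTrg (TSrc a) = y" for a x y
    by (simp add: catH_def Hom_def)
  show "two_category K" by (rule two_category_LS)
  fix x y f g g' a a'
  show "F0 (Fr small) x \<in> Cell0 K" "realized (F0 (Fr small) x)" "unit x \<in> Hom (cat1 K) x (F0 (Fr small) x)"
    if "x \<in> Cell0 K"
    using that Fr0_sketch Fr0_realized unit_Cell1 by (auto simp: Fr_def Hom1)
  show "F1 (Fr small) f \<in> Hom (cat1 K) (F0 (Fr small) x) (F0 (Fr small) y)"
    "Comp1 K (F1 (Fr small) f) (unit x) = Comp1 K (unit y) f" if "f \<in> Hom (cat1 K) x y"
    using Fr1[of f] that by (auto simp: Fr_def Hom1)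
  show "F2 (Fr small) a \<in> Hom (catV K) (F1 (Fr small) f) (F1 (Fr small) g)" if "a \<in> Hom (catV K) f g"
    using Fr2[of a] that by (auto simp: Fr_def HomV)
  show "HComp K (F2 (Fr small) a) (Id2 K (unit x)) = HComp K (Id2 K (unit y)) a" if "a \<in> Hom (catH K) x y"
    using Fr2(4)[of a] that by (auto simp: Fr_def HomH)
  show "g = g'" if "x \<in> Cell0 K" "realized y" "g \<in> Hom (cat1 K) (F0 (Fr small) x) y"
    "g' \<in> Hom (cat1 K) (F0 (Fr small) x) y" "Comp1 K g (unit x) = Comp1 K g' (unit x)"
    using unit_unique1[of x g g'] that by (auto simp: Fr_def Hom1)
  show "a = a'" if "x \<in> Cell0 K" "realized y" "g \<in> Hom (cat1 K) (F0 (Fr small) x) y"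
    "a \<in> Hom (catV K) g g'" "a' \<in> Hom (catV K) g g'"
    "HComp K a (Id2 K (unit x)) = HComp K a' (Id2 K (unit x))"
    using unit_unique2[of x a a'] that by (auto simp: Fr_def Hom1 HomV)
  show "\<exists>e\<in>Hom (cat1 K) (F0 (Fr small) y) y. Comp1 K e (unit y) = Id1 K y" if "y \<in> Cell0 K" "realized y"
  proof -
    have y: "lsk y" using that by simp
    note i = Id1_Cell1[OF y]
    \<comment> \<open>A realized sketch is a model of itself by the identity functor; the extension
      of the identity to \<open>Fib\<close> is the retraction.\<close>
    have "model small y (Base y) (id_fctr (Base y))" using Cell1_model[OF i] that by simp
    then obtain H where "is_functor (Fib small y) (Base y) H" "fcomp (Base y) H (Lbang small y) = id_fctr (Base y)"
      using sketch_ctx.Fib_universal[OF sketch_ctx[OF y]] by blast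
    then show ?thesis
      using extend_Cell1[OF i, of y H] by (intro bexI[of _ "\<lparr>MSrc = Fr0 small y, MTrg = y, MFun = H, MIx = MIx (Id1 K y)\<rparr>"])
        (auto simp: Fr_def Hom1)
  qed
qed

end

theorem theorem6p7:
  fixes small ismall :: "'u set \<Rightarrow> bool"
  assumes "smallness small ismall"
  shows "left_two_adjoint (LS small ismall) (RLS small ismall) (Fr small) forget"
proof -
  interpret size_pair small ismall by unfold_locales (rule assms)
  interpret two_reflection "LS small ismall" realized "Fr small" unit by (rule two_reflection_Fr)
  \<comment> \<open>\<open>forget\<close> is the identity on all cells, so it unfolds to
    \<open>two_id\<close>, the inclusion in the abstract statement.\<close>
  show ?thesis
    using left_two_adjoint_inclusion by (simp add: RLS_def forget_def two_id_def id_def)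
qed

end
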